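(* The dynamical degree of the complex projective heat map $\mathcal{H}:(\mathbb{P}^2_{\mathbb{C}})^{\mathbb{Z}}\dashrightarrow(\mathbb{P}^2_{\mathbb{C}})^{\mathbb{Z}}$ is $\lambda_1(\mathcal{H})=4$.
   Context: Work over $\mathbb{C}$; $\operatorname{Ind}$ denotes the indeterminacy locus of a rational map. A local rule on $(\mathbb{P}^N)^{\mathbb{Z}}$ is a finite nonempty set $S\subset\mathbb{Z}$ with a rational map $\varphi:(\mathbb{P}^N)^S\dashrightarrow\mathbb{P}^N$. The associated lattice map is the partially defined map $T_\varphi:(\mathbb{P}^N)^{\mathbb{Z}}\dashrightarrow(\mathbb{P}^N)^{\mathbb{Z}}$, $(v_i)_{i}\mapsto(\varphi(v_{i+s}:s\in S))_{i}$. For finite nonempty $A\subset\mathbb{Z}$, the regional map $\varphi_A:(\mathbb{P}^N)^{A+S}\dashrightarrow(\mathbb{P}^N)^A$ is $v\mapsto(\varphi(v_{i+s}:s\in S))_{i\in A}$, where $A+S$ is the Minkowski sum. If $T,T'$ have local rules $(S,\varphi),(S',\varphi')$ and the image of $\varphi_{S'}$ is not contained in $\operatorname{Ind}\varphi'$, then $T'\circ T$ is the lattice map with local rule $\varphi'\circ\varphi_{S'}$ on $S+S'$. Iterates are $T^0=\mathrm{Id}$, $T^m=T\circ T^{m-1}$; $T$ is iterable if all iterates exist. The degree $\deg T$ of a lattice map is the total degree of the multihomogeneous polynomials giving a local rule $\varphi$ of $T$ when written without common factors. The dynamical degree of an iterable lattice map is $\lambda_1(T)=\lim_{m\to\infty}(\deg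 T^m)^{1/m}$ (the limit exists). The heat map $\mathcal{H}$ is the lattice map on $(\mathbb{P}^2)^{\mathbb{Z}}$ (neighborhood $\{0,1,2,3\}$) sending $(v_i)$ to $(v_i')$, where $v_i'$ is the intersection of the line $$\overline{(\overline{v_iv_{i+2}}\cap\overline{v_{i+1}v_{i+3}})\,(\overline{v_iv_{i+1}}\cap\overline{v_{i+2}v_{i+3}})}$$ with the line $\overline{v_{i+1}v_{i+2}}$ (the "projective midpoint" of $v_{i+1}$ and $v_{i+2}$). Here $\overline{pq}$ denotes the line through distinct points $p,q$. The heat map is iterable over $\mathbb{C}$. *)

theory Defs
  imports "HOL-Analysis.Analysis" "HOL-Library.Poly_Mapping" "HOL-Library.Set_Algebras"
begin

section \<open>Complex projective space\<close>

text \<open>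
  Points are the one-dimensional linear subspaces of \<open>complex ^ 'n\<close>, so that \<open>'n proj\<close> is the
  projective space of dimension \<open>CARD('n) - 1\<close> and the projective plane is \<open>3 proj\<close>.
\<close>

typedef 'n::finite proj = "{L :: (complex ^ 'n) set. vec.subspace L \<and> vec.dim L = 1}"
  morphisms subspace_of Abs_proj
proof -
  have "vec.dim (vec.span {axis undefined 1 :: complex ^ 'n}) = 1"
    by (simp add: vec.dim_span vec.dim_eq_card_independent axis_eq_0_iff)
  thus ?thesis
    by (intro exI[of _ "vec.span {axis undefined 1}"]) simp
qed

definition proj_point :: "complex ^ 'n::finite \<Rightarrow> 'n proj" where
  "proj_point x = Abs_proj (vec.span {x})"

definition proj_line :: "'n::finite proj \<Rightarrow> 'n proj \<Rightarrow> 'n proj set" where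
  "proj_line p q = {r. subspace_of r \<subseteq> vec.span (subspace_of p \<union> subspace_of q)}"

section \<open>Rational maps between products of projective spaces\<close>

text \<open>
  The variable \<open>(i, j)\<close> stands for the \<open>j\<close>-th homogeneous coordinate at the site \<open>i\<close>.
\<close>

type_synonym 'n mpoly = "((int \<times> 'n) \<Rightarrow>\<^sub>0 nat) \<Rightarrow>\<^sub>0 complex"

definition mpoly_eval :: "'n mpoly \<Rightarrow> (int \<Rightarrow> complex ^ 'n::finite) \<Rightarrow> complex" where
  "mpoly_eval p x =
     (\<Sum>m\<in>Poly_Mapping.keys p. Poly_Mapping.lookup p m *
        (\<Prod>(i, j)\<in>Poly_Mapping.keys m. (x i $ j) ^ Poly_Mapping.lookup m (i, j)))"

definition tuple_eval :: "('n \<Rightarrow> 'n mpoly) \<Rightarrow> (int \<Rightarrow> complex ^ 'n::finite) \<Rightarrow> complex ^ 'n" where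
  "tuple_eval F x = (\<chi> j. mpoly_eval (F j) x)"

definition multihomogeneous :: "int set \<Rightarrow> (int \<Rightarrow> nat) \<Rightarrow> 'n::finite mpoly \<Rightarrow> bool" where
  "multihomogeneous S d p \<longleftrightarrow>
     (\<forall>m\<in>Poly_Mapping.keys p. Poly_Mapping.keys m \<subseteq> S \<times> UNIV \<and>
        (\<forall>i\<in>S. (\<Sum>j\<in>UNIV. Poly_Mapping.lookup m (i, j)) = d i))"

definition homogeneous_tuple :: "int set \<Rightarrow> (int \<Rightarrow> nat) \<Rightarrow> ('n::finite \<Rightarrow> 'n mpoly) \<Rightarrow> bool" where
  "homogeneous_tuple S d F \<longleftrightarrow> (\<forall>j. multihomogeneous S d (F j)) \<and> (\<exists>j. F j \<noteq> 0)"

definition same_ratios :: "('n \<Rightarrow> 'n mpoly) \<Rightarrow> ('n \<Rightarrow> 'n mpoly) \<Rightarrow> bool" where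
  "same_ratios F G \<longleftrightarrow> (\<forall>j k. F j * G k = F k * G j)"

definition no_common_factor :: "('n \<Rightarrow> 'n mpoly) \<Rightarrow> bool" where
  "no_common_factor F \<longleftrightarrow> (\<forall>h. (\<forall>j. h dvd F j) \<longrightarrow> h dvd 1)"

definition partial_map_of :: "('a \<Rightarrow> 'b \<Rightarrow> bool) \<Rightarrow> 'a \<rightharpoonup> 'b" where
  "partial_map_of R v = (if \<exists>!w. R v w then Some (THE w. R v w) else None)"

text \<open>
  Points of the product of projective spaces over \<open>S\<close> are the elements of \<open>S \<rightarrow>\<^sub>E UNIV\<close>.
  A rational map is defined at a point iff some tuple of multihomogeneous polynomials representing
  it does not vanish there; letting the representative \<open>G\<close> vary with the point makes the domain the
  largest possible one, and its complement is the indeterminacy locus.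
\<close>

definition regular_value ::
    "int set \<Rightarrow> ('n::finite \<Rightarrow> 'n mpoly) \<Rightarrow> (int \<Rightarrow> 'n proj) \<Rightarrow> 'n proj \<Rightarrow> bool" where
  "regular_value S F v w \<longleftrightarrow> v \<in> S \<rightarrow>\<^sub>E UNIV \<and>
     (\<exists>G d x. homogeneous_tuple S d G \<and> same_ratios F G \<and>
        (\<forall>i\<in>S. x i \<noteq> 0 \<and> proj_point (x i) = v i) \<and>
        tuple_eval G x \<noteq> 0 \<and> w = proj_point (tuple_eval G x))"

definition rational_map ::
    "int set \<Rightarrow> ('n::finite \<Rightarrow> 'n mpoly) \<Rightarrow> (int \<Rightarrow> 'n proj) \<rightharpoonup> 'n proj" where
  "rational_map S F = partial_map_of (regular_value S F)"

definition Ind :: "int set \<Rightarrow> ((int \<Rightarrow> 'n::finite proj) \<rightharpoonup> 'n proj) \<Rightarrow> (int \<Rightarrow> 'n proj) set" where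
  "Ind S \<phi> = (S \<rightarrow>\<^sub>E UNIV) - dom \<phi>"

section \<open>Lattice maps\<close>

type_synonym 'n lattice_map = "(int \<Rightarrow> 'n proj) \<rightharpoonup> (int \<Rightarrow> 'n proj)"

definition local_rule :: "int set \<Rightarrow> ((int \<Rightarrow> 'n::finite proj) \<rightharpoonup> 'n proj) \<Rightarrow> bool" where
  "local_rule S \<phi> \<longleftrightarrow> finite S \<and> S \<noteq> {} \<and>
     (\<exists>d F. homogeneous_tuple S d F \<and> \<phi> = rational_map S F)"

definition window :: "int set \<Rightarrow> int \<Rightarrow> (int \<Rightarrow> 'a) \<Rightarrow> int \<Rightarrow> 'a" where
  "window S i v = (\<lambda>s\<in>S. v (i + s))"

definition lattice_map_of ::
    "int set \<Rightarrow> ((int \<Rightarrow> 'n::finite proj) \<rightharpoonup> 'n proj) \<Rightarrow> 'n lattice_map" where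
  "lattice_map_of S \<phi> v =
     (if \<forall>i. window S i v \<in> dom \<phi> then Some (\<lambda>i. the (\<phi> (window S i v))) else None)"

definition regional_map ::
    "int set \<Rightarrow> int set \<Rightarrow> ((int \<Rightarrow> 'n::finite proj) \<rightharpoonup> 'n proj) \<Rightarrow>
     (int \<Rightarrow> 'n proj) \<rightharpoonup> (int \<Rightarrow> 'n proj)" where
  "regional_map A S \<phi> v =
     (if v \<in> (A + S) \<rightarrow>\<^sub>E UNIV \<and> (\<forall>i\<in>A. window S i v \<in> dom \<phi>)
      then Some (\<lambda>i\<in>A. the (\<phi> (window S i v))) else None)"

text \<open>
  The local rule \<open>\<psi>\<close> below is the composite \<open>\<phi>' \<circ> \<phi>\<^sub>S\<^sub>'\<close> as a rational map: it extends the pointwise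
  composite, whose domain may be smaller than the domain of the composite rational map.
  For the same reason \<open>T''\<close> is in general not the pointwise composite of \<open>T'\<close> and \<open>T\<close>.
\<close>

definition is_composite ::
    "'n::finite lattice_map \<Rightarrow> 'n lattice_map \<Rightarrow> 'n lattice_map \<Rightarrow> bool" where
  "is_composite T' T T'' \<longleftrightarrow>
     (\<exists>S \<phi> S' \<phi>' \<psi>.
        local_rule S \<phi> \<and> T = lattice_map_of S \<phi> \<and>
        local_rule S' \<phi>' \<and> T' = lattice_map_of S' \<phi>' \<and>
        \<not> ran (regional_map S' S \<phi>) \<subseteq> Ind S' \<phi>' \<and>
        local_rule (S + S') \<psi> \<and> (\<phi>' \<circ>\<^sub>m regional_map S' S \<phi>) \<subseteq>\<^sub>m \<psi> \<and>
        T'' = lattice_map_of (S + S') \<psi>)"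

inductive is_iterate :: "'n::finite lattice_map \<Rightarrow> nat \<Rightarrow> 'n lattice_map \<Rightarrow> bool"
  for T where
  "is_iterate T 0 Some"
| "is_iterate T m U \<Longrightarrow> is_composite T U U' \<Longrightarrow> is_iterate T (Suc m) U'"

definition iterate :: "'n::finite lattice_map \<Rightarrow> nat \<Rightarrow> 'n lattice_map" where
  "iterate T m = (THE U. is_iterate T m U)"

definition iterable :: "'n::finite lattice_map \<Rightarrow> bool" where
  "iterable T \<longleftrightarrow> (\<forall>m. \<exists>U. is_iterate T m U)"

definition lattice_degree :: "'n::finite lattice_map \<Rightarrow> nat" where
  "lattice_degree T = (THE n. \<exists>S d F. finite S \<and> S \<noteq> {} \<and> homogeneous_tuple S d F \<and>
     no_common_factor F \<and> T = lattice_map_of S (rational_map S F) \<and> n = (\<Sum>i\<in>S. d i))"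

definition has_dynamical_degree :: "'n::finite lattice_map \<Rightarrow> real \<Rightarrow> bool" where
  "has_dynamical_degree T l \<longleftrightarrow> iterable T \<and>
     (\<lambda>m. root m (real (lattice_degree (iterate T m)))) \<longlonglongrightarrow> l"

section \<open>The projective heat map\<close>

definition projective_midpoint :: "(int \<Rightarrow> 3 proj) \<Rightarrow> 3 proj \<Rightarrow> bool" where
  "projective_midpoint v w \<longleftrightarrow> v \<in> {0, 1, 2, 3} \<rightarrow>\<^sub>E UNIV \<and>
     v 0 \<noteq> v 2 \<and> v 1 \<noteq> v 3 \<and> v 0 \<noteq> v 1 \<and> v 2 \<noteq> v 3 \<and> v 1 \<noteq> v 2 \<and>
     (\<exists>a b. proj_line (v 0) (v 2) \<inter> proj_line (v 1) (v 3) = {a} \<and>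
        proj_line (v 0) (v 1) \<inter> proj_line (v 2) (v 3) = {b} \<and>
        a \<noteq> b \<and> proj_line a b \<inter> proj_line (v 1) (v 2) = {w})"

text \<open>
  The geometric construction makes sense only for quadruples in sufficiently general position;
  the local rule is the unique rational map that extends it.
\<close>

definition heat_rule :: "(int \<Rightarrow> 3 proj) \<rightharpoonup> 3 proj" where
  "heat_rule = (THE \<phi>. local_rule {0, 1, 2, 3} \<phi> \<and> partial_map_of projective_midpoint \<subseteq>\<^sub>m \<phi>)"

definition heat_map :: "3 lattice_map" where
  "heat_map = lattice_map_of {0, 1, 2, 3} heat_rule"

end

theory Submission
  imports Defs "HOL-Computational_Algebra.Polynomial" "HOL-Library.Complex_Order"
begin

text \<open>
  In homogeneous coordinates the heat map replaces \<open>x 0\<close> by \<open>[013] x 2 + [023] x 1\<close>, where the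
  brackets are \<open>3 \<times> 3\<close> determinants.  This is of degree one in each of four points, so substituting
  it into itself \<open>m\<close> times gives polynomials of total degree \<open>4 ^ m\<close>.  The point is that they have
  no common factor (\<open>coprime_heat_iterate\<close>); then the \<open>m\<close>-th iterate has degree exactly \<open>4 ^ m\<close>.

  Coprimality is proved by induction on \<open>m\<close>, writing the next iterate as the previous one pulled
  back along one heat step.  The new points, together with finitely many data of the old
  configuration, determine the old points rationally, and the denominators are brackets \<open>[012]\<close>,
  \<open>[013]\<close>, \<open>[023]\<close> of consecutive points.  So a common factor that appears in the pullback must be one
  of these brackets (\<open>coprime_tuple_pullback\<close>, \<open>localized_old_points\<close>), and it remains to find
  for each bracket a zero at which the iterates do not vanish.  Such zeros come from total
  positivity: if all brackets \<open>[ijk]\<close> with \<open>i < j < k\<close> are positive, then the same holds after a heat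
  step (\<open>heat_step_positive\<close>), hence no iterate vanishes there.  For \<open>[012]\<close> a convex polygon with
  one flat vertex serves (\<open>skip3_zero_witness\<close>).  For \<open>[023]\<close> one constructs a configuration that
  becomes positive after one step (\<open>skip1_zero_witness\<close>), and \<open>[013]\<close> follows by reflection.

  The rest connects these polynomial functions with partially defined lattice maps.  A lattice map
  determines its local rule up to a common factor (\<open>lattice_of_eq_imp_parallel\<close>); therefore the
  composites are unique, the iterates are represented by the iterated polynomials, and the degree of
  a coprime representative is the degree of the lattice map.
\<close>

section \<open>Polynomial functions\<close>

inductive polyfun :: "((int \<Rightarrow> complex ^ 'n::finite) \<Rightarrow> complex) \<Rightarrow> bool" where
  polyfun_const: "polyfun (\<lambda>x. c)"
| polyfun_coord: "polyfun (\<lambda>x. x i $ j)"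
| polyfun_add: "polyfun f \<Longrightarrow> polyfun g \<Longrightarrow> polyfun (\<lambda>x. f x + g x)"
| polyfun_mult: "polyfun f \<Longrightarrow> polyfun g \<Longrightarrow> polyfun (\<lambda>x. f x * g x)"

lemma polyfun_uminus: "polyfun f \<Longrightarrow> polyfun (\<lambda>x. - f x)"
  using polyfun_mult[OF polyfun_const[of "-1"], of f] by simp

lemma polyfun_diff: "polyfun f \<Longrightarrow> polyfun g \<Longrightarrow> polyfun (\<lambda>x. f x - g x)"
  using polyfun_add[of f "\<lambda>x. - g x"] polyfun_uminus[of g] by simp

lemma polyfun_sum: "(\<And>a. a \<in> A \<Longrightarrow> polyfun (f a)) \<Longrightarrow> polyfun (\<lambda>x. \<Sum>a\<in>A. f a x)"
  by (induction A rule: infinite_finite_induct) (auto intro: polyfun_const polyfun_add)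

lemma polyfun_prod: "(\<And>a. a \<in> A \<Longrightarrow> polyfun (f a)) \<Longrightarrow> polyfun (\<lambda>x. \<Prod>a\<in>A. f a x)"
  by (induction A rule: infinite_finite_induct) (auto intro: polyfun_const polyfun_mult)

lemma polyfun_power: "polyfun f \<Longrightarrow> polyfun (\<lambda>x. f x ^ n)"
  by (induction n) (auto intro: polyfun_const polyfun_mult)

lemmas polyfun_intros = polyfun_const polyfun_coord polyfun_add polyfun_mult polyfun_uminus
  polyfun_diff polyfun_sum polyfun_prod polyfun_power

lemma polyfun_compose:
  assumes "polyfun f" and "\<And>i j. polyfun (\<lambda>x. \<theta> x i $ j)"
  shows "polyfun (\<lambda>x. f (\<theta> x))"
  using assms(1) by induction (auto intro: polyfun_intros assms(2))

lemma polyfun_on_line: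
  assumes "polyfun f"
  shows "\<exists>p. \<forall>t. f (\<lambda>i. a i + t *s b i) = poly p t"
  using assms
proof induction
  case (polyfun_const c)
  show ?case by (rule exI[of _ "[:c:]"]) simp
next
  case (polyfun_coord i j)
  show ?case by (rule exI[of _ "[:a i $ j, b i $ j:]"]) simp
next
  case (polyfun_add f g)
  then obtain p q where "\<forall>t. f (\<lambda>i. a i + t *s b i) = poly p t"
    "\<forall>t. g (\<lambda>i. a i + t *s b i) = poly q t" by blast
  then show ?case by (intro exI[of _ "p + q"]) simp
next
  case (polyfun_mult f g)
  then obtain p q where "\<forall>t. f (\<lambda>i. a i + t *s b i) = poly p t"
    "\<forall>t. g (\<lambda>i. a i + t *s b i) = poly q t" by blast
  then show ?case by (intro exI[of _ "p * q"]) simp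
qed

lemma polyfun_finite_support:
  assumes "polyfun f"
  shows "\<exists>M. \<forall>x y. (\<forall>i. \<bar>i\<bar> \<le> M \<longrightarrow> x i = y i) \<longrightarrow> f x = f y"
  using assms
proof induction
  case (polyfun_coord i j)
  show ?case by (rule exI[of _ "\<bar>i\<bar>"]) simp
next
  case (polyfun_add f g)
  then obtain M N where "\<forall>x y. (\<forall>i. \<bar>i\<bar> \<le> M \<longrightarrow> x i = y i) \<longrightarrow> f x = f y"
    "\<forall>x y. (\<forall>i. \<bar>i\<bar> \<le> N \<longrightarrow> x i = y i) \<longrightarrow> g x = g y" by blast
  then show ?case by (intro exI[of _ "max M N"]) (metis max.coboundedI1 max.coboundedI2)
next
  case (polyfun_mult f g)
  then obtain M N where "\<forall>x y. (\<forall>i. \<bar>i\<bar> \<le> M \<longrightarrow> x i = y i) \<longrightarrow> f x = f y"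
    "\<forall>x y. (\<forall>i. \<bar>i\<bar> \<le> N \<longrightarrow> x i = y i) \<longrightarrow> g x = g y" by blast
  then show ?case by (intro exI[of _ "max M N"]) (metis max.coboundedI1 max.coboundedI2)
qed simp

text \<open>
  Polynomial functions form an integral domain: join a point where \<open>f\<close> does not vanish to one
  where \<open>g\<close> does not vanish by a line, on which both functions are nonzero polynomials.
\<close>

lemma polyfun_common_nonzero:
  assumes "polyfun f" "polyfun g" "f a \<noteq> 0" "g b \<noteq> 0"
  shows "\<exists>x. f x \<noteq> 0 \<and> g x \<noteq> 0"
proof -
  define l where "l t = (\<lambda>i. a i + t *s (b i - a i))" for t
  obtain p where p: "\<And>t. f (l t) = poly p t"
    using polyfun_on_line[OF assms(1), of a "\<lambda>i. b i - a i"] unfolding l_def by blast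
  obtain q where q: "\<And>t. g (l t) = poly q t"
    using polyfun_on_line[OF assms(2), of a "\<lambda>i. b i - a i"] unfolding l_def by blast
  have "l 0 = a" "l 1 = b" by (auto simp: l_def)
  then have "poly p 0 \<noteq> 0" "poly q 1 \<noteq> 0" using p[of 0] q[of 1] assms by auto
  then have "p * q \<noteq> 0" by auto
  then have "finite {t. poly (p * q) t = 0}" by (rule poly_roots_finite)
  then obtain t where "poly (p * q) t \<noteq> 0"
    using ex_new_if_finite[OF infinite_UNIV_char_0] by blast
  then show ?thesis using p[of t] q[of t] by (intro exI[of _ "l t"]) simp
qed

lemma polyfun_common_nonzero_finite:
  assumes "finite A" "\<And>a. a \<in> A \<Longrightarrow> polyfun (f a)" "\<And>a. a \<in> A \<Longrightarrow> \<exists>x. f a x \<noteq> 0"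
  shows "\<exists>x. \<forall>a\<in>A. f a x \<noteq> 0"
  using assms
proof (induction A)
  case (insert a A)
  then obtain b where "\<forall>a\<in>A. f a b \<noteq> 0" by (metis insertCI)
  moreover obtain c where "f a c \<noteq> 0" using insert.prems(2) by (metis insertCI)
  ultimately have "(\<Prod>a\<in>A. f a b) \<noteq> 0" using insert by simp
  then obtain x where "f a x \<noteq> 0" "(\<Prod>a\<in>A. f a x) \<noteq> 0"
    using polyfun_common_nonzero[of "\<lambda>x. \<Prod>a\<in>A. f a x" "f a" b c] \<open>f a c \<noteq> 0\<close> insert
    by (auto intro: polyfun_prod)
  then show ?case using insert by auto
qed simp

lemma polyfun_eq_if_eq_on_nonzero:
  assumes "polyfun s" "polyfun f" "polyfun g" "s a \<noteq> 0" "\<And>x. s x \<noteq> 0 \<Longrightarrow> f x = g x"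
  shows "f x = g x"
proof (rule ccontr)
  assume "f x \<noteq> g x"
  then obtain y where "s y \<noteq> 0" "f y - g y \<noteq> 0"
    using polyfun_common_nonzero[of s "\<lambda>x. f x - g x" a x] assms by (auto intro: polyfun_diff)
  then show False using assms(5) by simp
qed

lemma polyfun_cancel:
  assumes "polyfun s" "polyfun f" "polyfun g" "s a \<noteq> 0" "\<And>x. s x * f x = s x * g x"
  shows "f x = g x"
  by (rule polyfun_eq_if_eq_on_nonzero[OF assms(1-4)]) (use assms(5) in auto)

section \<open>Prime polynomials\<close>

definition divides ::
    "((int \<Rightarrow> complex ^ 'n::finite) \<Rightarrow> complex) \<Rightarrow> ((int \<Rightarrow> complex ^ 'n) \<Rightarrow> complex) \<Rightarrow> bool"
  where "divides f g \<longleftrightarrow> (\<exists>h. polyfun h \<and> (\<forall>x. g x = f x * h x))"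

definition prime_polyfun :: "((int \<Rightarrow> complex ^ 'n::finite) \<Rightarrow> complex) \<Rightarrow> bool" where
  "prime_polyfun q \<longleftrightarrow> polyfun q \<and> (\<exists>x. q x \<noteq> 0) \<and>
     (\<forall>f g. polyfun f \<and> polyfun g \<and> divides q (\<lambda>x. f x * g x) \<longrightarrow> divides q f \<or> divides q g)"

definition set_coord :: "int \<Rightarrow> 'n \<Rightarrow> complex \<Rightarrow> (int \<Rightarrow> complex ^ 'n::finite) \<Rightarrow> int \<Rightarrow> complex ^ 'n"
  where "set_coord i j c x = x(i := \<chi> l. if l = j then c else x i $ l)"

definition free_of_coord :: "int \<Rightarrow> 'n \<Rightarrow> ((int \<Rightarrow> complex ^ 'n::finite) \<Rightarrow> complex) \<Rightarrow> bool"
  where "free_of_coord i j f \<longleftrightarrow> (\<forall>c x. f (set_coord i j c x) = f x)"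

lemma set_coord_nth: "set_coord i j c x i' $ j' = (if i' = i \<and> j' = j then c else x i' $ j')"
  by (simp add: set_coord_def)

lemma pseudo_division:
  assumes "polyfun s" "polyfun t" "free_of_coord i j s" "free_of_coord i j t" "polyfun f"
  shows "\<exists>e h r. polyfun h \<and> polyfun r \<and> free_of_coord i j r \<and>
           (\<forall>x. s x ^ e * f x = (s x * x i $ j + t x) * h x + r x)"
  using assms(5)
proof induction
  case (polyfun_const c)
  show ?case
    by (rule exI[of _ 0], rule exI[of _ "\<lambda>_. 0"], rule exI[of _ "\<lambda>_. c"])
      (auto simp: free_of_coord_def intro: polyfun_intros)
next
  case (polyfun_coord i' j')
  show ?case
  proof (cases "i' = i \<and> j' = j")
    case True
    then show ?thesis
      by (intro exI[of _ 1] exI[of _ "\<lambda>_. 1"] exI[of _ "\<lambda>x. - t x"])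
        (use assms in \<open>auto simp: free_of_coord_def intro: polyfun_intros\<close>)
  next
    case False
    then show ?thesis
      by (intro exI[of _ 0] exI[of _ "\<lambda>_. 0"] exI[of _ "\<lambda>x. x i' $ j'"])
        (auto simp: free_of_coord_def set_coord_nth intro: polyfun_intros)
  qed
next
  case (polyfun_add f g)
  then obtain e h r e' h' r' where
    1: "polyfun h" "polyfun r" "free_of_coord i j r"
       "\<And>x. s x ^ e * f x = (s x * x i $ j + t x) * h x + r x" and
    2: "polyfun h'" "polyfun r'" "free_of_coord i j r'"
       "\<And>x. s x ^ e' * g x = (s x * x i $ j + t x) * h' x + r' x" by blast
  have "s x ^ (e + e') * (f x + g x)
      = (s x * x i $ j + t x) * (s x ^ e' * h x + s x ^ e * h' x)
        + (s x ^ e' * r x + s x ^ e * r' x)" for x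
  proof -
    have "s x ^ (e + e') * (f x + g x)
        = s x ^ e' * (s x ^ e * f x) + s x ^ e * (s x ^ e' * g x)"
      by (simp add: power_add algebra_simps)
    then show ?thesis unfolding 1(4) 2(4) by (simp add: algebra_simps)
  qed
  then show ?case
    by (intro exI[of _ "e + e'"] exI[of _ "\<lambda>x. s x ^ e' * h x + s x ^ e * h' x"]
          exI[of _ "\<lambda>x. s x ^ e' * r x + s x ^ e * r' x"])
      (use assms 1 2 in \<open>auto simp: free_of_coord_def intro!: polyfun_intros\<close>)
next
  case (polyfun_mult f g)
  then obtain e h r e' h' r' where
    1: "polyfun h" "polyfun r" "free_of_coord i j r"
       "\<And>x. s x ^ e * f x = (s x * x i $ j + t x) * h x + r x" and
    2: "polyfun h'" "polyfun r'" "free_of_coord i j r'"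
       "\<And>x. s x ^ e' * g x = (s x * x i $ j + t x) * h' x + r' x" by blast
  have "s x ^ (e + e') * (f x * g x)
      = (s x * x i $ j + t x) * (h x * ((s x * x i $ j + t x) * h' x + r' x) + r x * h' x)
        + r x * r' x" for x
  proof -
    have "s x ^ (e + e') * (f x * g x) = (s x ^ e * f x) * (s x ^ e' * g x)"
      by (simp add: power_add algebra_simps)
    then show ?thesis unfolding 1(4) 2(4) by (simp add: algebra_simps)
  qed
  then show ?case
    by (intro exI[of _ "e + e'"]
          exI[of _ "\<lambda>x. h x * ((s x * x i $ j + t x) * h' x + r' x) + r x * h' x"]
          exI[of _ "\<lambda>x. r x * r' x"])
      (use assms 1 2 in \<open>auto simp: free_of_coord_def intro!: polyfun_intros\<close>)
qed

text \<open>
  Gauss's lemma for polynomials of degree one: modulo \<open>s X + t\<close> every polynomial becomes free of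
  \<open>X\<close> after multiplication by a power of \<open>s\<close>, and a remainder free of \<open>X\<close> that is divisible by
  \<open>s X + t\<close> vanishes.  The last hypothesis, that \<open>s\<close> is prime to \<open>s X + t\<close>, allows the powers of
  \<open>s\<close> to be cancelled again.
\<close>

lemma prime_polyfun_linear:
  assumes s: "polyfun s" and t: "polyfun t"
    and free: "free_of_coord i j s" "free_of_coord i j t"
    and s0: "s a \<noteq> 0"
    and cop: "\<And>h. polyfun h \<Longrightarrow> divides s (\<lambda>x. (s x * x i $ j + t x) * h x) \<Longrightarrow> divides s h"
  shows "prime_polyfun (\<lambda>x. s x * x i $ j + t x)"
proof -
  let ?q = "\<lambda>x. s x * x i $ j + t x"
  have q: "polyfun ?q" using s t by (intro polyfun_intros)
  have strip: "divides ?q f"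
    if "polyfun f" "polyfun h" "\<And>x. s x ^ e * f x = ?q x * h x" for f h e
    using that
  proof (induction e arbitrary: h)
    case 0
    then show ?case by (auto simp: divides_def)
  next
    case (Suc e)
    have "divides s (\<lambda>x. ?q x * h x)"
      unfolding divides_def using Suc.prems s
      by (intro exI[of _ "\<lambda>x. s x ^ e * f x"]) (auto intro!: polyfun_intros simp: mult.assoc)
    then have "divides s h" using cop Suc.prems by blast
    then obtain g where g: "polyfun g" "\<And>x. h x = s x * g x" by (auto simp: divides_def)
    have "s x ^ e * f x = ?q x * g x" for x
      by (rule polyfun_cancel[OF s _ _ s0])
        (use Suc.prems(1,3) g s t q in
          \<open>auto intro!: polyfun_intros simp: mult.assoc[symmetric] mult.commute[of _ "s _"]\<close>)
    then show ?case using Suc.IH Suc.prems(1) g(1) by blast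
  qed
  show ?thesis unfolding prime_polyfun_def
  proof (intro conjI allI impI)
    have "?q (set_coord i j ((1 - t a) / s a) a) = 1"
      using s0 free by (simp add: free_of_coord_def set_coord_nth)
    then show "\<exists>x. ?q x \<noteq> 0" by (metis zero_neq_one)
  next
    fix f g assume fg: "polyfun f \<and> polyfun g \<and> divides ?q (\<lambda>x. f x * g x)"
    then obtain k where k: "polyfun k" "\<And>x. f x * g x = ?q x * k x" by (auto simp: divides_def)
    obtain e h r where 1: "polyfun h" "polyfun r" "free_of_coord i j r"
       "\<And>x. s x ^ e * f x = ?q x * h x + r x" using pseudo_division[OF s t free] fg by blast
    obtain e' h' r' where 2: "polyfun h'" "polyfun r'" "free_of_coord i j r'"
       "\<And>x. s x ^ e' * g x = ?q x * h' x + r' x" using pseudo_division[OF s t free] fg by blast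
    have rr: "r x * r' x = 0" if "s x \<noteq> 0" for x
    proof -
      define y where "y = set_coord i j (- t x / s x) x"
      have "s y = s x" "t y = t x" "r y = r x" "r' y = r' x"
        using free 1 2 by (auto simp: y_def free_of_coord_def)
      moreover have "?q y = 0"
        using that \<open>s y = s x\<close> \<open>t y = t x\<close> by (simp add: y_def set_coord_nth)
      ultimately show ?thesis
        using 1(4)[of y] 2(4)[of y] k(2)[of y] that by auto
    qed
    have "r x * r' x = 0" for x
      by (rule polyfun_eq_if_eq_on_nonzero[OF s _ _ s0 rr]) (use 1 2 in \<open>auto intro: polyfun_intros\<close>)
    then have "(\<forall>x. r x = 0) \<or> (\<forall>x. r' x = 0)"
      using polyfun_common_nonzero[of r r'] 1 2 by (metis mult_eq_0_iff)
    then show "divides ?q f \<or> divides ?q g"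
      using strip[of f h e] strip[of g h' e'] fg 1 2 by auto
  qed (rule q)
qed

definition det3 :: "complex ^ 3 \<Rightarrow> complex ^ 3 \<Rightarrow> complex ^ 3 \<Rightarrow> complex" where
  "det3 a b c = a $ 1 * (b $ 2 * c $ 3 - b $ 3 * c $ 2) - a $ 2 * (b $ 1 * c $ 3 - b $ 3 * c $ 1)
     + a $ 3 * (b $ 1 * c $ 2 - b $ 2 * c $ 1)"

lemma polyfun_det3:
  assumes "\<And>j. polyfun (\<lambda>x. f x $ j)" "\<And>j. polyfun (\<lambda>x. g x $ j)" "\<And>j. polyfun (\<lambda>x. h x $ j)"
  shows "polyfun (\<lambda>x. det3 (f x) (g x) (h x))"
  unfolding det3_def by (intro polyfun_intros assms)

lemma prime_polyfun_coord: "prime_polyfun (\<lambda>x. x i $ j)"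
proof -
  have "prime_polyfun (\<lambda>x. 1 * x i $ j + 0)"
    by (rule prime_polyfun_linear)
      (auto simp: free_of_coord_def divides_def intro: polyfun_const)
  then show ?thesis by simp
qed

lemma prime_polyfun_minor:
  assumes "a \<noteq> b"
  shows "prime_polyfun (\<lambda>x. x a $ 2 * (x b :: complex ^ 3) $ 3 - x a $ 3 * x b $ 2)"
proof -
  have "prime_polyfun (\<lambda>x. x a $ 2 * (x b :: complex ^ 3) $ 3 + - (x a $ 3 * x b $ 2))"
  proof (rule prime_polyfun_linear[where a = "\<lambda>_. 1"])
    fix h :: "(int \<Rightarrow> complex ^ 3) \<Rightarrow> complex"
    let ?s = "\<lambda>x :: int \<Rightarrow> complex ^ 3. x a $ (2::3)" and ?q = "\<lambda>x :: int \<Rightarrow> complex ^ 3. x a $ 2 * x b $ (3::3) + - (x a $ 3 * x b $ 2)"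
    assume h: "polyfun h" "divides ?s (\<lambda>x. ?q x * h x)"
    have "\<not> divides ?s ?q"
    proof
      assume "divides ?s ?q"
      then obtain g where "\<And>x. ?q x = ?s x * g x" unfolding divides_def by blast
      from this[of "\<lambda>i. if i = a then axis 3 1 else axis 2 1"] show False
        using assms by (simp add: axis_def)
    qed
    moreover have "polyfun ?q" by (intro polyfun_intros)
    ultimately show "divides ?s h"
      using prime_polyfun_coord[of a "2::3"] h unfolding prime_polyfun_def by blast
  qed (use assms in \<open>auto simp: free_of_coord_def set_coord_nth intro!: polyfun_intros\<close>)
  then show ?thesis by simp
qed

text \<open>
  The determinant is linear in the coordinate \<open>x a $ 1\<close>, its leading coefficient is a \<open>2 \<times> 2\<close> minor,
  and the minor is linear with a coordinate as leading coefficient; both steps are instances of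
  the lemma on polynomials of degree one.
\<close>

lemma prime_polyfun_det3:
  assumes "a \<noteq> b" "a \<noteq> c" "b \<noteq> c"
  shows "prime_polyfun (\<lambda>x. det3 (x a) (x b) (x c))"
proof -
  let ?s = "\<lambda>x :: int \<Rightarrow> complex ^ 3. x b $ (2::3) * x c $ 3 - x b $ 3 * x c $ 2"
  let ?t = "\<lambda>x :: int \<Rightarrow> complex ^ 3. x a $ 3 * (x b $ (1::3) * x c $ 2 - x b $ 2 * x c $ 1)
              - x a $ 2 * (x b $ (1::3) * x c $ 3 - x b $ 3 * x c $ 1)"
  have "prime_polyfun (\<lambda>x. ?s x * x a $ 1 + ?t x)"
  proof (rule prime_polyfun_linear[where a = "\<lambda>i. if i = b then axis 2 1 else axis 3 1"])
    fix h :: "(int \<Rightarrow> complex ^ 3) \<Rightarrow> complex"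
    let ?q = "\<lambda>x. ?s x * x a $ 1 + ?t x"
    assume h: "polyfun h" "divides ?s (\<lambda>x. ?q x * h x)"
    have "\<not> divides ?s ?q"
    proof
      assume "divides ?s ?q"
      then obtain g where "\<And>x. ?q x = ?s x * g x" unfolding divides_def by blast
      from this[of "\<lambda>i. if i = a then axis 3 1 else if i = b then axis 1 1 else axis 2 1"]
      show False using assms by (simp add: axis_def)
    qed
    moreover have "polyfun ?q" by (intro polyfun_intros)
    ultimately show "divides ?s h"
      using prime_polyfun_minor[OF assms(3)] h unfolding prime_polyfun_def by blast
  qed (use assms in \<open>auto simp: free_of_coord_def set_coord_nth axis_def intro!: polyfun_intros\<close>)
  then show ?thesis by (simp add: det3_def algebra_simps)
qed

section \<open>Coprime tuples and substitutions\<close>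

text \<open>
  By unique factorization this means that \<open>F\<close> has no common factor.  Stated in this way, coprimality
  can be transported along substitutions without any theory of factorization, and it says directly
  that every other representative of the same rational map is a multiple of \<open>F\<close>.
\<close>

definition coprime_tuple :: "('k \<Rightarrow> (int \<Rightarrow> complex ^ 'n::finite) \<Rightarrow> complex) \<Rightarrow> bool" where
  "coprime_tuple F \<longleftrightarrow> (\<forall>j. polyfun (F j)) \<and>
     (\<forall>P. (\<forall>j. polyfun (P j)) \<and> (\<forall>j k x. F j x * P k x = F k x * P j x) \<longrightarrow>
        (\<exists>N. polyfun N \<and> (\<forall>j x. P j x = N x * F j x)))"

inductive_set monomials_in ::
    "((int \<Rightarrow> complex ^ 'n::finite) \<Rightarrow> complex) set \<Rightarrow> ((int \<Rightarrow> complex ^ 'n) \<Rightarrow> complex) set"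
  for Q where
  monomials_one: "(\<lambda>x. 1) \<in> monomials_in Q"
| monomials_step: "q \<in> Q \<Longrightarrow> D \<in> monomials_in Q \<Longrightarrow> (\<lambda>x. q x * D x) \<in> monomials_in Q"

lemma monomials_mult:
  assumes "D \<in> monomials_in Q" "D' \<in> monomials_in Q"
  shows "(\<lambda>x. D x * D' x) \<in> monomials_in Q"
  using assms(1)
proof induction
  case (monomials_step q D)
  then show ?case
    using monomials_in.monomials_step[of q Q "\<lambda>x. D x * D' x"] by (simp add: mult.assoc)
qed (use assms(2) in simp)

lemma monomials_base: "q \<in> Q \<Longrightarrow> q \<in> monomials_in Q"
  using monomials_step[OF _ monomials_one, of q Q] by simp

text \<open>
  A prime factor of \<open>D\<close> divides every \<open>N * G k\<close> but not every \<open>G k\<close>, hence it divides \<open>N\<close> and can be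
  cancelled on both sides.
\<close>

lemma cancel_monomial:
  assumes "D \<in> monomials_in Q"
    and prime: "\<And>q. q \<in> Q \<Longrightarrow> prime_polyfun q"
    and nondiv: "\<And>q. q \<in> Q \<Longrightarrow> \<exists>k. \<not> divides q (G k)"
    and poly: "\<And>k. polyfun (G k)" "\<And>k. polyfun (P k)"
    and "polyfun N" "\<And>k x. D x * P k x = N x * G k x"
  shows "\<exists>N'. polyfun N' \<and> (\<forall>k x. P k x = N' x * G k x)"
  using assms(1,6,7)
proof (induction arbitrary: N)
  case monomials_one
  then show ?case by auto
next
  case (monomials_step q D)
  have D: "polyfun D"
    using \<open>D \<in> monomials_in Q\<close>
    by induction (use prime in \<open>auto simp: prime_polyfun_def intro: polyfun_intros\<close>)
  obtain k where "\<not> divides q (G k)" using nondiv \<open>q \<in> Q\<close> by blast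
  moreover have "divides q (\<lambda>x. N x * G k x)"
    unfolding divides_def
    by (rule exI[of _ "\<lambda>x. D x * P k x"])
      (use monomials_step.prems D poly in \<open>auto simp: mult.assoc[symmetric] intro: polyfun_intros\<close>)
  moreover have q: "polyfun q" "\<exists>x. q x \<noteq> 0"
    using prime[OF \<open>q \<in> Q\<close>] by (auto simp: prime_polyfun_def)
  ultimately have "divides q N"
    using prime[OF \<open>q \<in> Q\<close>] poly monomials_step.prems(1) unfolding prime_polyfun_def by blast
  then obtain M where M: "polyfun M" "\<And>x. N x = q x * M x" unfolding divides_def by blast
  obtain a where a: "q a \<noteq> 0" using q(2) by blast
  have "D x * P k x = M x * G k x" for k x
  proof (rule polyfun_cancel[OF q(1) _ _ a])
    show "q x * (D x * P k x) = q x * (M x * G k x)" for x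
      using monomials_step.prems(2)[of x k] M(2)[of x] by (simp add: mult.assoc)
  qed (use D M poly in \<open>auto intro: polyfun_intros\<close>)
  then show ?case using monomials_step.IH M(1) by blast
qed

text \<open>
  The functions that lie in the image of \<open>\<lambda>A. A \<circ> \<theta>\<close> after inverting the elements of \<open>Q\<close>.  The
  denominators themselves are required to lie in that image, so that these functions form a ring.
\<close>

definition localized ::
    "((int \<Rightarrow> complex ^ 'n::finite) \<Rightarrow> int \<Rightarrow> complex ^ 'n) \<Rightarrow>
     ((int \<Rightarrow> complex ^ 'n) \<Rightarrow> complex) set \<Rightarrow> ((int \<Rightarrow> complex ^ 'n) \<Rightarrow> complex) \<Rightarrow> bool" where
  "localized \<theta> Q f \<longleftrightarrow> (\<exists>D\<in>monomials_in Q. \<exists>A B. polyfun A \<and> polyfun B \<and>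
     (\<forall>x. D x * f x = A (\<theta> x)) \<and> (\<forall>x. D x = B (\<theta> x)))"

lemma localized_image: "polyfun A \<Longrightarrow> localized \<theta> Q (\<lambda>x. A (\<theta> x))"
  unfolding localized_def
  by (intro bexI[of _ "\<lambda>_. 1"] exI[of _ A] exI[of _ "\<lambda>_. 1"])
    (auto intro: polyfun_const monomials_one)

lemma localized_coord_image: "localized \<theta> Q (\<lambda>x. \<theta> x i $ j)"
  using localized_image[OF polyfun_coord] .

lemma localized_const: "localized \<theta> Q (\<lambda>x. c)"
  using localized_image[OF polyfun_const] .

lemma localized_mult:
  assumes "localized \<theta> Q f" "localized \<theta> Q g"
  shows "localized \<theta> Q (\<lambda>x. f x * g x)"
proof -
  obtain D A B where 1: "D \<in> monomials_in Q" "polyfun A" "polyfun B"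
     "\<And>x. D x * f x = A (\<theta> x)" "\<And>x. D x = B (\<theta> x)"
    using assms(1) unfolding localized_def by blast
  obtain D' A' B' where 2: "D' \<in> monomials_in Q" "polyfun A'" "polyfun B'"
     "\<And>x. D' x * g x = A' (\<theta> x)" "\<And>x. D' x = B' (\<theta> x)"
    using assms(2) unfolding localized_def by blast
  show ?thesis
    unfolding localized_def
  proof (intro bexI exI conjI allI)
    show "(\<lambda>x. D x * D' x) \<in> monomials_in Q" using monomials_mult 1 2 by blast
    show "polyfun (\<lambda>x. A x * A' x)" "polyfun (\<lambda>x. B x * B' x)" using 1 2 polyfun_mult by blast+
    show "D x * D' x * (f x * g x) = A (\<theta> x) * A' (\<theta> x)" for x
      unfolding 1(4)[symmetric] 2(4)[symmetric] by simp
    show "D x * D' x = B (\<theta> x) * B' (\<theta> x)" for x using 1(5) 2(5) by simp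
  qed
qed

lemma localized_add:
  assumes "localized \<theta> Q f" "localized \<theta> Q g"
  shows "localized \<theta> Q (\<lambda>x. f x + g x)"
proof -
  obtain D A B where 1: "D \<in> monomials_in Q" "polyfun A" "polyfun B"
     "\<And>x. D x * f x = A (\<theta> x)" "\<And>x. D x = B (\<theta> x)"
    using assms(1) unfolding localized_def by blast
  obtain D' A' B' where 2: "D' \<in> monomials_in Q" "polyfun A'" "polyfun B'"
     "\<And>x. D' x * g x = A' (\<theta> x)" "\<And>x. D' x = B' (\<theta> x)"
    using assms(2) unfolding localized_def by blast
  show ?thesis
    unfolding localized_def
  proof (intro bexI exI conjI allI)
    show "(\<lambda>x. D x * D' x) \<in> monomials_in Q" using monomials_mult 1 2 by blast
    show "polyfun (\<lambda>x. B' x * A x + B x * A' x)" "polyfun (\<lambda>x. B x * B' x)"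
      using 1 2 by (auto intro: polyfun_intros)
    show "D x * D' x * (f x + g x) = B' (\<theta> x) * A (\<theta> x) + B (\<theta> x) * A' (\<theta> x)" for x
      unfolding 1(4)[symmetric] 2(4)[symmetric] 1(5)[symmetric] 2(5)[symmetric]
      by (simp add: algebra_simps)
    show "D x * D' x = B (\<theta> x) * B' (\<theta> x)" for x using 1(5) 2(5) by simp
  qed
qed

lemma localized_diff:
  assumes "localized \<theta> Q f" "localized \<theta> Q g"
  shows "localized \<theta> Q (\<lambda>x. f x - g x)"
  using localized_add[OF assms(1) localized_mult[OF localized_const[of _ _ "-1"] assms(2)]]
  by simp

lemma localized_det3:
  assumes "\<And>j. localized \<theta> Q (\<lambda>x. f x $ j)" "\<And>j. localized \<theta> Q (\<lambda>x. g x $ j)"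
    "\<And>j. localized \<theta> Q (\<lambda>x. h x $ j)"
  shows "localized \<theta> Q (\<lambda>x. det3 (f x) (g x) (h x))"
  unfolding det3_def
  by (intro localized_add localized_diff localized_mult assms)

text \<open>
  The new denominator contains \<open>q\<close>, and it must be a function of \<open>\<theta> x\<close> again.  This is why \<open>q\<close> itself
  has to lie in the localization.
\<close>

lemma localized_divide:
  assumes "q \<in> Q" "localized \<theta> Q q" "localized \<theta> Q (\<lambda>x. q x * f x)"
  shows "localized \<theta> Q f"
proof -
  obtain D A B where 1: "D \<in> monomials_in Q" "polyfun A" "polyfun B"
     "\<And>x. D x * q x = A (\<theta> x)" "\<And>x. D x = B (\<theta> x)"
    using assms(2) unfolding localized_def by blast
  obtain D' A' B' where 2: "D' \<in> monomials_in Q" "polyfun A'" "polyfun B'"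
     "\<And>x. D' x * (q x * f x) = A' (\<theta> x)" "\<And>x. D' x = B' (\<theta> x)"
    using assms(3) unfolding localized_def by blast
  show ?thesis
    unfolding localized_def
  proof (intro bexI exI conjI allI)
    show "(\<lambda>x. (D x * q x) * D' x) \<in> monomials_in Q"
      using monomials_mult monomials_base assms(1) 1(1) 2(1) by blast
    show "polyfun (\<lambda>x. B x * A' x)" "polyfun (\<lambda>x. A x * B' x)"
      using 1 2 by (auto intro: polyfun_intros)
    show "D x * q x * D' x * f x = B (\<theta> x) * A' (\<theta> x)" for x
      unfolding 2(4)[symmetric] 1(5)[symmetric] by (simp add: algebra_simps)
    show "D x * q x * D' x = A (\<theta> x) * B' (\<theta> x)" for x using 1(4) 2(5) by simp
  qed
qed

lemma localized_polyfun:
  assumes "\<And>i j. localized \<theta> Q (\<lambda>x. x i $ j)" "polyfun f"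
  shows "localized \<theta> Q f"
  using assms(2)
  by induction (auto intro: assms(1) localized_const localized_add localized_mult)

text \<open>
  Pulling back along \<open>\<theta>\<close> preserves coprimality if \<open>\<theta>\<close> is dominant, if it becomes invertible once
  certain primes are inverted, and if none of these primes divides the pulled back tuple.
  Indeed, the quotient \<open>P k / F k (\<theta> x)\<close> is a polynomial in \<open>\<theta> x\<close> up to denominators, because
  \<open>F\<close> is coprime, and the denominators cancel prime by prime.
\<close>

lemma coprime_tuple_pullback:
  assumes cop: "coprime_tuple F"
    and \<theta>: "\<And>i j. polyfun (\<lambda>x. \<theta> x i $ j)"
    and dominant: "\<And>f. polyfun f \<Longrightarrow> (\<And>x. f (\<theta> x) = 0) \<Longrightarrow> (\<And>x. f x = 0)"
    and loc: "\<And>i j. localized \<theta> Q (\<lambda>x. x i $ j)"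
    and prime: "\<And>q. q \<in> Q \<Longrightarrow> prime_polyfun q"
    and nondiv: "\<And>q. q \<in> Q \<Longrightarrow> \<exists>k. \<not> divides q (\<lambda>x. F k (\<theta> x))"
  shows "coprime_tuple (\<lambda>k (x :: int \<Rightarrow> complex ^ 'n::finite). F (k :: 'k::finite) (\<theta> x))"
  unfolding coprime_tuple_def
proof (intro conjI allI impI)
  have F: "polyfun (F j)" for j using cop by (simp add: coprime_tuple_def)
  then show G: "polyfun (\<lambda>x. F j (\<theta> x))" for j using polyfun_compose \<theta> by blast
  fix P :: "'k \<Rightarrow> (int \<Rightarrow> complex ^ 'n) \<Rightarrow> complex"
  assume P: "(\<forall>j. polyfun (P j)) \<and> (\<forall>j k x. F j (\<theta> x) * P k x = F k (\<theta> x) * P j x)"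
  have "\<forall>k. localized \<theta> Q (P k)" using localized_polyfun[OF loc] P by blast
  then have "\<forall>k. \<exists>D A B. D \<in> monomials_in Q \<and> polyfun A \<and> polyfun B \<and>
     (\<forall>x. D x * P k x = A (\<theta> x)) \<and> (\<forall>x. D x = B (\<theta> x))"
    unfolding localized_def by blast
  then obtain D A B where DAB: "\<And>k. D k \<in> monomials_in Q" "\<And>k. polyfun (A k)" "\<And>k. polyfun (B k)"
     "\<And>k x. D k x * P k x = A k (\<theta> x)" "\<And>k x. D k x = B k (\<theta> x)" by metis
  (* a common denominator for all components of P *)
  define E where "E = (\<lambda>x. \<Prod>k\<in>UNIV. D k x)"
  define C where "C k = (\<lambda>x. A k x * (\<Prod>l\<in>UNIV - {k}. B l x))" for k
  have "(\<lambda>x. \<Prod>k\<in>K. D k x) \<in> monomials_in Q" if "finite K" for K :: "'k set"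
    using that by induction (auto intro: monomials_one monomials_mult DAB(1))
  then have E: "E \<in> monomials_in Q" by (simp add: E_def)
  have C: "polyfun (C k)" for k unfolding C_def using DAB by (intro polyfun_intros)
  have EP: "E x * P k x = C k (\<theta> x)" for k x
  proof -
    have "E x = D k x * (\<Prod>l\<in>UNIV - {k}. D l x)" unfolding E_def by (rule prod.remove) auto
    then have "E x * P k x = (D k x * P k x) * (\<Prod>l\<in>UNIV - {k}. D l x)" by (simp add: mult_ac)
    then show ?thesis unfolding C_def DAB(4) by (simp add: DAB(5))
  qed
  have "F j x * C k x = F k x * C j x" for j k x
  proof -
    have "F j x * C k x - F k x * C j x = 0"
    proof (rule dominant)
      show "F j (\<theta> x) * C k (\<theta> x) - F k (\<theta> x) * C j (\<theta> x) = 0" for x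
      proof -
        have "F j (\<theta> x) * C k (\<theta> x) - F k (\<theta> x) * C j (\<theta> x)
            = E x * (F j (\<theta> x) * P k x - F k (\<theta> x) * P j x)"
          unfolding EP[symmetric] by (simp add: algebra_simps)
        also have "F j (\<theta> x) * P k x - F k (\<theta> x) * P j x = 0" using P by simp
        finally show ?thesis by simp
      qed
    qed (use F C in \<open>auto intro!: polyfun_intros\<close>)
    then show ?thesis by simp
  qed
  then obtain N where N: "polyfun N" "\<And>k x. C k x = N x * F k x"
    using cop C unfolding coprime_tuple_def by blast
  show "\<exists>N. polyfun N \<and> (\<forall>j x. P j x = N x * F j (\<theta> x))"
  proof (rule cancel_monomial[OF E prime nondiv G])
    show "polyfun (P k)" for k using P by blast
    show "polyfun (\<lambda>x. N (\<theta> x))" using polyfun_compose N(1) \<theta> by blast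
    show "E x * P k x = N (\<theta> x) * F k (\<theta> x)" for k x unfolding EP N(2) ..
  qed
qed

section \<open>The heat map in homogeneous coordinates\<close>

lemma det3_add:
  "det3 (a + a') b c = det3 a b c + det3 a' b c"
  "det3 a (b + b') c = det3 a b c + det3 a b' c"
  "det3 a b (c + c') = det3 a b c + det3 a b c'"
  by (simp_all add: det3_def algebra_simps)

lemma det3_diff:
  "det3 (a - a') b c = det3 a b c - det3 a' b c"
  "det3 a (b - b') c = det3 a b c - det3 a b' c"
  "det3 a b (c - c') = det3 a b c - det3 a b c'"
  by (simp_all add: det3_def algebra_simps)

lemma det3_scale:
  "det3 (t *s a) b c = t * det3 a b c"
  "det3 a (t *s b) c = t * det3 a b c"
  "det3 a b (t *s c) = t * det3 a b c"
  by (simp_all add: det3_def algebra_simps)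

lemma det3_repeat: "det3 a a b = 0" "det3 a b a = 0" "det3 b a a = 0"
  by (simp_all add: det3_def algebra_simps)

lemma det3_zero: "det3 0 b c = 0" "det3 a 0 c = 0" "det3 a b 0 = 0"
  by (simp_all add: det3_def)

lemma det3_swap: "det3 b a c = - det3 a b c" "det3 a c b = - det3 a b c" "det3 c b a = - det3 a b c"
  by (simp_all add: det3_def algebra_simps)

lemma vec3_eq_iff: "(a :: complex ^ 3) = b \<longleftrightarrow> a $ 1 = b $ 1 \<and> a $ 2 = b $ 2 \<and> a $ 3 = b $ 3"
  by (simp add: vec_eq_iff forall_3)

lemma cramer3: "det3 p q r *s c = det3 c q r *s p - det3 c p r *s q + det3 c p q *s r"
  by (simp add: vec3_eq_iff det3_def algebra_simps)

lemma vec3_eqI_det3: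
  assumes "det3 p q r \<noteq> 0" "det3 c q r = det3 d q r" "det3 c p r = det3 d p r" "det3 c p q = det3 d p q"
  shows "c = d"
proof -
  have "det3 p q r *s c = det3 p q r *s d" unfolding cramer3[of p q r c] cramer3[of p q r d] using assms by simp
  then show ?thesis using assms(1) by simp
qed

definition skip1 :: "(int \<Rightarrow> complex ^ 3) \<Rightarrow> int \<Rightarrow> complex" where
  "skip1 x i = det3 (x i) (x (i + 2)) (x (i + 3))"

definition skip2 :: "(int \<Rightarrow> complex ^ 3) \<Rightarrow> int \<Rightarrow> complex" where
  "skip2 x i = det3 (x i) (x (i + 1)) (x (i + 3))"

definition skip3 :: "(int \<Rightarrow> complex ^ 3) \<Rightarrow> int \<Rightarrow> complex" where
  "skip3 x i = det3 (x i) (x (i + 1)) (x (i + 2))"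

definition heat_step :: "(int \<Rightarrow> complex ^ 3) \<Rightarrow> int \<Rightarrow> complex ^ 3" where
  "heat_step x i = skip1 x i *s x (i + 1) + skip2 x i *s x (i + 2)"

text \<open>
  The brackets \<open>skip1\<close>, \<open>skip2\<close>, \<open>skip3\<close> are the coefficients of the linear relation between four
  consecutive points.  Read as a formula for \<open>x i\<close>, this is what allows a heat step to be undone.
\<close>

lemma skip_relation:
  "skip3 x (i + 1) *s x i = skip1 x i *s x (i + 1) - skip2 x i *s x (i + 2) + skip3 x i *s x (i + 3)"
  unfolding skip1_def skip2_def skip3_def
  using cramer3[of "x (i + 1)" "x (i + 2)" "x (i + 3)" "x i"] by (simp add: add.assoc)

lemma heat_step_cong: "(\<And>n. i \<le> n \<Longrightarrow> n \<le> i + 3 \<Longrightarrow> x n = y n) \<Longrightarrow> heat_step x i = heat_step y i"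
  by (simp add: heat_step_def skip1_def skip2_def)

lemma heat_iterate_cong:
  "(\<And>n. i \<le> n \<Longrightarrow> n \<le> i + 3 * int m \<Longrightarrow> x n = y n) \<Longrightarrow>
     (heat_step ^^ m) x i = (heat_step ^^ m) y i"
proof (induction m arbitrary: i)
  case (Suc m)
  have "(heat_step ^^ m) x n = (heat_step ^^ m) y n" if "i \<le> n" "n \<le> i + 3" for n
    by (rule Suc.IH) (use Suc.prems that in auto)
  then show ?case by (auto intro: heat_step_cong)
qed simp

lemma heat_iterate_Suc_right: "(heat_step ^^ Suc m) x = (heat_step ^^ m) (heat_step x)"
  by (simp add: funpow_swap1)

lemma polyfun_skip:
  "polyfun (\<lambda>x. skip1 x i)" "polyfun (\<lambda>x. skip2 x i)" "polyfun (\<lambda>x. skip3 x i)"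
  unfolding skip1_def skip2_def skip3_def by (intro polyfun_det3 polyfun_coord)+

lemma polyfun_heat_step: "polyfun (\<lambda>x. heat_step x i $ j)"
  unfolding heat_step_def by (auto intro!: polyfun_intros polyfun_skip)

lemma polyfun_heat_iterate: "polyfun (\<lambda>x. (heat_step ^^ m) x i $ j)"
proof (induction m arbitrary: i)
  case 0
  show ?case by (simp add: polyfun_coord)
next
  case (Suc m)
  show ?case
    using polyfun_compose[OF Suc[of i] polyfun_heat_step] by (simp add: funpow_swap1)
qed

lemma heat_step_shift: "heat_step (\<lambda>n. x (n + s)) i = heat_step x (i + s)"
  by (simp add: heat_step_def skip1_def skip2_def add_ac)

lemma heat_iterate_shift: "(heat_step ^^ m) (\<lambda>n. x (n + s)) i = (heat_step ^^ m) x (i + s)"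
proof (induction m arbitrary: i)
  case (Suc m)
  then have "(heat_step ^^ m) (\<lambda>n. x (n + s)) = (\<lambda>i. (heat_step ^^ m) x (i + s))" by blast
  then show ?case by (simp add: heat_step_shift)
qed simp

section \<open>Total positivity\<close>

text \<open>
  In the order of the complex numbers \<open>0 \<le> z\<close> says that \<open>z\<close> is a nonnegative real number.
\<close>

definition positive_config :: "(int \<Rightarrow> complex ^ 3) \<Rightarrow> bool" where
  "positive_config x \<longleftrightarrow> (\<forall>i j k. i < j \<and> j < k \<longrightarrow> 0 \<le> det3 (x i) (x j) (x k) \<and> det3 (x i) (x j) (x k) \<noteq> 0)"

text \<open>
  The case of the Cauchy-Binet formula for a nonnegative matrix with two diagonals: a bracket of
  mixtures is a sum of eight brackets with nonnegative coefficients, and two of them decide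
  strict positivity.
\<close>

lemma mixture_positive:
  assumes x: "\<And>i j k. i < j \<Longrightarrow> j < k \<Longrightarrow> 0 \<le> det3 (x i) (x j) (x k)"
    and ab: "\<And>i. 0 \<le> a i" "\<And>i. 0 \<le> b i"
    and strict: "\<And>i j k. i < j \<Longrightarrow> j < k \<Longrightarrow>
      a i * a j * a k * det3 (x (i + 1)) (x (j + 1)) (x (k + 1)) \<noteq> 0 \<or>
      b i * b j * b k * det3 (x (i + 2)) (x (j + 2)) (x (k + 2)) \<noteq> 0"
  shows "positive_config (\<lambda>i. a i *s x (i + 1) + b i *s x (i + 2))"
  unfolding positive_config_def
proof (intro allI impI)
  fix i j k :: int
  assume ijk: "i < j \<and> j < k"
  let ?d = "\<lambda>p q r. det3 (x p) (x q) (x r)"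
  have weak: "0 \<le> ?d p q r" if "p \<le> q" "q \<le> r" for p q r
  proof (cases "p = q \<or> q = r")
    case True
    then show ?thesis by (auto simp: det3_repeat)
  next
    case False
    then have "p < q" "q < r" using that by auto
    then show ?thesis by (rule x)
  qed
  let ?A = "a i * a j * a k * ?d (i + 1) (j + 1) (k + 1)"
  let ?B = "b i * b j * b k * ?d (i + 2) (j + 2) (k + 2)"
  let ?C = "a i * a j * b k * ?d (i + 1) (j + 1) (k + 2) + a i * b j * a k * ?d (i + 1) (j + 2) (k + 1)
    + a i * b j * b k * ?d (i + 1) (j + 2) (k + 2) + b i * a j * a k * ?d (i + 2) (j + 1) (k + 1)
    + b i * a j * b k * ?d (i + 2) (j + 1) (k + 2) + b i * b j * a k * ?d (i + 2) (j + 2) (k + 1)"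
  have eq: "det3 (a i *s x (i + 1) + b i *s x (i + 2)) (a j *s x (j + 1) + b j *s x (j + 2))
     (a k *s x (k + 1) + b k *s x (k + 2)) = ?A + ?B + ?C"
    by (simp add: det3_add det3_scale algebra_simps)
  have C: "0 \<le> ?C" and A: "0 \<le> ?A" and B: "0 \<le> ?B"
    by (intro add_nonneg_nonneg mult_nonneg_nonneg ab weak; use ijk in linarith)+
  have "?A + ?B + ?C \<noteq> 0"
    using strict[of i j k] ijk A B C by (metis add_nonneg_eq_0_iff add_nonneg_nonneg)
  then show "0 \<le> det3 (a i *s x (i + 1) + b i *s x (i + 2)) (a j *s x (j + 1) + b j *s x (j + 2))
     (a k *s x (k + 1) + b k *s x (k + 2)) \<and> det3 (a i *s x (i + 1) + b i *s x (i + 2))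
     (a j *s x (j + 1) + b j *s x (j + 2)) (a k *s x (k + 1) + b k *s x (k + 2)) \<noteq> 0"
    unfolding eq by (intro conjI add_nonneg_nonneg[OF add_nonneg_nonneg[OF A B] C])
qed

lemma heat_step_positive:
  assumes "positive_config x"
  shows "positive_config (heat_step x)"
proof -
  have "0 \<le> skip1 x i" "skip1 x i \<noteq> 0" "0 \<le> skip2 x i" "skip2 x i \<noteq> 0" for i
    using assms by (auto simp: positive_config_def skip1_def skip2_def)
  then show ?thesis
    unfolding heat_step_def[abs_def]
    by (intro mixture_positive) (use assms in \<open>auto simp: positive_config_def\<close>)
qed

lemma heat_iterate_positive: "positive_config x \<Longrightarrow> positive_config ((heat_step ^^ m) x)"
  by (induction m) (auto intro: heat_step_positive)

lemma positive_config_nonzero: "positive_config x \<Longrightarrow> x i \<noteq> 0"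
  unfolding positive_config_def using det3_zero(1) by (metis less_add_one)

definition parabola :: "int \<Rightarrow> complex ^ 3" where
  "parabola n = vector [1, of_int n, of_int (n ^ 2)]"

lemma of_int_nonneg_complex: "0 \<le> n \<Longrightarrow> 0 \<le> (of_int n :: complex)"
  by (simp add: less_eq_complex_def)

lemma parabola_positive: "positive_config parabola"
  unfolding positive_config_def
proof (intro allI impI)
  fix i j k :: int assume "i < j \<and> j < k"
  moreover have "det3 (parabola i) (parabola j) (parabola k) = of_int ((j - i) * (k - i) * (k - j))"
    by (simp add: det3_def parabola_def vector_3 algebra_simps power2_eq_square)
  moreover have "0 < (j - i) * (k - i) * (k - j)"
    using \<open>i < j \<and> j < k\<close> by (intro mult_pos_pos) auto
  ultimately show "0 \<le> det3 (parabola i) (parabola j) (parabola k) \<and>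
      det3 (parabola i) (parabola j) (parabola k) \<noteq> 0"
    using of_int_nonneg_complex[of "(j - i) * (k - i) * (k - j)"] by (metis less_le of_int_eq_0_iff)
qed

text \<open>
  The function \<open>n ^ 2 - \<bar>n\<bar>\<close> is convex on the integers, and its only vanishing second difference is the
  one at \<open>0\<close>.
\<close>

lemma flattened_parabola_convex:
  fixes a b c :: int
  defines "g \<equiv> \<lambda>n :: int. n ^ 2 - \<bar>n\<bar>"
  assumes "a < b" "b < c"
  shows "0 \<le> (b - a) * (g c - g b) - (c - b) * (g b - g a)"
    and "(b - a) * (g c - g b) - (c - b) * (g b - g a) = 0 \<Longrightarrow> a = -1 \<and> b = 0 \<and> c = 1"
proof -
  let ?D = "(b - a) * (g c - g b) - (c - b) * (g b - g a)"
  have "0 \<le> ?D \<and> (?D = 0 \<longrightarrow> a = -1 \<and> b = 0 \<and> c = 1)"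
  proof -
    consider "c \<le> 0 \<or> 0 \<le> a" | "a < 0" "0 < c" "b \<le> 0" | "a < 0" "0 < c" "0 < b" by linarith
    then show ?thesis
    proof cases
      case 1
      then have "?D = (b - a) * (c - b) * (c - a)"
        using assms by (auto simp: g_def algebra_simps power2_eq_square)
      then show ?thesis using assms by (simp add: mult_nonneg_nonneg)
    next
      case 2
      then have D: "?D = (b - a) * ((c - b) * (c - a) - 2 * c)"
        using assms by (auto simp: g_def algebra_simps power2_eq_square)
      have e: "(c - b) * (c - a) - 2 * c
          = (c - b) * (b - a - 1) + (c - b) * (c - b - 1) + 2 * (- b)"
        by (simp add: algebra_simps)
      have nn: "0 \<le> (c - b) * (b - a - 1)" "0 \<le> (c - b) * (c - b - 1)" "0 \<le> - b"
        using 2 assms by auto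
      then have "0 \<le> ?D"
        unfolding D e using assms by (intro mult_nonneg_nonneg add_nonneg_nonneg) auto
      moreover have "a = -1 \<and> b = 0 \<and> c = 1" if "?D = 0"
      proof -
        have "(c - b) * (b - a - 1) + (c - b) * (c - b - 1) + 2 * (- b) = 0"
          using that assms unfolding D e by simp
        then have "(c - b) * (b - a - 1) = 0" "(c - b) * (c - b - 1) = 0" "b = 0"
          using nn by linarith+
        then show ?thesis using assms by auto
      qed
      ultimately show ?thesis by blast
    next
      case 3
      then have D: "?D = (c - b) * ((b - a) * (c - a) + 2 * a)"
        using assms by (auto simp: g_def algebra_simps power2_eq_square)
      have e: "(b - a) * (c - a) + 2 * a
          = (b - a) * (c - b - 1) + (b - a) * (b - a - 1) + 2 * b"
        by (simp add: algebra_simps)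
      have "0 \<le> (b - a) * (c - b - 1)" "0 \<le> (b - a) * (b - a - 1)" using 3 assms by auto
      then have "0 < ?D"
        unfolding D e using assms 3 by (intro mult_pos_pos add_nonneg_pos add_nonneg_nonneg) auto
      then show ?thesis by simp
    qed
  qed
  then show "0 \<le> ?D" "?D = 0 \<Longrightarrow> a = -1 \<and> b = 0 \<and> c = 1" by blast+
qed

definition flattened_parabola :: "int \<Rightarrow> int \<Rightarrow> complex ^ 3" where
  "flattened_parabola m n = vector [1, of_int (n - m), of_int ((n - m) ^ 2 - \<bar>n - m\<bar>)]"

lemma det3_flattened_parabola:
  assumes "i < j" "j < k"
  shows "0 \<le> det3 (flattened_parabola m i) (flattened_parabola m j) (flattened_parabola m k)"
    and "det3 (flattened_parabola m i) (flattened_parabola m j) (flattened_parabola m k) = 0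
      \<longleftrightarrow> i = m - 1 \<and> j = m \<and> k = m + 1"
proof -
  let ?g = "\<lambda>n :: int. n ^ 2 - \<bar>n\<bar>"
  let ?D = "((j - m) - (i - m)) * (?g (k - m) - ?g (j - m)) - ((k - m) - (j - m)) * (?g (j - m) - ?g (i - m))"
  have eq: "det3 (flattened_parabola m i) (flattened_parabola m j) (flattened_parabola m k) = of_int ?D"
    by (simp add: det3_def flattened_parabola_def vector_3 algebra_simps)
  have lt: "i - m < j - m" "j - m < k - m" using assms by auto
  show "0 \<le> det3 (flattened_parabola m i) (flattened_parabola m j) (flattened_parabola m k)"
    unfolding eq by (rule of_int_nonneg_complex[OF flattened_parabola_convex(1)[OF lt]])
  have "?D = 0 \<Longrightarrow> i - m = -1 \<and> j - m = 0 \<and> k - m = 1"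
    by (rule flattened_parabola_convex(2)[OF lt])
  then show "det3 (flattened_parabola m i) (flattened_parabola m j) (flattened_parabola m k) = 0
      \<longleftrightarrow> i = m - 1 \<and> j = m \<and> k = m + 1"
    unfolding eq of_int_eq_0_iff by auto
qed

text \<open>
  Flattening a convex polygon at one vertex makes the points \<open>j\<close>, \<open>j + 1\<close>, \<open>j + 2\<close> collinear, and
  one heat step makes the polygon strictly convex again.
\<close>

lemma skip3_zero_witness:
  "\<exists>x. skip3 x j = 0 \<and> (heat_step ^^ Suc m) x 0 \<noteq> 0"
proof (intro exI conjI)
  let ?x = "flattened_parabola (j + 1)"
  show "skip3 ?x j = 0" unfolding skip3_def by (subst det3_flattened_parabola(2)) auto
  have s: "0 \<le> skip1 ?x i" "skip1 ?x i \<noteq> 0" "0 \<le> skip2 ?x i" "skip2 ?x i \<noteq> 0" for i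
    unfolding skip1_def skip2_def by (auto simp: det3_flattened_parabola)
  have "positive_config (heat_step ?x)"
    unfolding heat_step_def[abs_def]
    by (rule mixture_positive) (use s in \<open>auto simp: det3_flattened_parabola\<close>)
  then show "(heat_step ^^ Suc m) ?x 0 \<noteq> 0"
    unfolding heat_iterate_Suc_right using positive_config_nonzero heat_iterate_positive by blast
qed

section \<open>Undoing one heat step\<close>

text \<open>
  The map \<open>heat_param k\<close> records the new points at the sites \<open>0, ..., k\<close> together with enough old
  data, stored from site \<open>k + 1\<close> on, to recover the old points.  The map \<open>partial_param i g k\<close> is an
  intermediate stage: at the sites below \<open>i\<close> it copies the point of \<open>x\<close> as an arbitrary new point.
\<close>

definition partial_param ::
    "int \<Rightarrow> complex \<Rightarrow> int \<Rightarrow> (int \<Rightarrow> complex ^ 3) \<Rightarrow> int \<Rightarrow> complex ^ 3" where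
  "partial_param i g k x n =
     (if 0 \<le> n \<and> n < i then x n
      else if 0 \<le> n \<and> n \<le> k then heat_step x n
      else if n = k + 1 then vector [g, skip1 x (k + 1), skip2 x (k + 1)]
      else x n)"

definition heat_param :: "int \<Rightarrow> (int \<Rightarrow> complex ^ 3) \<Rightarrow> int \<Rightarrow> complex ^ 3" where
  "heat_param k x = partial_param 0 (skip3 x 0) k x"

lemma polyfun_heat_param: "polyfun (\<lambda>x. heat_param k x i $ j)"
proof -
  have vec: "polyfun (\<lambda>x. vector [skip3 x 0, skip1 x (k + 1), skip2 x (k + 1)] $ j)" for j :: 3
    using exhaust_3[of j] by (auto simp: vector_3 polyfun_skip)
  consider "0 \<le> i" "i \<le> k" | "i = k + 1" | "i < 0 \<or> k < i" "i \<noteq> k + 1"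
    by linarith
  then show ?thesis
  proof cases
    case 1
    then have "heat_param k x i = heat_step x i" for x
      by (simp add: heat_param_def partial_param_def)
    then show ?thesis by (simp add: polyfun_heat_step)
  next
    case 2
    then have "heat_param k x i = vector [skip3 x 0, skip1 x (k + 1), skip2 x (k + 1)]" for x
      by (auto simp: heat_param_def partial_param_def)
    then show ?thesis using vec by simp
  next
    case 3
    then have "heat_param k x i = x i" for x
      by (auto simp: heat_param_def partial_param_def)
    then show ?thesis by (simp add: polyfun_coord)
  qed
qed

definition bad_primes :: "int \<Rightarrow> ((int \<Rightarrow> complex ^ 3) \<Rightarrow> complex) set" where
  "bad_primes k = {\<lambda>x. skip1 x i | i. 0 \<le> i \<and> i \<le> k} \<union> {\<lambda>x. skip2 x i | i. 1 \<le> i \<and> i \<le> k + 1}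
     \<union> {\<lambda>x. skip3 x i | i. 1 \<le> i \<and> i \<le> k + 2}"

lemma prime_bad_primes: "q \<in> bad_primes k \<Longrightarrow> prime_polyfun q"
  unfolding bad_primes_def skip1_def skip2_def skip3_def by (auto intro!: prime_polyfun_det3)

text \<open>
  Brackets of the new point with later old points isolate the unknown coefficients one at a time.
  Their factors are the denominators that occur when the old points are recovered.
\<close>

lemma det3_heat_step:
  "det3 (heat_step x i) (x (i + 2)) (x (i + 4)) = skip1 x i * skip2 x (i + 1)"
  "det3 (heat_step x i) (x (i + 2)) (x (i + 3)) = skip1 x i * skip3 x (i + 1)"
  "det3 (heat_step x i) (x (i + 3)) (x (i + 4))
     = skip1 x i * skip1 x (i + 1) + skip2 x i * skip3 x (i + 2)"
  by (simp_all add: heat_step_def skip1_def[of x "i + 1"] skip2_def[of x "i + 1"]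
      skip3_def[of x "i + 1"] skip3_def[of x "i + 2"] det3_add det3_scale det3_repeat add.assoc)

text \<open>
  Going down from site \<open>k + 1\<close>: once the points beyond \<open>i + 1\<close> and the two numbers
  \<open>skip1 x (i + 1)\<close>, \<open>skip2 x (i + 1)\<close> are known, brackets with the new point at \<open>i\<close> give \<open>skip1 x i\<close>,
  \<open>skip3 x (i + 1)\<close> and \<open>skip2 x i\<close>, and then the linear relation gives \<open>x (i + 1)\<close>.
\<close>

lemma localized_old_points:
  assumes "0 \<le> k"
  shows "localized (heat_param k) (bad_primes k) (\<lambda>x. x n $ j)"
proof -
  let ?L = "localized (heat_param k) (bad_primes k)"
  have site: "?L (\<lambda>x. heat_param k x n $ j)" for n j by (rule localized_coord_image)
  have far: "?L (\<lambda>x. x n $ j)" if "k + 1 < n \<or> n < 0" for n j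
    using site[of n j] that assms by (auto simp: heat_param_def partial_param_def)
  have new: "?L (\<lambda>x. heat_step x i $ j)" if "0 \<le> i" "i \<le> k" for i j
    using site[of i j] that by (simp add: heat_param_def partial_param_def)
  have g0: "?L (\<lambda>x. skip3 x 0)"
    using site[of "k + 1" 1] assms by (simp add: heat_param_def partial_param_def vector_3)
  have known: "(\<forall>n>k - int d + 1. \<forall>j. ?L (\<lambda>x. x n $ j)) \<and>
      ?L (\<lambda>x. skip1 x (k - int d + 1)) \<and> ?L (\<lambda>x. skip2 x (k - int d + 1))"
    if "int d \<le> k + 1" for d
    using that
  proof (induction d)
    case 0
    show ?case
    proof -
      have "heat_param k x (k + 1) $ 2 = skip1 x (k + 1)" "heat_param k x (k + 1) $ 3 = skip2 x (k + 1)"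
        for x using assms by (auto simp: heat_param_def partial_param_def vector_3)
      then show ?thesis using site[of "k + 1" 2] site[of "k + 1" 3] far by simp
    qed
  next
    case (Suc d)
    define i where "i = k - int d"
    have i: "0 \<le> i" "i \<le> k" using Suc.prems by (auto simp: i_def)
    have old: "?L (\<lambda>x. x n $ j)" if "i + 1 < n" for n j
      using Suc that by (simp add: i_def)
    have s1: "?L (\<lambda>x. skip1 x (i + 1))" and s2: "?L (\<lambda>x. skip2 x (i + 1))"
      using Suc by (simp_all add: i_def)
    have s3: "?L (\<lambda>x. skip3 x (i + 2))"
      unfolding skip3_def by (intro localized_det3 old) auto
    have bad: "(\<lambda>x. skip1 x i) \<in> bad_primes k" "(\<lambda>x. skip2 x (i + 1)) \<in> bad_primes k"
      "(\<lambda>x. skip3 x (i + 2)) \<in> bad_primes k"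
      using i by (auto simp: bad_primes_def)
    have "?L (\<lambda>x. skip2 x (i + 1) * skip1 x i)"
      unfolding mult.commute[of "skip2 _ _"] det3_heat_step(1)[symmetric]
      by (intro localized_det3 old new i) auto
    then have a: "?L (\<lambda>x. skip1 x i)" by (rule localized_divide[OF bad(2) s2])
    have "?L (\<lambda>x. skip1 x i * skip3 x (i + 1))"
      unfolding det3_heat_step(2)[symmetric] by (intro localized_det3 old new i) auto
    then have c: "?L (\<lambda>x. skip3 x (i + 1))" by (rule localized_divide[OF bad(1) a])
    have "?L (\<lambda>x. skip3 x (i + 2) * skip2 x i)"
    proof -
      have "?L (\<lambda>x. det3 (heat_step x i) (x (i + 3)) (x (i + 4)) - skip1 x i * skip1 x (i + 1))"
        by (intro localized_diff localized_mult localized_det3 old new i a s1) auto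
      then show ?thesis unfolding det3_heat_step(3) by (simp add: mult.commute)
    qed
    then have b: "?L (\<lambda>x. skip2 x i)" by (rule localized_divide[OF bad(3) s3])
    have "?L (\<lambda>x. x (i + 1) $ j)" for j
    proof (rule localized_divide[OF bad(3) s3])
      have "?L (\<lambda>x. (skip1 x (i + 1) * x (i + 2) $ j - skip2 x (i + 1) * x (i + 3) $ j)
          + skip3 x (i + 1) * x (i + 4) $ j)"
        by (intro localized_add localized_diff localized_mult old s1 s2 c) auto
      moreover have "skip3 x (i + 2) * x (i + 1) $ j = skip1 x (i + 1) * x (i + 2) $ j
          - skip2 x (i + 1) * x (i + 3) $ j + skip3 x (i + 1) * x (i + 4) $ j" for x j
        using arg_cong[OF skip_relation[of x "i + 1"], of "\<lambda>v. v $ j"] by (simp add: add.assoc)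
      ultimately show "?L (\<lambda>x. skip3 x (i + 2) * x (i + 1) $ j)" by simp
    qed
    then have "\<forall>n>i. \<forall>j. ?L (\<lambda>x. x n $ j)"
      using old by (metis add_le_imp_le_diff zless_imp_add1_zle order_le_less)
    then show ?case using a b by (simp add: i_def)
  qed
  have k1: "int (nat (k + 1)) = k + 1" using assms by simp
  from known[of "nat (k + 1)"] have pos: "\<And>n j. 0 < n \<Longrightarrow> ?L (\<lambda>x. x n $ j)"
    and s: "?L (\<lambda>x. skip1 x 0)" "?L (\<lambda>x. skip2 x 0)"
    unfolding k1 by simp_all
  have "?L (\<lambda>x. x 0 $ j)" for j
  proof (rule localized_divide)
    show "(\<lambda>x. skip3 x 1) \<in> bad_primes k" using assms by (auto simp: bad_primes_def)
    show "?L (\<lambda>x. skip3 x 1)"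
      unfolding skip3_def by (intro localized_det3 pos) auto
    have "?L (\<lambda>x. (skip1 x 0 * x 1 $ j - skip2 x 0 * x 2 $ j) + skip3 x 0 * x 3 $ j)"
      by (intro localized_add localized_diff localized_mult pos s g0) auto
    moreover have "skip3 x 1 * x 0 $ j
        = skip1 x 0 * x 1 $ j - skip2 x 0 * x 2 $ j + skip3 x 0 * x 3 $ j" for x j
      using arg_cong[OF skip_relation[of x 0], of "\<lambda>v. v $ j"] by simp
    ultimately show "?L (\<lambda>x. skip3 x 1 * x 0 $ j)" by simp
  qed
  then show ?thesis using pos far assms by (cases "n = 0"; cases "n < 0") auto
qed

text \<open>
  One can prescribe the new point at site \<open>i\<close> by moving only \<open>x i\<close> and \<open>x (i + 1)\<close>, without changing
  the later new points: these see \<open>x (i + 1)\<close> only through \<open>skip1 x (i + 1)\<close> and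
  \<open>skip2 x (i + 1)\<close>, which leaves \<open>x (i + 1)\<close> one degree of freedom.
\<close>

lemma prescribe_heat_step:
  assumes "skip2 x (i + 1) \<noteq> 0" "skip3 x (i + 2) \<noteq> 0"
    and c: "det3 c (x (i + 2)) (x (i + 4)) \<noteq> 0" "det3 c (x (i + 2)) (x (i + 3)) \<noteq> 0"
  shows "\<exists>x'. (\<forall>n. n \<noteq> i \<and> n \<noteq> i + 1 \<longrightarrow> x' n = x n) \<and> heat_step x' i = c \<and>
    skip1 x' (i + 1) = skip1 x (i + 1) \<and> skip2 x' (i + 1) = skip2 x (i + 1) \<and>
    skip3 x' i = g \<and> skip3 x' (i + 1) \<noteq> 0 \<and>
    skip2 x' i = (det3 c (x (i + 3)) (x (i + 4)) -
       det3 c (x (i + 2)) (x (i + 4)) / skip2 x (i + 1) * skip1 x (i + 1)) / skip3 x (i + 2)"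
proof -
  define a1 b1 g2 where "a1 = skip1 x (i + 1)" and "b1 = skip2 x (i + 1)" and "g2 = skip3 x (i + 2)"
  define p q r where "p = x (i + 2)" and "q = x (i + 3)" and "r = x (i + 4)"
  have nz: "b1 \<noteq> 0" "g2 \<noteq> 0" "det3 c p r \<noteq> 0" "det3 c p q \<noteq> 0"
    using assms by (auto simp: b1_def g2_def p_def q_def r_def)
  have g2: "det3 p q r = g2" by (simp add: g2_def p_def q_def r_def skip3_def add.assoc)
  define a g1 where "a = det3 c p r / b1" and "g1 = det3 c p q / a"
  have nz2: "a \<noteq> 0" "g1 \<noteq> 0" using nz by (auto simp: a_def g1_def)
  define b where "b = (det3 c q r - a * a1) / g2"
  define y where "y = (1 / g2) *s (a1 *s p - b1 *s q + g1 *s r)"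
  define z where "z = (1 / g1) *s (a *s y - b *s p + g *s q)"
  define x' where "x' = x(i + 1 := y, i := z)"
  have y: "det3 y q r = a1" "det3 y p r = b1" "det3 y p q = g1"
    using nz g2 det3_swap(1)[of q p r] det3_swap(1)[of r p q] det3_swap(2)[of p r q]
    by (simp_all add: y_def det3_scale det3_add det3_diff det3_repeat)
  have z: "det3 z p q = a" "det3 z y q = b" "det3 z y p = g"
    using nz2 y det3_swap(1)[of p y q] det3_swap(1)[of q y p] det3_swap(2)[of y q p]
    by (simp_all add: z_def det3_scale det3_add det3_diff det3_repeat)
  have sites: "x' i = z" "x' (i + 1) = y" "x' (i + 2) = p" "x' (i + 3) = q" "x' (i + 4) = r"
    by (simp_all add: x'_def p_def q_def r_def)
  have "heat_step x' i = a *s y + b *s p"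
    by (simp add: heat_step_def skip1_def skip2_def sites z)
  also have "\<dots> = c"
  proof (rule vec3_eqI_det3[of p q r])
    show "det3 (a *s y + b *s p) q r = det3 c q r"
      using nz by (simp add: det3_add det3_scale y g2 b_def)
    show "det3 (a *s y + b *s p) p r = det3 c p r"
      using nz by (simp add: det3_add det3_scale det3_repeat y a_def)
    show "det3 (a *s y + b *s p) p q = det3 c p q"
      using nz nz2 by (simp add: det3_add det3_scale det3_repeat y g1_def)
  qed (use nz g2 in simp)
  finally have "heat_step x' i = c" .
  moreover have "skip1 x' (i + 1) = a1" "skip2 x' (i + 1) = b1" "skip3 x' i = g"
    "skip3 x' (i + 1) = g1" "skip2 x' i = b"
    by (simp_all add: skip1_def skip2_def skip3_def add.assoc sites y z)
  ultimately show ?thesis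
    using nz2
    by (intro exI[of _ x']) (auto simp: x'_def a1_def b1_def g2_def p_def q_def r_def b_def a_def)
qed

lemma exists_generic_vector:
  fixes f :: "(int \<Rightarrow> complex ^ 'n::finite) \<Rightarrow> complex" and L :: "'l \<Rightarrow> complex ^ 'n \<Rightarrow> complex"
  assumes "polyfun f" "f y \<noteq> 0" "finite A"
    and "\<And>l. l \<in> A \<Longrightarrow> polyfun (\<lambda>x. L l (x i))" "\<And>l. l \<in> A \<Longrightarrow> \<exists>v. L l v \<noteq> 0"
  shows "\<exists>c. f (y(i := c)) \<noteq> 0 \<and> (\<forall>l\<in>A. L l c \<noteq> 0)"
proof -
  have f: "polyfun (\<lambda>x. f (y(i := x i)))"
  proof (rule polyfun_compose[OF assms(1)])
    show "polyfun (\<lambda>x. (y(i := x i)) n $ j)" for n j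
      by (cases "n = i") (simp_all add: polyfun_const polyfun_coord)
  qed
  have "\<exists>x. L l (x i) \<noteq> 0" if l: "l \<in> A" for l
  proof -
    obtain v where "L l v \<noteq> 0" using assms(5)[OF l] by blast
    then show ?thesis by (intro exI[of _ "\<lambda>_. v"])
  qed
  then obtain z where "\<forall>l\<in>A. L l (z i) \<noteq> 0"
    using polyfun_common_nonzero_finite[of A "\<lambda>l x. L l (x i)"] assms(3,4) by blast
  then have "(\<Prod>l\<in>A. L l (z i)) \<noteq> 0" using assms(3) by simp
  moreover have "polyfun (\<lambda>x. \<Prod>l\<in>A. L l (x i))"
    using assms(4) by (rule polyfun_prod)
  moreover have "f (y(i := y i)) \<noteq> 0" using assms(2) by simp
  ultimately obtain x where "f (y(i := x i)) \<noteq> 0" "(\<Prod>l\<in>A. L l (x i)) \<noteq> 0"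
    using polyfun_common_nonzero[OF f] by blast
  then show ?thesis using assms(3) by auto
qed

lemma polyfun_det3_site:
  "polyfun (\<lambda>x. det3 (x i) p q)"
  by (rule polyfun_det3) (rule polyfun_coord polyfun_const)+

text \<open>
  The point \<open>c\<close> that takes the place of the one at site \<open>i\<close> has to be generic, because the
  construction must be possible again at the next site below; the three linear forms \<open>L\<close> express this.
\<close>

lemma descend_step:
  assumes f: "polyfun f" "f (partial_param (i + 1) g k x) \<noteq> 0"
    and i: "0 \<le> i" "i \<le> k"
    and nz: "skip2 x (i + 1) \<noteq> 0" "skip3 x (i + 2) \<noteq> 0"
  shows "\<exists>x'. f (partial_param i g k x') \<noteq> 0 \<and> skip2 x' i \<noteq> 0 \<and> skip3 x' (i + 1) \<noteq> 0 \<and>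
    skip3 x' i = g \<and> skip1 x' (i + 1) = skip1 x (i + 1) \<and> (\<forall>n>i + 1. x' n = x n)"
proof -
  define p q r where "p = x (i + 2)" and "q = x (i + 3)" and "r = x (i + 4)"
  have pqr: "det3 p q r \<noteq> 0"
    using nz by (simp add: p_def q_def r_def skip3_def add.assoc)
  define L where "L l c = (if l = 0 then det3 c p r else if l = 1 then det3 c p q
    else det3 c q r - det3 c p r / skip2 x (i + 1) * skip1 x (i + 1))" for l :: nat and c
  have polyL: "polyfun (\<lambda>x. L l (x i))" for l
  proof -
    have "polyfun (\<lambda>z. det3 (z i) q r - (det3 (z i) p r * (1 / skip2 x (i + 1))) * skip1 x (i + 1))"
      by (intro polyfun_intros polyfun_det3_site)
    then show ?thesis by (cases "l = 0"; cases "l = 1") (simp_all add: L_def polyfun_det3_site)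
  qed
  have "\<exists>v. L l v \<noteq> 0" for l
  proof -
    have "L 0 q \<noteq> 0" "L 1 r \<noteq> 0" "l \<noteq> 0 \<and> l \<noteq> 1 \<Longrightarrow> L l p \<noteq> 0"
      using pqr det3_swap(1)[of q p r] det3_swap(1)[of r p q] det3_swap(2)[of p r q]
      by (simp_all add: L_def det3_repeat)
    then show ?thesis by (cases "l = 0"; cases "l = 1") auto
  qed
  then have "\<exists>c. f ((partial_param (i + 1) g k x)(i := c)) \<noteq> 0 \<and> (\<forall>l\<in>{0,1,2}. L l c \<noteq> 0)"
    by (intro exists_generic_vector[OF f] polyL) auto
  then obtain c where c: "f ((partial_param (i + 1) g k x)(i := c)) \<noteq> 0" "\<forall>l\<in>{0,1,2}. L l c \<noteq> 0"
    by blast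
  then have c': "det3 c p r \<noteq> 0" "det3 c p q \<noteq> 0"
      "det3 c q r - det3 c p r / skip2 x (i + 1) * skip1 x (i + 1) \<noteq> 0"
    by (simp_all add: L_def)
  then obtain x' where x': "\<And>n. n \<noteq> i \<Longrightarrow> n \<noteq> i + 1 \<Longrightarrow> x' n = x n" "heat_step x' i = c"
    "skip1 x' (i + 1) = skip1 x (i + 1)" "skip2 x' (i + 1) = skip2 x (i + 1)"
    "skip3 x' i = g" "skip3 x' (i + 1) \<noteq> 0"
    "skip2 x' i = (det3 c q r - det3 c p r / skip2 x (i + 1) * skip1 x (i + 1)) / skip3 x (i + 2)"
    using prescribe_heat_step[OF nz, of c g] unfolding p_def q_def r_def by blast
  have "partial_param i g k x' n = ((partial_param (i + 1) g k x)(i := c)) n" for n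
  proof -
    consider "n < i" | "n = i" | "n = i + 1" | "i + 1 < n" by linarith
    then show ?thesis
    proof cases
      case 1
      then show ?thesis using i x'(1)[of n] by (auto simp: partial_param_def)
    next
      case 2
      then show ?thesis using i x'(2) by (simp add: partial_param_def)
    next
      case 3
      have "heat_step x' (i + 1) = heat_step x (i + 1)"
        using x'(3,4) by (simp add: heat_step_def x'(1))
      then show ?thesis using 3 i x'(3,4) by (cases "i = k") (auto simp: partial_param_def)
    next
      case 4
      have "heat_step x' n = heat_step x n"
        by (rule heat_step_cong) (use 4 x'(1) in auto)
      moreover have "skip1 x' n = skip1 x n" "skip2 x' n = skip2 x n"
        using 4 by (simp_all add: skip1_def skip2_def x'(1))
      ultimately show ?thesis using 4 i x'(1)[of n] by (auto simp: partial_param_def)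
    qed
  qed
  then have "partial_param i g k x' = (partial_param (i + 1) g k x)(i := c)" by blast
  then show ?thesis
    using c(1) c'(3) x' nz by (intro exI[of _ x']) auto
qed

text \<open>
  Going down from \<open>i\<close> to \<open>0\<close>, the points at the sites below \<open>i\<close> can be replaced by old points that
  produce, after one heat step, points at which \<open>f\<close> does not vanish either.
\<close>

lemma descend:
  assumes "polyfun f"
  shows "f (partial_param (int i) g k x) \<noteq> 0 \<Longrightarrow> skip2 x (int i) \<noteq> 0 \<Longrightarrow> skip3 x (int i + 1) \<noteq> 0 \<Longrightarrow>
    int i \<le> k + 1 \<Longrightarrow>
    \<exists>x'. f (partial_param 0 g k x') \<noteq> 0 \<and> skip1 x' (int i) = skip1 x (int i) \<and>
      (\<forall>n>int i. x' n = x n) \<and> (0 < i \<or> skip3 x 0 = g \<longrightarrow> skip3 x' 0 = g)"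
proof (induction i arbitrary: x)
  case 0
  then show ?case by auto
next
  case (Suc i)
  then obtain y where y: "f (partial_param (int i) g k y) \<noteq> 0" "skip2 y (int i) \<noteq> 0"
    "skip3 y (int i + 1) \<noteq> 0" "skip3 y (int i) = g"
    "skip1 y (int i + 1) = skip1 x (int i + 1)" "\<forall>n>int i + 1. y n = x n"
    using descend_step[OF assms, of "int i" g k x] by (auto simp: algebra_simps)
  obtain x' where x': "f (partial_param 0 g k x') \<noteq> 0"
      "\<forall>n>int i. x' n = y n" "0 < i \<or> skip3 y 0 = g \<longrightarrow> skip3 x' 0 = g"
    using Suc.IH[OF y(1-3)] Suc.prems by auto
  have "skip1 x' (int i + 1) = skip1 y (int i + 1)" using x'(2) by (simp add: skip1_def)
  then show ?case using x' y by (intro exI[of _ x']) (auto simp: algebra_simps)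
qed

text \<open>
  Starting from a point where \<open>f\<close> does not vanish, the last stored data are realized by a choice of
  \<open>x (k + 1)\<close>, and the sites below are treated by descending.
\<close>

lemma heat_param_dominant:
  assumes "0 \<le> k" "polyfun f" "\<And>x. f (heat_param k x) = 0"
  shows "f x = 0"
proof (rule ccontr)
  assume "f x \<noteq> 0"
  have "\<exists>x. det3 (x (k + 2)) (x (k + 3)) (x (k + 4)) \<noteq> 0" 
    using parabola_positive unfolding positive_config_def by (intro exI[of _ parabola]) simp
  moreover have "polyfun (\<lambda>x. det3 (x (k + 2)) (x (k + 3)) (x (k + 4)))"
    by (intro polyfun_det3 polyfun_coord)
  ultimately obtain z where "f z \<noteq> 0" "det3 (z (k + 2)) (z (k + 3)) (z (k + 4)) \<noteq> 0"
    using polyfun_common_nonzero[OF assms(2)] \<open>f x \<noteq> 0\<close> by blast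
  moreover have "polyfun (\<lambda>x. f x * det3 (x (k + 2)) (x (k + 3)) (x (k + 4)))"
    using assms(2) by (intro polyfun_mult polyfun_det3 polyfun_coord)
  ultimately have "\<exists>y. f y * det3 (y (k + 2)) (y (k + 3)) (y (k + 4)) \<noteq> 0 \<and> y (k + 1) $ (3::3) \<noteq> 0"
    by (intro polyfun_common_nonzero[where a = z and b = "\<lambda>_. axis 3 1"] polyfun_coord)
      (auto simp: axis_def)
  then obtain y where y: "f y \<noteq> 0" "det3 (y (k + 2)) (y (k + 3)) (y (k + 4)) \<noteq> 0"
      "y (k + 1) $ (3::3) \<noteq> 0" by auto
  define d where "d = det3 (y (k + 2)) (y (k + 3)) (y (k + 4))"
  define g where "g = y (k + 1) $ 1"
  define x where "x = y(k + 1 := (1 / d) *s (y (k + 1) $ 2 *s y (k + 2) - y (k + 1) $ 3 *s y (k + 3)))"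
  have "d \<noteq> 0" using y by (simp add: d_def)
  have s: "skip1 x (k + 1) = y (k + 1) $ 2" "skip2 x (k + 1) = y (k + 1) $ 3" "skip3 x (k + 2) = d"
    using \<open>d \<noteq> 0\<close> det3_swap(1)[of "y (k + 3)" "y (k + 2)" "y (k + 4)"]
    by (simp_all add: skip1_def skip2_def skip3_def x_def add.assoc det3_scale det3_diff
        det3_repeat d_def[symmetric])
  have "partial_param (k + 1) g k x = y"
  proof
    fix n
    show "partial_param (k + 1) g k x n = y n"
      using assms(1) s by (auto simp: partial_param_def g_def vec3_eq_iff vector_3 x_def)
  qed
  then have nz: "f (partial_param (k + 1) g k x) \<noteq> 0" "skip2 x (k + 1) \<noteq> 0" "skip3 x (k + 1 + 1) \<noteq> 0"
    using y s \<open>d \<noteq> 0\<close> by (simp_all add: add.assoc)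
  have k1: "int (nat (k + 1)) = k + 1" "0 < nat (k + 1)" using assms(1) by auto
  obtain x' where "f (partial_param 0 g k x') \<noteq> 0" "skip3 x' 0 = g"
    using descend[OF assms(2), of "nat (k + 1)" g k x, unfolded k1, OF nz] k1 by auto
  then show False using assms(3)[of x'] by (simp add: heat_param_def)
qed

section \<open>The iterates have no common factor\<close>

text \<open>
  If \<open>skip1 x j = 0\<close>, then the new point at \<open>j\<close> is a multiple of \<open>x (j + 2)\<close>.  When the points beyond
  \<open>j\<close> lie on the parabola and the new points below \<open>j\<close> are taken to be \<open>parabola (n + 2)\<close>, the new points
  form a mixture of consecutive points of the parabola and are positive.  Descending from \<open>j\<close> finds
  old points below \<open>j\<close> whose new points still give a nonzero iterate.
\<close>

lemma skip1_zero_witness: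
  assumes "0 \<le> j" "j \<le> 3 * int m"
  shows "\<exists>x. skip1 x j = 0 \<and> (heat_step ^^ Suc m) x 0 \<noteq> 0"
proof -
  let ?p = parabola and ?k = "3 * int m"
  have pos: "0 \<le> det3 (?p a) (?p b) (?p c)" "det3 (?p a) (?p b) (?p c) \<noteq> 0" if "a < b" "b < c" for a b c
    using parabola_positive that by (auto simp: positive_config_def)
  define g where "g = skip3 ?p (j + 1)"
  have "g \<noteq> 0" using pos by (simp add: g_def skip3_def)
  define t where "t = - 1 / g"
  define x where "x n = (if n < j then ?p (n + 2) else if n = j then t *s ?p (j + 2) else ?p n)" for n
  have s: "skip1 x j = 0" "skip2 x j = 1" "skip3 x (j + 1) \<noteq> 0"
  proof -
    show "skip1 x j = 0" by (simp add: skip1_def x_def det3_scale det3_repeat)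
    have "skip2 x j = t * (- g)"
      using det3_swap(1)[of "?p (j + 2)" "?p (j + 1)" "?p (j + 3)"]
      by (simp add: skip2_def x_def det3_scale g_def skip3_def add.assoc)
    then show "skip2 x j = 1" using \<open>g \<noteq> 0\<close> by (simp add: t_def)
    show "skip3 x (j + 1) \<noteq> 0" using pos by (simp add: skip3_def x_def)
  qed
  define a where "a i = (if i \<le> j then 0 else skip1 ?p i)" for i
  define b where "b i = (if i \<le> j then 1 else skip2 ?p i)" for i
  define y where "y i = a i *s ?p (i + 1) + b i *s ?p (i + 2)" for i
  have "positive_config y"
    unfolding y_def[abs_def]
    by (rule mixture_positive)
      (use pos in \<open>auto simp: a_def b_def skip1_def skip2_def less_eq_complex_def[of 0 1]\<close>)
  then have "(heat_step ^^ m) y 0 \<noteq> 0" by (intro positive_config_nonzero heat_iterate_positive)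
  moreover have "(heat_step ^^ m) (partial_param j 0 ?k x) 0 = (heat_step ^^ m) y 0"
  proof (rule heat_iterate_cong)
    fix n assume n: "0 \<le> n" "n \<le> 0 + 3 * int m"
    have "heat_step x n = y n" if "j \<le> n"
    proof (cases "n = j")
      case True
      then show ?thesis using s by (simp add: heat_step_def y_def a_def b_def) (simp add: x_def)
    next
      case False
      then have "heat_step x n = heat_step ?p n" using that by (intro heat_step_cong) (simp add: x_def)
      then show ?thesis using False that by (simp add: heat_step_def y_def a_def b_def)
    qed
    moreover have "x n = y n" if "n < j"
      using that by (simp add: x_def y_def a_def b_def)
    ultimately show "partial_param j 0 ?k x n = y n" using n by (simp add: partial_param_def)
  qed
  ultimately obtain l where "(heat_step ^^ m) (partial_param j 0 ?k x) 0 $ l \<noteq> 0"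
    by (metis vec_eq_iff zero_index)
  moreover have "int (nat j) = j" using assms by simp
  ultimately obtain x' where x': "(heat_step ^^ m) (partial_param 0 0 ?k x') 0 $ l \<noteq> 0" "skip1 x' j = skip1 x j"
    using descend[OF polyfun_heat_iterate[of m 0 l], of "nat j" 0 ?k x] s assms by auto
  have "(heat_step ^^ m) (partial_param 0 0 ?k x') 0 = (heat_step ^^ m) (heat_step x') 0"
    by (rule heat_iterate_cong) (simp add: partial_param_def)
  then have "(heat_step ^^ Suc m) x' 0 \<noteq> 0"
    using x'(1) unfolding heat_iterate_Suc_right by auto
  then show ?thesis using x'(2) s(1) by auto
qed

lemma heat_step_scale: "heat_step (\<lambda>i. s *s x i) i = s ^ 4 *s heat_step x i"
  by (simp add: heat_step_def skip1_def skip2_def det3_scale vec3_eq_iff algebra_simps power4_eq_xxxx)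

lemma heat_step_reverse: "heat_step (\<lambda>i. x (N - i)) i = (- 1) *s heat_step x (N - 3 - i)"
proof -
  define p where "p = N - 3 - i"
  have sites: "N - i = p + 3" "N - (i + 1) = p + 2" "N - (i + 2) = p + 1" "N - (i + 3) = p"
    by (auto simp: p_def)
  show ?thesis
    using det3_swap(3)[of "x p" "x (p + 1)" "x (p + 3)"] det3_swap(3)[of "x p" "x (p + 2)" "x (p + 3)"]
    unfolding heat_step_def skip1_def skip2_def p_def[symmetric] sites
    by (simp add: vec3_eq_iff)
qed

text \<open>
  The midpoint construction is symmetric under reversing the order of the points.  The reflection
  exchanges \<open>skip1\<close> and \<open>skip2\<close> up to sign.
\<close>

lemma heat_iterate_reverse:
  "\<exists>s. s \<noteq> 0 \<and> (\<forall>i. (heat_step ^^ m) (\<lambda>i. x (N - i)) i = s *s (heat_step ^^ m) x (N - 3 * int m - i))"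
proof (induction m)
  case 0
  show ?case by (rule exI[of _ 1]) simp
next
  case (Suc m)
  then obtain s where s: "s \<noteq> 0" "(heat_step ^^ m) (\<lambda>i. x (N - i))
      = (\<lambda>i. s *s (heat_step ^^ m) x (N - 3 * int m - i))" by blast
  have "(heat_step ^^ Suc m) (\<lambda>i. x (N - i)) i
      = (- (s ^ 4)) *s (heat_step ^^ Suc m) x (N - 3 * int (Suc m) - i)" for i
  proof -
    have "(heat_step ^^ Suc m) (\<lambda>i. x (N - i)) i
        = s ^ 4 *s heat_step (\<lambda>i. (heat_step ^^ m) x (N - 3 * int m - i)) i"
      by (simp add: s(2) heat_step_scale)
    also have "\<dots> = (- (s ^ 4)) *s (heat_step ^^ Suc m) x (N - 3 * int m - 3 - i)"
      unfolding heat_step_reverse by (simp add: vec3_eq_iff)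
    finally show ?thesis by (simp add: algebra_simps)
  qed
  then show ?case using s(1) by (intro exI[of _ "- (s ^ 4)"]) simp
qed

lemma skip2_zero_witness:
  assumes "1 \<le> j" "j \<le> 3 * int m + 1"
  shows "\<exists>x. skip2 x j = 0 \<and> (heat_step ^^ Suc m) x 0 \<noteq> 0"
proof (cases "j = 3 * int m + 1")
  case True
  (* the last point involved in skip2 x j does not influence the iterate at all *)
  have "(heat_step ^^ Suc m) parabola 0 \<noteq> 0"
    by (intro positive_config_nonzero heat_iterate_positive parabola_positive)
  moreover have "skip2 (parabola(3 * int m + 4 := parabola j)) j = 0"
    using True by (simp add: skip2_def det3_repeat)
  moreover have "(heat_step ^^ Suc m) (parabola(3 * int m + 4 := parabola j)) 0 = (heat_step ^^ Suc m) parabola 0"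
    by (rule heat_iterate_cong) simp
  ultimately show ?thesis by metis
next
  case False
  define N where "N = 3 * int (Suc m)"
  obtain x where x: "skip1 x (N - 3 - j) = 0" "(heat_step ^^ Suc m) x 0 \<noteq> 0"
    using skip1_zero_witness[of "N - 3 - j" m] False assms by (auto simp: N_def)
  obtain s where s: "s \<noteq> 0" "(heat_step ^^ Suc m) (\<lambda>i. x (N - i)) 0 = s *s (heat_step ^^ Suc m) x (N - N - 0)"
    using heat_iterate_reverse[of "Suc m" x N] unfolding N_def by blast
  have "(heat_step ^^ Suc m) (\<lambda>i. x (N - i)) 0 \<noteq> 0"
    unfolding s(2) using s(1) x(2) by (simp add: vec_eq_iff)
  moreover have "skip2 (\<lambda>i. x (N - i)) j = 0"
  proof -
    define p where "p = N - 3 - j"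
    have sites: "N - j = p + 3" "N - (j + 1) = p + 2" "N - (j + 3) = p" by (auto simp: p_def)
    show ?thesis
      using x(1) det3_swap(3)[of "x p" "x (p + 2)" "x (p + 3)"]
      unfolding skip1_def skip2_def p_def[symmetric] sites by simp
  qed
  ultimately show ?thesis by (intro exI[of _ "\<lambda>i. x (N - i)"] conjI)
qed

text \<open>
  Two different coordinates are non-associated primes.
\<close>

lemma coprime_tuple_site: "coprime_tuple (\<lambda>j (x :: int \<Rightarrow> complex ^ 3). x 0 $ j)"
  unfolding coprime_tuple_def
proof (intro conjI allI impI)
  fix P :: "3 \<Rightarrow> (int \<Rightarrow> complex ^ 3) \<Rightarrow> complex"
  assume P: "(\<forall>j. polyfun (P j)) \<and> (\<forall>j k x. x 0 $ j * P k x = x 0 $ k * P j x)"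
  let ?X = "\<lambda>j x :: int \<Rightarrow> complex ^ 3. x 0 $ (j :: 3)"
  have "divides (?X 1) (\<lambda>x. ?X 2 x * P 1 x)"
    using P unfolding divides_def by blast
  moreover have "\<not> divides (?X 1) (?X 2)"
  proof
    assume "divides (?X 1) (?X 2)"
    then obtain h where "\<And>x. ?X 2 x = ?X 1 x * h x" unfolding divides_def by blast
    from this[of "\<lambda>_. axis 2 1"] show False by (simp add: axis_def)
  qed
  ultimately have "divides (?X 1) (P 1)"
    using prime_polyfun_coord[of 0 "1 :: 3"] P polyfun_coord unfolding prime_polyfun_def by blast
  then obtain N where N: "polyfun N" "\<And>x. P 1 x = ?X 1 x * N x" unfolding divides_def by blast
  have "P j x = N x * x 0 $ j" for j x
  proof (rule polyfun_cancel[of "?X 1"])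
    show "?X 1 (\<lambda>_. axis 1 1) \<noteq> 0" by (simp add: axis_def)
    show "?X 1 x * P j x = ?X 1 x * (N x * x 0 $ j)" for x
      using P N(2)[of x] by (simp add: mult_ac)
  qed (use P N in \<open>auto intro: polyfun_intros\<close>)
  then show "\<exists>N. polyfun N \<and> (\<forall>j x. P j x = N x * x 0 $ j)" using N(1) by blast
qed (rule polyfun_coord)

theorem coprime_heat_iterate: "coprime_tuple (\<lambda>j x. (heat_step ^^ m) x 0 $ j)"
proof (induction m)
  case 0
  show ?case using coprime_tuple_site by simp
next
  case (Suc m)
  let ?k = "3 * int m"
  have eq: "(heat_step ^^ m) (heat_param ?k x) 0 = (heat_step ^^ Suc m) x 0" for x
    unfolding heat_iterate_Suc_right
    by (rule heat_iterate_cong) (simp add: heat_param_def partial_param_def)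
  have "coprime_tuple (\<lambda>j x. (heat_step ^^ m) (heat_param ?k x) 0 $ j)"
  proof (rule coprime_tuple_pullback[OF Suc polyfun_heat_param])
    show "\<And>f. polyfun f \<Longrightarrow> (\<And>x. f (heat_param ?k x) = 0) \<Longrightarrow> (\<And>x. f x = 0)"
      by (rule heat_param_dominant[of ?k]) auto
    show "\<And>i j. localized (heat_param ?k) (bad_primes ?k) (\<lambda>x. x i $ j)"
      by (rule localized_old_points) simp
    show "\<And>q. q \<in> bad_primes ?k \<Longrightarrow> prime_polyfun q" by (rule prime_bad_primes)
    fix q assume "q \<in> bad_primes ?k"
    then obtain x where x: "q x = 0" "(heat_step ^^ Suc m) x 0 \<noteq> 0"
      unfolding bad_primes_def
      using skip1_zero_witness[of _ m] skip2_zero_witness[of _ m] skip3_zero_witness[of _ m] by blast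
    then obtain j where "(heat_step ^^ Suc m) x 0 $ j \<noteq> 0" by (metis vec_eq_iff zero_index)
    then show "\<exists>j. \<not> divides q (\<lambda>x. (heat_step ^^ m) (heat_param ?k x) 0 $ j)"
      unfolding eq divides_def using x(1) by (metis mult_zero_left)
  qed
  then show ?case unfolding eq .
qed

section \<open>Formal polynomials and polynomial functions\<close>

definition monom_eval :: "((int \<times> 'n) \<Rightarrow>\<^sub>0 nat) \<Rightarrow> (int \<Rightarrow> complex ^ 'n::finite) \<Rightarrow> complex" where
  "monom_eval m x = (\<Prod>(i, j)\<in>Poly_Mapping.keys m. (x i $ j) ^ Poly_Mapping.lookup m (i, j))"

lemma monom_eval_superset:
  assumes "finite A" "Poly_Mapping.keys m \<subseteq> A"
  shows "monom_eval m x = (\<Prod>(i, j)\<in>A. (x i $ j) ^ Poly_Mapping.lookup m (i, j))"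
  unfolding monom_eval_def
  by (rule prod.mono_neutral_left) (use assms in \<open>auto simp: in_keys_iff\<close>)

lemma mpoly_eval_superset:
  assumes "finite A" "Poly_Mapping.keys p \<subseteq> A"
  shows "mpoly_eval p x = (\<Sum>m\<in>A. Poly_Mapping.lookup p m * monom_eval m x)"
  unfolding mpoly_eval_def monom_eval_def[symmetric]
  by (rule sum.mono_neutral_left) (use assms in \<open>auto simp: in_keys_iff\<close>)

lemma monom_eval_add: "monom_eval (a + b) x = monom_eval a x * monom_eval b x"
proof -
  let ?A = "Poly_Mapping.keys a \<union> Poly_Mapping.keys b"
  have "Poly_Mapping.keys (a + b) \<subseteq> ?A" by (rule Poly_Mapping.keys_add)
  then show ?thesis
    by (simp add: monom_eval_superset[of ?A] lookup_add power_add prod.distrib[symmetric] split_beta)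
qed

lemma monom_eval_ones: "monom_eval m (\<lambda>_. \<chi> _. 1) = 1"
  by (simp add: monom_eval_def split_beta)

lemma mpoly_eval_add: "mpoly_eval (p + q) x = mpoly_eval p x + mpoly_eval q x"
proof -
  let ?A = "Poly_Mapping.keys p \<union> Poly_Mapping.keys q"
  have "Poly_Mapping.keys (p + q) \<subseteq> ?A" by (rule Poly_Mapping.keys_add)
  then show ?thesis
    by (simp add: mpoly_eval_superset[of ?A] lookup_add sum.distrib[symmetric] algebra_simps)
qed

lemma mpoly_eval_zero: "mpoly_eval 0 x = 0"
  by (simp add: mpoly_eval_def)

lemma mpoly_eval_single: "mpoly_eval (Poly_Mapping.single m c) x = c * monom_eval m x"
  by (simp add: mpoly_eval_superset[of "{m}"])

lemma mpoly_eval_sum: "mpoly_eval (\<Sum>a\<in>A. f a) x = (\<Sum>a\<in>A. mpoly_eval (f a) x)"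
  by (induction A rule: infinite_finite_induct) (simp_all add: mpoly_eval_zero mpoly_eval_add)

lemma poly_mapping_sum_single:
  "p = (\<Sum>m\<in>Poly_Mapping.keys p. Poly_Mapping.single m (Poly_Mapping.lookup p m))"
  by (rule poly_mapping_eqI) (auto simp: lookup_sum lookup_single when_def in_keys_iff)

lemma mpoly_eval_mult: "mpoly_eval (p * q) x = mpoly_eval p x * mpoly_eval q x"
proof -
  let ?s = "\<lambda>p m. Poly_Mapping.single m (Poly_Mapping.lookup p m)"
  have "p * q = (\<Sum>m\<in>Poly_Mapping.keys p. ?s p m) * (\<Sum>n\<in>Poly_Mapping.keys q. ?s q n)"
    by (simp add: poly_mapping_sum_single[symmetric])
  also have "\<dots> = (\<Sum>m\<in>Poly_Mapping.keys p. \<Sum>n\<in>Poly_Mapping.keys q.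
      Poly_Mapping.single (m + n) (Poly_Mapping.lookup p m * Poly_Mapping.lookup q n))"
    by (simp add: sum_product mult_single)
  finally have "mpoly_eval (p * q) x = (\<Sum>m\<in>Poly_Mapping.keys p. \<Sum>n\<in>Poly_Mapping.keys q.
      (Poly_Mapping.lookup p m * monom_eval m x) * (Poly_Mapping.lookup q n * monom_eval n x))"
    by (simp add: mpoly_eval_sum mpoly_eval_single monom_eval_add mult_ac)
  then show ?thesis
    by (simp add: sum_product[symmetric] mpoly_eval_superset[OF finite_keys subset_refl, of p]
        mpoly_eval_superset[OF finite_keys subset_refl, of q])
qed

lemma polyfun_monom_eval: "polyfun (monom_eval m)"
proof -
  have "polyfun (\<lambda>x. \<Prod>v\<in>Poly_Mapping.keys m. (x (fst v) $ snd v) ^ Poly_Mapping.lookup m v)"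
    by (intro polyfun_intros)
  then show ?thesis by (simp add: monom_eval_def[abs_def] split_beta)
qed

lemma polyfun_mpoly_eval: "polyfun (mpoly_eval p)"
proof -
  have "polyfun (\<lambda>x. \<Sum>m\<in>Poly_Mapping.keys p. Poly_Mapping.lookup p m * monom_eval m x)"
    by (intro polyfun_intros polyfun_monom_eval)
  then show ?thesis by (simp add: mpoly_eval_def[abs_def] monom_eval_def)
qed

lemma polyfun_is_mpoly_eval:
  assumes "polyfun f"
  shows "\<exists>p. mpoly_eval p = f"
  using assms
proof induction
  case (polyfun_const c)
  show ?case
    by (rule exI[of _ "Poly_Mapping.single 0 c"]) (simp add: fun_eq_iff mpoly_eval_single monom_eval_def)
next
  case (polyfun_coord i j)
  show ?case
    by (rule exI[of _ "Poly_Mapping.single (Poly_Mapping.single (i, j) 1) 1"])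
      (simp add: fun_eq_iff mpoly_eval_single monom_eval_def)
next
  case (polyfun_add f g)
  then obtain p q where "mpoly_eval p = f" "mpoly_eval q = g" by blast
  then show ?case by (intro exI[of _ "p + q"]) (auto simp: fun_eq_iff mpoly_eval_add)
next
  case (polyfun_mult f g)
  then obtain p q where "mpoly_eval p = f" "mpoly_eval q = g" by blast
  then show ?case by (intro exI[of _ "p * q"]) (auto simp: fun_eq_iff mpoly_eval_mult)
qed

lemma complex_power2_inject: "(2 :: complex) ^ a = 2 ^ b \<longleftrightarrow> a = b"
proof -
  have "complex_of_real (2 ^ a) = complex_of_real (2 ^ b) \<longleftrightarrow> a = b"
    unfolding of_real_eq_iff by simp
  then show ?thesis by simp
qed

lemma monom_eval_mult_args:
  "monom_eval m (\<lambda>i. \<chi> j. x i $ j * y i $ j) = monom_eval m x * monom_eval m y"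
  by (simp add: monom_eval_def power_mult_distrib prod.distrib[symmetric] split_beta)

lemma monom_eval_separates:
  assumes "m \<noteq> m'"
  shows "\<exists>y. monom_eval m y \<noteq> monom_eval m' y"
proof -
  obtain i j where ij: "Poly_Mapping.lookup m (i, j) \<noteq> Poly_Mapping.lookup m' (i, j)"
    using assms by (auto simp: poly_mapping_eq_iff fun_eq_iff)
  define y :: "int \<Rightarrow> complex ^ 'a" where "y i' = (\<chi> j'. if i' = i \<and> j' = j then 2 else 1)" for i'
  have e: "monom_eval k y = 2 ^ Poly_Mapping.lookup k (i, j)" for k
  proof -
    have "monom_eval k y = (\<Prod>(i', j')\<in>insert (i, j) (Poly_Mapping.keys k).
        (y i' $ j') ^ Poly_Mapping.lookup k (i', j'))"
      by (rule monom_eval_superset) auto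
    also have "\<dots> = (\<Prod>v\<in>insert (i, j) (Poly_Mapping.keys k).
        if v = (i, j) then 2 ^ Poly_Mapping.lookup k (i, j) else 1)"
      by (rule prod.cong) (auto simp: y_def split: if_splits)
    finally show ?thesis by (simp add: prod.delta)
  qed
  show ?thesis using ij by (intro exI[of _ y]) (simp add: e complex_power2_inject)
qed

text \<open>
  Monomials are characters of the multiplicative monoid of all coordinate vectors.  Their linear
  independence is Dedekind's lemma: a relation can be shortened by multiplying the argument by a
  point on which two of the characters differ.
\<close>

lemma monom_eval_independent:
  assumes "finite A" "\<And>x. (\<Sum>m\<in>A. c m * monom_eval m x) = 0" "m \<in> A"
  shows "c m = 0"
  using assms
proof (induction "card A" arbitrary: A c m)
  case 0
  then show ?case by simp
next
  case (Suc n)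
  have others: "c k = 0" if k: "k \<in> A" "k \<noteq> m" for k
  proof -
    obtain y where y: "monom_eval k y \<noteq> monom_eval m y" using monom_eval_separates k by blast
    have "(\<Sum>l\<in>A - {m}. (c l * (monom_eval l y - monom_eval m y)) * monom_eval l x) = 0" for x
    proof -
      have "(\<Sum>l\<in>A. c l * monom_eval l (\<lambda>i. \<chi> j. x i $ j * y i $ j))
          - monom_eval m y * (\<Sum>l\<in>A. c l * monom_eval l x) = 0"
        using Suc.prems(2) by simp
      then have "(\<Sum>l\<in>A. (c l * (monom_eval l y - monom_eval m y)) * monom_eval l x) = 0"
        by (simp add: monom_eval_mult_args sum_distrib_left sum_subtractf[symmetric] algebra_simps)
      then show ?thesis using Suc.prems(1,3) by (simp add: sum.remove)
    qed
    moreover have "n = card (A - {m})" using Suc by simp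
    ultimately have "c k * (monom_eval k y - monom_eval m y) = 0"
      using Suc.hyps(1)[of "A - {m}" "\<lambda>l. c l * (monom_eval l y - monom_eval m y)" k] Suc.prems(1) k
      by blast
    then show ?thesis using y by simp
  qed
  have "(\<Sum>l\<in>A. c l * monom_eval l (\<lambda>_. \<chi> _. 1)) = c m"
    using Suc.prems(1,3) others by (simp add: monom_eval_ones sum.remove)
  then show ?case using Suc.prems(2) by simp
qed

lemma mpoly_eval_inject: "mpoly_eval p = mpoly_eval q \<longleftrightarrow> p = q"
proof
  assume eq: "mpoly_eval p = mpoly_eval q"
  let ?A = "Poly_Mapping.keys p \<union> Poly_Mapping.keys q"
  show "p = q"
  proof (rule poly_mapping_eqI)
    fix m
    show "Poly_Mapping.lookup p m = Poly_Mapping.lookup q m"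
    proof (cases "m \<in> ?A")
      case True
      have "(\<Sum>m\<in>?A. (Poly_Mapping.lookup p m - Poly_Mapping.lookup q m) * monom_eval m x) = 0" for x
        using fun_cong[OF eq, of x]
        by (simp add: mpoly_eval_superset[of ?A] left_diff_distrib sum_subtractf)
      then have "Poly_Mapping.lookup p m - Poly_Mapping.lookup q m = 0"
        by (rule monom_eval_independent[rotated]) (use True in auto)
      then show ?thesis by simp
    next
      case False
      then show ?thesis by (simp add: in_keys_iff)
    qed
  qed
qed simp

lemma mpoly_eval_eq_zero_iff: "(\<forall>x. mpoly_eval p x = 0) \<longleftrightarrow> p = 0"
  using mpoly_eval_inject[of p 0] by (auto simp: fun_eq_iff mpoly_eval_zero)

lemma mpoly_dvd_iff: "p dvd q \<longleftrightarrow> divides (mpoly_eval p) (mpoly_eval q)"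
proof
  assume "p dvd q"
  then obtain r where "q = p * r" by (rule dvdE)
  then show "divides (mpoly_eval p) (mpoly_eval q)"
    unfolding divides_def by (intro exI[of _ "mpoly_eval r"]) (simp add: polyfun_mpoly_eval mpoly_eval_mult)
next
  assume "divides (mpoly_eval p) (mpoly_eval q)"
  then obtain h where h: "polyfun h" "\<And>x. mpoly_eval q x = mpoly_eval p x * h x"
    unfolding divides_def by blast
  obtain r where "mpoly_eval r = h" using polyfun_is_mpoly_eval[OF h(1)] by blast
  then have "mpoly_eval q = mpoly_eval (p * r)" using h(2) by (auto simp: fun_eq_iff mpoly_eval_mult)
  then show "p dvd q" unfolding mpoly_eval_inject by simp
qed

definition parallel :: "complex ^ 'n::finite \<Rightarrow> complex ^ 'n \<Rightarrow> bool" where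
  "parallel a b \<longleftrightarrow> (\<forall>j k. a $ j * b $ k = a $ k * b $ j)"

lemma same_ratios_iff: "same_ratios F G \<longleftrightarrow> (\<forall>x. parallel (tuple_eval F x) (tuple_eval G x))"
  unfolding same_ratios_def parallel_def tuple_eval_def mpoly_eval_inject[symmetric]
  by (auto simp: fun_eq_iff mpoly_eval_mult)

section \<open>Homogeneous maps\<close>

definition scale_site :: "int \<Rightarrow> complex \<Rightarrow> (int \<Rightarrow> complex ^ 'n::finite) \<Rightarrow> int \<Rightarrow> complex ^ 'n" where
  "scale_site i c x = x(i := c *s x i)"

lemma monom_eval_scale_site:
  "monom_eval m (scale_site i c x) = c ^ (\<Sum>j\<in>UNIV. Poly_Mapping.lookup m (i, j)) * monom_eval m x"
proof -
  define I where "I = insert i (fst ` Poly_Mapping.keys m)"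
  have I: "finite I" "i \<in> I" "Poly_Mapping.keys m \<subseteq> I \<times> UNIV" by (force simp: I_def)+
  have e: "monom_eval m y = (\<Prod>i\<in>I. \<Prod>j\<in>UNIV. (y i $ j) ^ Poly_Mapping.lookup m (i, j))" for y
    using I by (simp add: monom_eval_superset[of "I \<times> UNIV"] prod.cartesian_product)
  have "(\<Prod>i'\<in>I - {i}. \<Prod>j\<in>UNIV. (scale_site i c x i' $ j) ^ Poly_Mapping.lookup m (i', j))
      = (\<Prod>i'\<in>I - {i}. \<Prod>j\<in>UNIV. (x i' $ j) ^ Poly_Mapping.lookup m (i', j))"
    by (rule prod.cong) (auto simp: scale_site_def)
  then show ?thesis
    unfolding e using I
    by (simp add: prod.remove[of I i] scale_site_def power_mult_distrib prod.distrib power_sum)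
qed

lemma lookup_const_mult: "Poly_Mapping.lookup (Poly_Mapping.single 0 c * p) m = c * Poly_Mapping.lookup p m"
  for p :: "'n::finite mpoly"
  unfolding mult_map_scale_conv_mult[symmetric] by (simp add: Poly_Mapping.map.rep_eq when_def)

text \<open>
  Scaling a single site multiplies each monomial by a power of the scalar.  Since distinct monomials
  are linearly independent, scaling by \<open>2\<close> already forces all monomials to have the same degree there.
\<close>

lemma multihomogeneous_iff:
  "multihomogeneous S d p \<longleftrightarrow>
     (\<forall>i c x. mpoly_eval p (scale_site i c x) = (if i \<in> S then c ^ d i else 1) * mpoly_eval p x)"
  (is "_ \<longleftrightarrow> ?R")
proof
  assume hom: "multihomogeneous S d p"
  show ?R
  proof (intro allI)
    fix i c x
    have "monom_eval m (scale_site i c x) = (if i \<in> S then c ^ d i else 1) * monom_eval m x"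
      if m: "m \<in> Poly_Mapping.keys p" for m
    proof (cases "i \<in> S")
      case True
      then show ?thesis using hom m by (simp add: multihomogeneous_def monom_eval_scale_site)
    next
      case False
      have "Poly_Mapping.keys m \<subseteq> S \<times> UNIV" using hom m by (simp add: multihomogeneous_def)
      then have "Poly_Mapping.lookup m (i, j) = 0" for j
        using False by (auto simp: in_keys_iff)
      then show ?thesis using False by (simp add: monom_eval_scale_site)
    qed
    then show "mpoly_eval p (scale_site i c x) = (if i \<in> S then c ^ d i else 1) * mpoly_eval p x"
      by (simp add: mpoly_eval_superset[of "Poly_Mapping.keys p"] sum_distrib_left mult_ac cong: sum.cong)
  qed
next
  assume R: ?R
  have deg: "(\<Sum>j\<in>UNIV. Poly_Mapping.lookup m (i, j)) = (if i \<in> S then d i else 0)"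
    if m: "m \<in> Poly_Mapping.keys p" for m i
  proof -
    let ?deg = "\<lambda>m. \<Sum>j\<in>UNIV. Poly_Mapping.lookup m (i, j)"
    define q where "q = (\<Sum>m\<in>Poly_Mapping.keys p. Poly_Mapping.single m (2 ^ ?deg m * Poly_Mapping.lookup p m))"
    have "mpoly_eval q x = mpoly_eval p (scale_site i 2 x)" for x
      by (simp add: q_def mpoly_eval_sum mpoly_eval_single monom_eval_scale_site
          mpoly_eval_superset[of "Poly_Mapping.keys p" p] mult_ac)
    then have "mpoly_eval q = mpoly_eval (Poly_Mapping.single 0 (2 ^ (if i \<in> S then d i else 0)) * p)"
      using R by (auto simp: fun_eq_iff mpoly_eval_mult mpoly_eval_single monom_eval_def)
    then have "Poly_Mapping.lookup q m = 2 ^ (if i \<in> S then d i else 0) * Poly_Mapping.lookup p m"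
      unfolding mpoly_eval_inject by (simp only: lookup_const_mult)
    moreover have "Poly_Mapping.lookup q m = 2 ^ ?deg m * Poly_Mapping.lookup p m"
      using m by (simp add: q_def lookup_sum lookup_single when_def)
    ultimately have "(2 :: complex) ^ ?deg m = 2 ^ (if i \<in> S then d i else 0)"
      using m by (simp add: in_keys_iff)
    then show ?thesis unfolding complex_power2_inject .
  qed
  show "multihomogeneous S d p"
    unfolding multihomogeneous_def
  proof (intro ballI conjI subsetI)
    fix m v assume m: "m \<in> Poly_Mapping.keys p" and v: "v \<in> Poly_Mapping.keys m"
    obtain i j where ij: "v = (i, j)" by (cases v)
    have "i \<in> S"
    proof (rule ccontr)
      assume "i \<notin> S"
      then have "(\<Sum>j\<in>UNIV. Poly_Mapping.lookup m (i, j)) = 0" using deg[OF m, of i] by simp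
      then show False using v ij by (simp add: in_keys_iff)
    qed
    then show "v \<in> S \<times> UNIV" using ij by simp
  next
    fix m i assume "m \<in> Poly_Mapping.keys p" "i \<in> S"
    then show "(\<Sum>j\<in>UNIV. Poly_Mapping.lookup m (i, j)) = d i" using deg by simp
  qed
qed

text \<open>
  The scalar \<open>c = 0\<close> is included.  For a site outside \<open>S\<close> the condition then says that \<open>f\<close> does not
  change when the point at this site is replaced by zero, so \<open>f\<close> is independent of it.
\<close>

definition homogeneous_map ::
    "int set \<Rightarrow> (int \<Rightarrow> nat) \<Rightarrow> ((int \<Rightarrow> complex ^ 'n::finite) \<Rightarrow> complex ^ 'n) \<Rightarrow> bool" where
  "homogeneous_map S d f \<longleftrightarrow> (\<forall>j. polyfun (\<lambda>x. f x $ j)) \<and> (\<exists>x. f x \<noteq> 0) \<and>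
     (\<forall>i c x. f (scale_site i c x) = (if i \<in> S then c ^ d i else 1) *s f x)"

lemma homogeneous_tuple_iff: "homogeneous_tuple S d F \<longleftrightarrow> homogeneous_map S d (tuple_eval F)"
proof -
  have "(\<exists>j. F j \<noteq> 0) \<longleftrightarrow> (\<exists>x. tuple_eval F x \<noteq> 0)"
    unfolding mpoly_eval_eq_zero_iff[symmetric] by (auto simp: vec_eq_iff tuple_eval_def)
  then show ?thesis
    unfolding homogeneous_tuple_def homogeneous_map_def multihomogeneous_iff
    by (auto simp: tuple_eval_def vec_eq_iff polyfun_mpoly_eval)
qed

lemma tuple_eval_surj:
  assumes "\<And>j. polyfun (\<lambda>x. f x $ j)"
  shows "\<exists>F. tuple_eval F = f"
proof -
  have "\<forall>j. \<exists>p. mpoly_eval p = (\<lambda>x. f x $ j)" using polyfun_is_mpoly_eval assms by blast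
  then obtain F where "\<And>j. mpoly_eval (F j) = (\<lambda>x. f x $ j)" by metis
  then show ?thesis by (intro exI[of _ F]) (simp add: fun_eq_iff tuple_eval_def vec_eq_iff)
qed

lemma homogeneous_polyfun: "homogeneous_map S d f \<Longrightarrow> polyfun (\<lambda>x. f x $ j)"
  by (simp add: homogeneous_map_def)

lemma homogeneous_map_UNIV:
  "homogeneous_map S d f \<Longrightarrow> homogeneous_map UNIV (\<lambda>i. if i \<in> S then d i else 0) f"
  unfolding homogeneous_map_def by auto

lemma homogeneous_map_finite_support:
  assumes "homogeneous_map S d f"
  shows "\<exists>M. \<forall>x y. (\<forall>i. \<bar>i\<bar> \<le> M \<longrightarrow> x i = y i) \<longrightarrow> f x = f y"
proof -
  have "\<forall>j. \<exists>M. \<forall>x y. (\<forall>i. \<bar>i\<bar> \<le> M \<longrightarrow> x i = y i) \<longrightarrow> f x $ j = f y $ j"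
    using polyfun_finite_support homogeneous_polyfun[OF assms] by blast
  then obtain M where M: "\<And>j x y. (\<forall>i. \<bar>i\<bar> \<le> M j \<longrightarrow> x i = y i) \<Longrightarrow> f x $ j = f y $ j" by metis
  have m: "M j \<le> Max (range M)" for j by (intro Max_ge) auto
  show ?thesis
  proof (intro exI allI impI)
    fix x y :: "int \<Rightarrow> complex ^ 'a" assume xy: "\<forall>i. \<bar>i\<bar> \<le> Max (range M) \<longrightarrow> x i = y i"
    have "f x $ j = f y $ j" for j
      by (rule M) (use m[of j] xy in \<open>meson order_trans\<close>)
    then show "f x = f y" by (simp add: vec_eq_iff)
  qed
qed

lemma homogeneous_map_rescale:
  assumes "homogeneous_map UNIV e f" "finite A"
  shows "f (\<lambda>i. if i \<in> A then t i *s x i else x i) = (\<Prod>i\<in>A. t i ^ e i) *s f x"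
  using assms(2)
proof induction
  case (insert a A)
  have "(\<lambda>i. if i \<in> insert a A then t i *s x i else x i)
      = scale_site a (t a) (\<lambda>i. if i \<in> A then t i *s x i else x i)"
    using insert by (auto simp: scale_site_def fun_eq_iff)
  then show ?case using insert assms(1) by (simp add: homogeneous_map_def)
qed simp

lemma homogeneous_map_cong:
  assumes "homogeneous_map S d f" "\<And>i. i \<in> S \<Longrightarrow> x i = y i"
  shows "f x = f y"
proof -
  obtain M where M: "\<And>x y. (\<forall>i. \<bar>i\<bar> \<le> M \<longrightarrow> x i = y i) \<Longrightarrow> f x = f y"
    using homogeneous_map_finite_support[OF assms(1)] by blast
  (* scaling a site outside S by 0 does not change f *)
  have zero: "f (\<lambda>i. if i \<in> {-M..M} - S then 0 *s z i else z i) = f z" for z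
  proof -
    have "f (\<lambda>i. if i \<in> {-M..M} - S then 0 *s z i else z i)
        = (\<Prod>i\<in>{-M..M} - S. 0 ^ (if i \<in> S then d i else 0)) *s f z"
      by (rule homogeneous_map_rescale[OF homogeneous_map_UNIV[OF assms(1)]]) simp
    also have "(\<Prod>i\<in>{-M..M} - S. 0 ^ (if i \<in> S then d i else 0)) = (1 :: complex)"
      by (rule prod.neutral) simp
    finally show ?thesis by simp
  qed
  have "f (\<lambda>i. if i \<in> {-M..M} - S then 0 *s x i else x i)
      = f (\<lambda>i. if i \<in> {-M..M} - S then 0 *s y i else y i)"
    by (rule M) (use assms(2) in auto)
  then show ?thesis unfolding zero .
qed

section \<open>Points of projective space\<close>

lemma parallel_sym: "parallel a b \<Longrightarrow> parallel b a"
  unfolding parallel_def by (metis mult.commute)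

lemma parallel_iff_multiple:
  assumes "a \<noteq> 0"
  shows "parallel a b \<longleftrightarrow> (\<exists>c. b = c *s a)"
proof
  assume p: "parallel a b"
  obtain j where j: "a $ j \<noteq> 0" using assms by (auto simp: vec_eq_iff)
  have "b = (b $ j / a $ j) *s a"
    using p j by (auto simp: vec_eq_iff parallel_def field_simps)
  then show "\<exists>c. b = c *s a" ..
qed (auto simp: parallel_def)

lemma parallel_trans:
  assumes "parallel a b" "parallel a c" "a \<noteq> 0"
  shows "parallel b c"
proof -
  obtain s t where "b = s *s a" "c = t *s a" using assms by (auto simp: parallel_iff_multiple)
  then show ?thesis by (simp add: parallel_def)
qed

lemma subspace_of_proj_point: "x \<noteq> 0 \<Longrightarrow> subspace_of (proj_point x) = vec.span {x}"
  unfolding proj_point_def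
  by (rule Abs_proj_inverse) (simp add: vec.dim_span vec.dim_eq_card_independent)

lemma proj_point_eq_iff:
  assumes "x \<noteq> 0" "y \<noteq> 0"
  shows "proj_point x = proj_point y \<longleftrightarrow> parallel x y"
proof
  assume "proj_point x = proj_point y"
  then have "vec.span {x} = vec.span {y}" using assms by (metis subspace_of_proj_point)
  then have "y \<in> vec.span {x}" by (simp add: vec.span_base)
  then show "parallel x y" using assms by (auto simp: vec.span_singleton parallel_iff_multiple)
next
  assume "parallel x y"
  then obtain c where c: "y = c *s x" using assms by (auto simp: parallel_iff_multiple)
  then have "c \<noteq> 0" using assms by auto
  have "vec.span {x} = vec.span {y}"
    unfolding vec.span_singleton
  proof safe
    fix k
    show "k *s x \<in> range (\<lambda>k. k *s y)"
      by (rule range_eqI[of _ _ "k / c"]) (use c \<open>c \<noteq> 0\<close> in simp)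
    show "k *s y \<in> range (\<lambda>k. k *s x)"
      by (rule range_eqI[of _ _ "k * c"]) (use c in simp)
  qed
  then show "proj_point x = proj_point y" by (simp add: proj_point_def)
qed

lemma proj_point_cases: "\<exists>x. x \<noteq> 0 \<and> proj_point x = p"
proof -
  have p: "vec.subspace (subspace_of p)" "vec.dim (subspace_of p) = 1"
    using subspace_of[of p] by auto
  obtain B where B: "B \<subseteq> subspace_of p" "vec.independent B" "subspace_of p \<subseteq> vec.span B"
      "card B = vec.dim (subspace_of p)"
    using vec.basis_exists by blast
  obtain x where x: "B = {x}" using B(4) p(2) by (metis card_1_singletonE)
  then have "x \<noteq> 0" using B(2) by simp
  moreover have "subspace_of p = vec.span {x}"
    using B(1,3) p(1) x by (intro antisym vec.span_minimal) auto
  ultimately have "subspace_of (proj_point x) = subspace_of p" by (simp add: subspace_of_proj_point)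
  then show ?thesis using \<open>x \<noteq> 0\<close> by (auto simp: subspace_of_inject)
qed

lemma config_lift: "\<exists>x. \<forall>i. x i \<noteq> 0 \<and> proj_point (x i) = v i"
  by (rule choice) (use proj_point_cases in blast)

text \<open>
  Infinitely many sites may be rescaled, but only finitely many of them influence \<open>f\<close>.
\<close>

lemma homogeneous_map_change_lift:
  assumes f: "homogeneous_map UNIV e f"
    and "\<And>i. x i \<noteq> 0 \<and> y i \<noteq> 0 \<and> proj_point (x i) = proj_point (y i)"
  shows "\<exists>c. c \<noteq> 0 \<and> f y = c *s f x"
proof -
  have "\<exists>c. y i = c *s x i" for i
    using assms(2)[of i] by (auto simp: proj_point_eq_iff parallel_iff_multiple)
  then obtain t where t: "\<And>i. y i = t i *s x i" by metis
  then have "t i \<noteq> 0" for i using assms(2)[of i] by auto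
  obtain M where M: "\<And>x y. (\<forall>i. \<bar>i\<bar> \<le> M \<longrightarrow> x i = y i) \<Longrightarrow> f x = f y"
    using homogeneous_map_finite_support[OF f] by blast
  have "f y = f (\<lambda>i. if i \<in> {-M..M} then t i *s x i else x i)" by (rule M) (auto simp: t)
  also have "\<dots> = (\<Prod>i\<in>{-M..M}. t i ^ e i) *s f x" by (rule homogeneous_map_rescale[OF f]) simp
  finally show ?thesis using \<open>\<And>i. t i \<noteq> 0\<close> by (intro exI[of _ "\<Prod>i\<in>{-M..M}. t i ^ e i"]) simp
qed

section \<open>Generic points\<close>

text \<open>
  Only finitely many sites influence the functions in \<open>\<F>\<close>; at the others any nonzero vector will do.
\<close>

lemma polyfun_generic_point:
  assumes "finite \<F>" "\<And>f. f \<in> \<F> \<Longrightarrow> polyfun f" "\<And>f. f \<in> \<F> \<Longrightarrow> \<exists>x. f x \<noteq> 0"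
  shows "\<exists>y :: int \<Rightarrow> complex ^ 'n::finite. (\<forall>i. y i \<noteq> 0) \<and> (\<forall>f\<in>\<F>. f y \<noteq> 0)"
proof -
  have "\<forall>f\<in>\<F>. \<exists>M. \<forall>x y. (\<forall>i. \<bar>i\<bar> \<le> M \<longrightarrow> x i = y i) \<longrightarrow> f x = f y"
    using polyfun_finite_support assms(2) by blast
  then obtain M where M: "\<And>f x y. f \<in> \<F> \<Longrightarrow> (\<forall>i. \<bar>i\<bar> \<le> M f \<longrightarrow> x i = y i) \<Longrightarrow> f x = f y"
    by metis
  define m where "m = Max (insert 0 (M ` \<F>))"
  have m: "M f \<le> m" if "f \<in> \<F>" for f using that assms(1) by (simp add: m_def)
  obtain j :: 'n where True by simp
  define \<G> where "\<G> = \<F> \<union> (\<lambda>i x. x i $ j) ` {-m..m}"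
  have "\<exists>x. \<forall>f\<in>\<G>. f x \<noteq> 0"
  proof (rule polyfun_common_nonzero_finite)
    show "polyfun f" if "f \<in> \<G>" for f using that assms(2) by (auto simp: \<G>_def intro: polyfun_coord)
    show "\<exists>x. f x \<noteq> 0" if "f \<in> \<G>" for f
      using that assms(3) by (auto simp: \<G>_def intro: exI[of _ "\<lambda>_. axis j 1"])
  qed (use assms(1) in \<open>simp add: \<G>_def\<close>)
  then obtain x where x: "\<And>f. f \<in> \<G> \<Longrightarrow> f x \<noteq> 0" by blast
  define y where "y i = (if \<bar>i\<bar> \<le> m then x i else axis j 1)" for i
  have "f y \<noteq> 0" if f: "f \<in> \<F>" for f
  proof -
    have "f y = f x" by (rule M[OF f]) (use m[OF f] in \<open>auto simp: y_def\<close>)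
    then show ?thesis using x[of f] f by (simp add: \<G>_def)
  qed
  then have "\<forall>f\<in>\<F>. f y \<noteq> 0" by blast
  moreover have "x i $ j \<noteq> 0" if "\<bar>i\<bar> \<le> m" for i
  proof -
    have "(\<lambda>x. x i $ j) \<in> (\<lambda>i x. x i $ j) ` {-m..m}" using that by (intro imageI) auto
    then show ?thesis using x unfolding \<G>_def by blast
  qed
  then have "y i \<noteq> 0" for i by (metis y_def axis_eq_0_iff zero_index zero_neq_one)
  ultimately show ?thesis by blast
qed

lemma parallel_if_generically:
  assumes P: "\<And>j. polyfun (\<lambda>x. P x $ j)" and Q: "\<And>j. polyfun (\<lambda>x. Q x $ j)"
    and \<F>: "finite \<F>" "\<And>f. f \<in> \<F> \<Longrightarrow> polyfun f" "\<And>f. f \<in> \<F> \<Longrightarrow> \<exists>x. f x \<noteq> 0"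
    and gen: "\<And>y. (\<And>i. y i \<noteq> 0) \<Longrightarrow> (\<And>f. f \<in> \<F> \<Longrightarrow> f y \<noteq> 0) \<Longrightarrow> parallel (P y) (Q y)"
  shows "parallel (P x) (Q x)"
proof (rule ccontr)
  assume "\<not> parallel (P x) (Q x)"
  then obtain j k where jk: "P x $ j * Q x $ k - P x $ k * Q x $ j \<noteq> 0" by (auto simp: parallel_def)
  let ?d = "\<lambda>x. P x $ j * Q x $ k - P x $ k * Q x $ j"
  have "polyfun ?d" using P Q by (intro polyfun_intros)
  have "\<exists>y. (\<forall>i. y i \<noteq> 0) \<and> (\<forall>f\<in>insert ?d \<F>. f y \<noteq> 0)"
  proof (rule polyfun_generic_point)
    show "\<And>f. f \<in> insert ?d \<F> \<Longrightarrow> polyfun f" using \<F>(2) \<open>polyfun ?d\<close> by blast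
    show "\<And>f. f \<in> insert ?d \<F> \<Longrightarrow> \<exists>x. f x \<noteq> 0" using \<F>(3) jk by blast
  qed (use \<F>(1) in simp)
  then obtain y where "\<forall>i. y i \<noteq> 0" "\<forall>f\<in>insert ?d \<F>. f y \<noteq> 0" by blast
  then show False using gen[of y] by (auto simp: parallel_def)
qed

lemma homogeneous_map_component: "homogeneous_map S d f \<Longrightarrow> \<exists>j x. f x $ j \<noteq> 0"
  unfolding homogeneous_map_def by (auto simp: vec_eq_iff)

lemma proportional_trans:
  assumes f: "homogeneous_map S d f" and g: "\<And>j. polyfun (\<lambda>x. g x $ j)" and h: "\<And>j. polyfun (\<lambda>x. h x $ j)"
    and "\<And>x. parallel (f x) (g x)" "\<And>x. parallel (f x) (h x)"
  shows "parallel (g x) (h x)"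
proof -
  obtain j x0 where j: "f x0 $ j \<noteq> 0" using homogeneous_map_component[OF f] by blast
  show ?thesis
  proof (rule parallel_if_generically[OF g h, of "{\<lambda>x. f x $ j}"])
    fix y assume "\<And>q. q \<in> {\<lambda>x. f x $ j} \<Longrightarrow> q y \<noteq> 0"
    then have "f y \<noteq> 0" by (metis singletonI zero_index)
    then show "parallel (g y) (h y)" using parallel_trans assms(4,5) by blast
  qed (use j homogeneous_polyfun[OF f] in auto)
qed

section \<open>Regular values of rational maps\<close>

text \<open>
  The values of the rational map represented by \<open>f\<close>, taken on configurations indexed by all of
  \<open>\<int>\<close>.  In this form they depend neither on the window nor on the representative.
\<close>

definition regular_at ::
    "((int \<Rightarrow> complex ^ 'n::finite) \<Rightarrow> complex ^ 'n) \<Rightarrow> (int \<Rightarrow> 'n proj) \<Rightarrow> 'n proj \<Rightarrow> bool" where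
  "regular_at f v w \<longleftrightarrow> (\<exists>g e x. homogeneous_map UNIV e g \<and> (\<forall>y. parallel (f y) (g y)) \<and>
     (\<forall>i. x i \<noteq> 0 \<and> proj_point (x i) = v i) \<and> g x \<noteq> 0 \<and> w = proj_point (g x))"

lemma regular_at_self:
  assumes "homogeneous_map S d f" "\<And>i. x i \<noteq> 0 \<and> proj_point (x i) = v i" "f x \<noteq> 0"
  shows "regular_at f v (proj_point (f x))"
  unfolding regular_at_def
  using homogeneous_map_UNIV[OF assms(1)] assms(2,3)
  by (intro exI[of _ f] exI[of _ "\<lambda>i. if i \<in> S then d i else 0"] exI[of _ x])
    (auto simp: parallel_def)

lemma proj_point_scale:
  assumes "c \<noteq> 0" "x \<noteq> 0"
  shows "proj_point (c *s x) = proj_point x"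
  by (subst proj_point_eq_iff) (use assms in \<open>auto simp: parallel_def\<close>)

lemma regular_at_lift:
  assumes "regular_at f v w" and x: "\<And>i. x i \<noteq> 0 \<and> proj_point (x i) = v i"
  obtains g e where "homogeneous_map UNIV e g" "\<And>y. parallel (f y) (g y)" "g x \<noteq> 0" "w = proj_point (g x)"
proof -
  obtain g e y where g: "homogeneous_map UNIV e g" "\<And>y. parallel (f y) (g y)"
    "\<And>i. y i \<noteq> 0 \<and> proj_point (y i) = v i" "g y \<noteq> 0" "w = proj_point (g y)"
    using assms(1) unfolding regular_at_def by blast
  obtain c where c: "c \<noteq> 0" "g x = c *s g y"
    using homogeneous_map_change_lift[OF g(1), of y x] x g(3) by auto
  show ?thesis
    by (rule that[OF g(1,2)]) (use c g(4,5) in \<open>auto simp: proj_point_scale\<close>)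
qed

lemma regular_at_unique:
  assumes f: "homogeneous_map S d f" and "regular_at f v w" "regular_at f v w'"
  shows "w = w'"
proof -
  obtain x where x: "\<And>i. x i \<noteq> 0 \<and> proj_point (x i) = v i" using config_lift by metis
  obtain g e where g: "homogeneous_map UNIV e g" "\<And>y. parallel (f y) (g y)" "g x \<noteq> 0" "w = proj_point (g x)"
    using regular_at_lift[OF assms(2) x] by blast
  obtain h e' where h: "homogeneous_map UNIV e' h" "\<And>y. parallel (f y) (h y)" "h x \<noteq> 0" "w' = proj_point (h x)"
    using regular_at_lift[OF assms(3) x] by blast
  have "parallel (g x) (h x)"
    by (rule proportional_trans[OF f homogeneous_polyfun[OF g(1)] homogeneous_polyfun[OF h(1)] g(2) h(2)])
  then show ?thesis using g h by (simp add: proj_point_eq_iff)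
qed

lemma regular_at_parallel:
  assumes f: "homogeneous_map S d f" and f': "homogeneous_map S' d' f'" and ff': "\<And>y. parallel (f y) (f' y)"
  shows "regular_at f v w \<longleftrightarrow> regular_at f' v w"
proof -
  have "(\<forall>y. parallel (f y) (g y)) \<longleftrightarrow> (\<forall>y. parallel (f' y) (g y))" if g: "homogeneous_map UNIV e g" for g e
    using proportional_trans[OF f homogeneous_polyfun[OF f'] homogeneous_polyfun[OF g] ff']
      proportional_trans[OF f' homogeneous_polyfun[OF f] homogeneous_polyfun[OF g] parallel_sym[OF ff']]
    by blast
  then show ?thesis unfolding regular_at_def by blast
qed

text \<open>
  A representative that uses sites outside \<open>S\<close> can be replaced by one on \<open>S\<close>: the superfluous points
  are frozen at coordinate vectors for which the representative does not vanish.
\<close>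

lemma regular_value_iff:
  assumes F: "homogeneous_tuple S d F"
  shows "regular_value S F (restrict v S) w \<longleftrightarrow> regular_at (tuple_eval F) v w"
proof
  assume "regular_value S F (restrict v S) w"
  then obtain G d' x where G: "homogeneous_tuple S d' G" "same_ratios F G"
    "\<And>i. i \<in> S \<Longrightarrow> x i \<noteq> 0 \<and> proj_point (x i) = v i" "tuple_eval G x \<noteq> 0" "w = proj_point (tuple_eval G x)"
    unfolding regular_value_def by auto
  obtain y where y: "\<And>i. y i \<noteq> 0 \<and> proj_point (y i) = v i" using config_lift by metis
  define z where "z i = (if i \<in> S then x i else y i)" for i
  have hom: "homogeneous_map S d' (tuple_eval G)" using G(1) by (simp add: homogeneous_tuple_iff)
  have "tuple_eval G z = tuple_eval G x" by (rule homogeneous_map_cong[OF hom]) (simp add: z_def)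
  then show "regular_at (tuple_eval F) v w"
    unfolding regular_at_def
    using homogeneous_map_UNIV[OF hom] G y
    by (intro exI[of _ "tuple_eval G"] exI[of _ "\<lambda>i. if i \<in> S then d' i else 0"] exI[of _ z])
      (auto simp: z_def same_ratios_iff)
next
  have hom: "homogeneous_map S d (tuple_eval F)" using F by (simp add: homogeneous_tuple_iff)
  assume "regular_at (tuple_eval F) v w"
  then obtain g e x where g: "homogeneous_map UNIV e g" "\<And>y. parallel (tuple_eval F y) (g y)"
    "\<And>i. x i \<noteq> 0 \<and> proj_point (x i) = v i" "g x \<noteq> 0" "w = proj_point (g x)"
    unfolding regular_at_def by blast
  (* freeze the sites outside the window *)
  define r where "r y = (\<lambda>i. if i \<in> S then y i else x i)" for y
  have r: "polyfun (\<lambda>y. r y i $ j)" for i j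
    by (cases "i \<in> S") (simp_all add: r_def polyfun_coord polyfun_const)
  have "r x = x" by (auto simp: r_def)
  have scale: "r (scale_site i c y) = (if i \<in> S then scale_site i c (r y) else r y)" for i c y
    by (auto simp: r_def scale_site_def fun_eq_iff)
  have hom': "homogeneous_map S e (\<lambda>y. g (r y))"
    unfolding homogeneous_map_def
  proof (intro conjI allI)
    show "polyfun (\<lambda>y. g (r y) $ j)" for j
      by (rule polyfun_compose[OF homogeneous_polyfun[OF g(1)] r])
    show "\<exists>y. g (r y) \<noteq> 0" using g(4) \<open>r x = x\<close> by metis
    show "g (r (scale_site i c y)) = (if i \<in> S then c ^ e i else 1) *s g (r y)" for i c y
      using g(1) by (simp add: scale homogeneous_map_def)
  qed
  then obtain G where G: "tuple_eval G = (\<lambda>y. g (r y))"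
    using tuple_eval_surj[of "\<lambda>y. g (r y)"] homogeneous_polyfun by blast
  have "parallel (tuple_eval F y) (g (r y))" for y
    using g(2)[of "r y"] homogeneous_map_cong[OF hom, of y "r y"] by (simp add: r_def)
  then show "regular_value S F (restrict v S) w"
    unfolding regular_value_def using hom' g \<open>r x = x\<close>
    by (intro conjI exI[of _ G] exI[of _ e] exI[of _ x])
      (auto simp: homogeneous_tuple_iff same_ratios_iff G)
qed

lemma partial_map_of_Some_iff:
  assumes "\<And>w w'. R v w \<Longrightarrow> R v w' \<Longrightarrow> w = w'"
  shows "partial_map_of R v = Some w \<longleftrightarrow> R v w"
proof
  assume "R v w"
  then have "\<exists>!w. R v w" "(THE w. R v w) = w" using assms by blast+
  then show "partial_map_of R v = Some w" by (simp add: partial_map_of_def)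
next
  assume "partial_map_of R v = Some w"
  then have "\<exists>!w. R v w" "w = (THE w. R v w)" by (auto simp: partial_map_of_def split: if_splits)
  then show "R v w" using theI'[of "R v"] by blast
qed

lemma rational_map_Some_iff:
  assumes F: "homogeneous_tuple S d F"
  shows "rational_map S F (restrict v S) = Some w \<longleftrightarrow> regular_at (tuple_eval F) v w"
proof -
  have hom: "homogeneous_map S d (tuple_eval F)" using F by (simp add: homogeneous_tuple_iff)
  show ?thesis
    unfolding rational_map_def regular_value_iff[OF F, symmetric]
    by (rule partial_map_of_Some_iff) (use regular_at_unique[OF hom] regular_value_iff[OF F] in blast)
qed

lemma rational_map_domain: "rational_map S F v = Some w \<Longrightarrow> v \<in> S \<rightarrow>\<^sub>E UNIV"
  unfolding rational_map_def partial_map_of_def regular_value_def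
  by (auto split: if_splits)

section \<open>Lattice maps and their local rules\<close>

definition shift :: "int \<Rightarrow> (int \<Rightarrow> 'a) \<Rightarrow> int \<Rightarrow> 'a" where
  "shift s x = (\<lambda>i. x (s + i))"

definition lattice_of :: "((int \<Rightarrow> complex ^ 'n::finite) \<Rightarrow> complex ^ 'n) \<Rightarrow> 'n lattice_map" where
  "lattice_of f v = (if \<forall>i. \<exists>w. regular_at f (shift i v) w
     then Some (\<lambda>i. THE w. regular_at f (shift i v) w) else None)"

lemma window_eq: "window S i v = restrict (shift i v) S"
  by (simp add: window_def shift_def)

lemma lattice_map_of_rational_map:
  assumes F: "homogeneous_tuple S d F"
  shows "lattice_map_of S (rational_map S F) = lattice_of (tuple_eval F)"
proof
  fix v
  have dom: "window S i v \<in> dom (rational_map S F) \<longleftrightarrow> (\<exists>w. regular_at (tuple_eval F) (shift i v) w)" for i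
    by (simp add: window_eq dom_def rational_map_Some_iff[OF F])
  have "the (rational_map S F (window S i v)) = (THE w. regular_at (tuple_eval F) (shift i v) w)"
    if ex: "\<exists>w. regular_at (tuple_eval F) (shift i v) w" for i
  proof -
    obtain w where w: "regular_at (tuple_eval F) (shift i v) w" using ex by blast
    have "(THE w. regular_at (tuple_eval F) (shift i v) w) = w"
      by (rule the_equality[of "regular_at (tuple_eval F) (shift i v)", OF w])
        (use regular_at_unique[of S d "tuple_eval F"] F w in \<open>auto simp: homogeneous_tuple_iff\<close>)
    moreover have "rational_map S F (window S i v) = Some w"
      using w by (simp add: window_eq rational_map_Some_iff[OF F])
    ultimately show ?thesis by simp
  qed
  then show "lattice_map_of S (rational_map S F) v = lattice_of (tuple_eval F) v"
    unfolding lattice_map_of_def lattice_of_def dom by (auto simp: fun_eq_iff)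
qed

lemma lattice_of_Some_iff:
  assumes f: "homogeneous_map S d f"
  shows "lattice_of f v = Some u \<longleftrightarrow> (\<forall>i. regular_at f (shift i v) (u i))"
proof
  assume "lattice_of f v = Some u"
  then have ex: "\<forall>i. \<exists>w. regular_at f (shift i v) w" and u: "u = (\<lambda>i. THE w. regular_at f (shift i v) w)"
    by (auto simp: lattice_of_def split: if_splits)
  show "\<forall>i. regular_at f (shift i v) (u i)"
  proof
    fix i
    have "\<exists>!w. regular_at f (shift i v) w" using ex regular_at_unique[OF f] by blast
    then show "regular_at f (shift i v) (u i)" unfolding u by (rule theI')
  qed
next
  assume u: "\<forall>i. regular_at f (shift i v) (u i)"
  then have "(THE w. regular_at f (shift i v) w) = u i" for i
    using regular_at_unique[OF f] by (intro the_equality) blast+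
  then show "lattice_of f v = Some u" using u by (auto simp: lattice_of_def fun_eq_iff)
qed

lemma lattice_of_parallel:
  assumes "homogeneous_map S d f" "homogeneous_map S' d' g" "\<And>y. parallel (f y) (g y)"
  shows "lattice_of f = lattice_of g"
  unfolding lattice_of_def regular_at_parallel[OF assms] ..

lemma polyfun_shift:
  assumes "\<And>j. polyfun (\<lambda>x. f x $ j)"
  shows "polyfun (\<lambda>x. f (shift s x) $ j)"
  by (rule polyfun_compose[OF assms]) (simp add: shift_def polyfun_coord)

lemma nonzero_shift: "f x $ j \<noteq> 0 \<Longrightarrow> \<exists>x. f (shift s x) $ j \<noteq> 0"
  by (rule exI[of _ "shift (- s) x"]) (simp add: shift_def)

text \<open>
  A lattice map determines its local rule.  To compare two local rules at a generic point one needs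
  a configuration on which both lattice maps are defined, that is, infinitely many windows must
  avoid the indeterminacy loci.  For periodic configurations these are finitely many conditions.
\<close>

lemma lattice_of_eq_imp_parallel:
  fixes f g :: "(int \<Rightarrow> complex ^ 'n::finite) \<Rightarrow> complex ^ 'n"
  assumes f: "homogeneous_map S d f" and g: "homogeneous_map S' d' g" and eq: "lattice_of f = lattice_of g"
  shows "parallel (f x) (g x)"
proof (rule ccontr)
  assume np: "\<not> parallel (f x) (g x)"
  obtain j xf where jf: "f xf $ j \<noteq> 0" using homogeneous_map_component[OF f] by blast
  obtain k xg where kg: "g xg $ k \<noteq> 0" using homogeneous_map_component[OF g] by blast
  obtain a b where ab: "f x $ a * g x $ b - f x $ b * g x $ a \<noteq> 0" using np by (auto simp: parallel_def)
  obtain Mf where Mf: "\<And>x y. (\<forall>i. \<bar>i\<bar> \<le> Mf \<longrightarrow> x i = y i) \<Longrightarrow> f x = f y"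
    using homogeneous_map_finite_support[OF f] by blast
  obtain Mg where Mg: "\<And>x y. (\<forall>i. \<bar>i\<bar> \<le> Mg \<longrightarrow> x i = y i) \<Longrightarrow> g x = g y"
    using homogeneous_map_finite_support[OF g] by blast
  define M where "M = max 0 (max Mf Mg)"
  define N where "N = 2 * M + 1"
  have N: "0 < N" by (simp add: N_def M_def)
  define rep where "rep i = (i + M) mod N - M" for i
  define per where "per y = (\<lambda>i. y (rep i))" for y :: "int \<Rightarrow> complex ^ 'n"
  have rep_id: "rep i = i" if "\<bar>i\<bar> \<le> M" for i
    using that by (simp add: rep_def N_def)
  have rep_rep: "rep (rep (s + i) - s) = rep i" for s i
  proof -
    have "(rep (s + i) - s + M) mod N = ((s + i + M) mod N - s) mod N" by (simp add: rep_def)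
    also have "\<dots> = (i + M) mod N" by (simp add: mod_diff_left_eq algebra_simps)
    finally show ?thesis by (simp add: rep_def)
  qed
  have poly: "polyfun (\<lambda>y. h (shift s (per y)) $ l)" if "\<And>l. polyfun (\<lambda>y. h y $ l)"
    for h :: "(int \<Rightarrow> complex ^ 'n) \<Rightarrow> complex ^ 'n" and s l
    by (rule polyfun_compose[OF that]) (simp add: shift_def per_def polyfun_coord)
  (* any pattern on the window can be realized at the site s by a periodic configuration *)
  have realize: "\<exists>y. \<forall>i. \<bar>i\<bar> \<le> M \<longrightarrow> shift s (per y) i = z i" for s and z :: "int \<Rightarrow> complex ^ 'n"
    by (rule exI[of _ "\<lambda>n. z (rep (n - s))"])
      (auto simp: shift_def per_def rep_rep rep_id)
  have nzf: "\<exists>y. f (shift s (per y)) $ j \<noteq> 0" for s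
  proof -
    obtain y where "\<forall>i. \<bar>i\<bar> \<le> M \<longrightarrow> shift s (per y) i = xf i" using realize by blast
    then have "f (shift s (per y)) = f xf" by (intro Mf) (simp add: M_def)
    then show ?thesis using jf by metis
  qed
  have nzg: "\<exists>y. g (shift s (per y)) $ k \<noteq> 0" for s
  proof -
    obtain y where "\<forall>i. \<bar>i\<bar> \<le> M \<longrightarrow> shift s (per y) i = xg i" using realize by blast
    then have "g (shift s (per y)) = g xg" by (intro Mg) (simp add: M_def)
    then show ?thesis using kg by metis
  qed
  let ?D = "\<lambda>y. f (shift 0 (per y)) $ a * g (shift 0 (per y)) $ b - f (shift 0 (per y)) $ b * g (shift 0 (per y)) $ a"
  have nzD: "\<exists>y. ?D y \<noteq> 0"
  proof -
    obtain y where y: "\<forall>i. \<bar>i\<bar> \<le> M \<longrightarrow> shift 0 (per y) i = x i" using realize by blast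
    then have "f (shift 0 (per y)) = f x" by (intro Mf) (simp add: M_def)
    moreover have "g (shift 0 (per y)) = g x" using y by (intro Mg) (simp add: M_def)
    ultimately show ?thesis using ab by metis
  qed
  define \<F> where "\<F> = {?D} \<union> (\<lambda>s y. f (shift s (per y)) $ j) ` {0..<N} \<union> (\<lambda>s y. g (shift s (per y)) $ k) ` {0..<N}"
  have "\<exists>y. (\<forall>i. y i \<noteq> 0) \<and> (\<forall>f\<in>\<F>. f y \<noteq> 0)"
  proof (rule polyfun_generic_point)
    show "finite \<F>" by (simp add: \<F>_def)
    show "polyfun q" if "q \<in> \<F>" for q
      using that homogeneous_polyfun[OF f] homogeneous_polyfun[OF g]
      by (auto simp: \<F>_def intro!: poly polyfun_diff polyfun_mult)
    show "\<exists>y. q y \<noteq> 0" if "q \<in> \<F>" for q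
      using that nzf nzg nzD unfolding \<F>_def by blast
  qed
  then obtain y where y: "\<And>i. y i \<noteq> 0" "\<And>q. q \<in> \<F> \<Longrightarrow> q y \<noteq> 0" by blast
  define z where "z = per y"
  define v where "v = (\<lambda>i. proj_point (z i))"
  have mod: "shift i z = shift (i mod N) z" for i
    by (simp add: shift_def z_def per_def rep_def mod_simps add.assoc)
  have nz: "f (shift i z) \<noteq> 0" "g (shift i z) \<noteq> 0" for i
  proof -
    have "i mod N \<in> {0..<N}" using N by simp
    then have "f (shift (i mod N) z) $ j \<noteq> 0" "g (shift (i mod N) z) $ k \<noteq> 0"
      using y(2)[of "\<lambda>y. f (shift (i mod N) (per y)) $ j"] y(2)[of "\<lambda>y. g (shift (i mod N) (per y)) $ k"]
      unfolding \<F>_def z_def by blast+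
    then show "f (shift i z) \<noteq> 0" "g (shift i z) \<noteq> 0" unfolding mod[of i] by auto
  qed
  have lift: "shift i z l \<noteq> 0 \<and> proj_point (shift i z l) = shift i v l" for i l
    using y(1) by (simp add: v_def shift_def z_def per_def)
  have "lattice_of f v = Some (\<lambda>i. proj_point (f (shift i z)))"
    unfolding lattice_of_Some_iff[OF f] by (intro allI regular_at_self[OF f] lift nz)
  moreover have "lattice_of g v = Some (\<lambda>i. proj_point (g (shift i z)))"
    unfolding lattice_of_Some_iff[OF g] by (intro allI regular_at_self[OF g] lift nz)
  ultimately have "proj_point (f (shift 0 z)) = proj_point (g (shift 0 z))" using eq by (metis option.inject)
  then have "parallel (f (shift 0 z)) (g (shift 0 z))"
    using nz by (simp add: proj_point_eq_iff)
  then show False using y(2)[of ?D] by (simp add: \<F>_def z_def parallel_def)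
qed

section \<open>Composition\<close>

definition compose_rules ::
    "((int \<Rightarrow> complex ^ 'n::finite) \<Rightarrow> complex ^ 'n) \<Rightarrow> ((int \<Rightarrow> complex ^ 'n) \<Rightarrow> complex ^ 'n) \<Rightarrow>
     (int \<Rightarrow> complex ^ 'n) \<Rightarrow> complex ^ 'n" where
  "compose_rules h f x = h (\<lambda>s. f (shift s x))"

lemma regional_map_value:
  assumes F: "homogeneous_tuple S d F"
  shows "regional_map S' S (rational_map S F) (restrict v (S + S')) = Some r \<longleftrightarrow>
    r \<in> S' \<rightarrow>\<^sub>E UNIV \<and> (\<forall>s\<in>S'. regular_at (tuple_eval F) (shift s v) (r s))"
proof -
  have win: "window S s (restrict v (S + S')) = restrict (shift s v) S" if "s \<in> S'" for s
  proof
    fix t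
    show "window S s (restrict v (S + S')) t = restrict (shift s v) S t"
      using that set_plus_intro[of t S s S'] by (simp add: window_def shift_def restrict_def add.commute)
  qed
  have val: "rational_map S F (window S s (restrict v (S + S'))) = Some w \<longleftrightarrow>
      regular_at (tuple_eval F) (shift s v) w" if "s \<in> S'" for s w
    unfolding win[OF that] by (rule rational_map_Some_iff[OF F])
  show ?thesis
  proof
    assume "regional_map S' S (rational_map S F) (restrict v (S + S')) = Some r"
    then have dom: "\<forall>s\<in>S'. window S s (restrict v (S + S')) \<in> dom (rational_map S F)"
      and r: "r = (\<lambda>i\<in>S'. the (rational_map S F (window S i (restrict v (S + S')))))"
      by (auto simp: regional_map_def split: if_splits)
    have "regular_at (tuple_eval F) (shift s v) (r s)" if s: "s \<in> S'" for s
    proof -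
      obtain w where "rational_map S F (window S s (restrict v (S + S'))) = Some w" using dom s by blast
      then show ?thesis using val[OF s, of w] s by (simp add: r)
    qed
    then show "r \<in> S' \<rightarrow>\<^sub>E UNIV \<and> (\<forall>s\<in>S'. regular_at (tuple_eval F) (shift s v) (r s))"
      using r by auto
  next
    assume r: "r \<in> S' \<rightarrow>\<^sub>E UNIV \<and> (\<forall>s\<in>S'. regular_at (tuple_eval F) (shift s v) (r s))"
    then have v: "rational_map S F (window S s (restrict v (S + S'))) = Some (r s)" if "s \<in> S'" for s
      using val that by blast
    have "(\<lambda>i\<in>S'. the (rational_map S F (window S i (restrict v (S + S'))))) = r"
    proof
      fix s
      show "(\<lambda>i\<in>S'. the (rational_map S F (window S i (restrict v (S + S'))))) s = r s"
        using v r by (cases "s \<in> S'") (auto simp: PiE_def extensional_def)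
    qed
    moreover have "restrict v (S + S') \<in> S' + S \<rightarrow>\<^sub>E UNIV" by (simp add: add.commute)
    ultimately show "regional_map S' S (rational_map S F) (restrict v (S + S')) = Some r"
      using v by (auto simp: regional_map_def)
  qed
qed

lemma composite_value:
  assumes F: "homogeneous_tuple S d F" and G: "homogeneous_tuple S' d' G"
  shows "(rational_map S' G \<circ>\<^sub>m regional_map S' S (rational_map S F)) (restrict v (S + S')) = Some w \<longleftrightarrow>
    (\<exists>r. (\<forall>s\<in>S'. regular_at (tuple_eval F) (shift s v) (r s)) \<and> regular_at (tuple_eval G) r w)"
    (is "?L \<longleftrightarrow> ?R")
proof
  assume ?L
  then obtain r where r: "regional_map S' S (rational_map S F) (restrict v (S + S')) = Some r"
      "rational_map S' G r = Some w"
    by (auto simp: map_comp_def split: option.splits)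
  then have "r \<in> S' \<rightarrow>\<^sub>E UNIV" "\<forall>s\<in>S'. regular_at (tuple_eval F) (shift s v) (r s)"
    unfolding regional_map_value[OF F] by blast+
  moreover from this have "restrict r S' = r" by (simp add: PiE_restrict)
  ultimately show ?R using r(2) rational_map_Some_iff[OF G, of r w] by auto
next
  assume ?R
  then obtain r where r: "\<forall>s\<in>S'. regular_at (tuple_eval F) (shift s v) (r s)" "regular_at (tuple_eval G) r w"
    by blast
  then have "regional_map S' S (rational_map S F) (restrict v (S + S')) = Some (restrict r S')"
    unfolding regional_map_value[OF F] by simp
  then show ?L using r(2) rational_map_Some_iff[OF G, of r w] by (simp add: map_comp_def)
qed

text \<open>
  The configuration must be chosen generic at all sites that influence \<open>h\<close>, not only in the window
  \<open>S'\<close>, because \<open>h\<close> may be homogeneous with respect to a different window.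
\<close>

lemma composite_generic:
  assumes F: "homogeneous_tuple S d F" and G: "homogeneous_tuple S' d' G" and "finite S'"
    and f: "homogeneous_map Sf df f" "\<And>y. parallel (tuple_eval F y) (f y)"
    and h: "homogeneous_map Sh dh h" "\<And>y. parallel (tuple_eval G y) (h y)"
    and c: "homogeneous_map Sc dc (compose_rules h f)"
    and P: "polyfun P" "P a \<noteq> 0"
  shows "\<exists>y. (\<forall>i. y i \<noteq> 0) \<and> P y \<noteq> 0 \<and> compose_rules h f y \<noteq> 0 \<and>
    (rational_map S' G \<circ>\<^sub>m regional_map S' S (rational_map S F)) (restrict (\<lambda>i. proj_point (y i)) (S + S'))
      = Some (proj_point (compose_rules h f y))"
proof -
  have F': "homogeneous_map S d (tuple_eval F)" and G': "homogeneous_map S' d' (tuple_eval G)"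
    using F G by (simp_all add: homogeneous_tuple_iff)
  obtain j xf where jf: "f xf $ j \<noteq> 0" using homogeneous_map_component[OF f(1)] by blast
  obtain k xF where kF: "tuple_eval F xF $ k \<noteq> 0" using homogeneous_map_component[OF F'] by blast
  obtain l xc where lc: "compose_rules h f xc $ l \<noteq> 0" using homogeneous_map_component[OF c] by blast
  obtain M where M: "\<And>x y. (\<forall>i. \<bar>i\<bar> \<le> M \<longrightarrow> x i = y i) \<Longrightarrow> h x = h y"
    using homogeneous_map_finite_support[OF h(1)] by blast
  define A where "A = {-M..M} \<union> S'"
  define \<F> where "\<F> = {P, \<lambda>y. compose_rules h f y $ l} \<union> (\<lambda>s y. f (shift s y) $ j) ` A \<union>
    (\<lambda>s y. tuple_eval F (shift s y) $ k) ` A"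
  have "\<exists>y. (\<forall>i. y i \<noteq> 0) \<and> (\<forall>f\<in>\<F>. f y \<noteq> 0)"
  proof (rule polyfun_generic_point)
    show "finite \<F>" using \<open>finite S'\<close> by (simp add: \<F>_def A_def)
    show "polyfun q" if "q \<in> \<F>" for q
      using that P(1) homogeneous_polyfun[OF c] polyfun_shift[OF homogeneous_polyfun[OF F']]
        polyfun_shift[OF homogeneous_polyfun[OF f(1)]]
      by (auto simp: \<F>_def)
    show "\<exists>y. q y \<noteq> 0" if "q \<in> \<F>" for q
      using that P(2) lc nonzero_shift[of f, OF jf] nonzero_shift[of "tuple_eval F", OF kF]
      unfolding \<F>_def by blast
  qed
  then obtain y where y: "\<And>i. y i \<noteq> 0" "\<And>q. q \<in> \<F> \<Longrightarrow> q y \<noteq> 0" by blast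
  have nz: "f (shift s y) \<noteq> 0" "tuple_eval F (shift s y) \<noteq> 0" if "s \<in> A" for s
  proof -
    have "f (shift s y) $ j \<noteq> 0" "tuple_eval F (shift s y) $ k \<noteq> 0"
      using y(2)[of "\<lambda>y. f (shift s y) $ j"] y(2)[of "\<lambda>y. tuple_eval F (shift s y) $ k"] that
      unfolding \<F>_def by blast+
    then show "f (shift s y) \<noteq> 0" "tuple_eval F (shift s y) \<noteq> 0" by auto
  qed
  have cy: "compose_rules h f y \<noteq> 0"
    using y(2)[of "\<lambda>y. compose_rules h f y $ l"] by (auto simp: \<F>_def)
  define z where "z s = (if s \<in> A then tuple_eval F (shift s y) else y 0)" for s
  define zf where "zf s = (if s \<in> A then f (shift s y) else y 0)" for s
  have z: "z s \<noteq> 0" "zf s \<noteq> 0" "proj_point (zf s) = proj_point (z s)" for s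
  proof -
    show "z s \<noteq> 0" "zf s \<noteq> 0" using nz y(1) by (auto simp: z_def zf_def)
    have "parallel (zf s) (z s)"
      using parallel_sym[OF f(2)] by (auto simp: z_def zf_def) (auto simp: parallel_def)
    then show "proj_point (zf s) = proj_point (z s)" using \<open>z s \<noteq> 0\<close> \<open>zf s \<noteq> 0\<close> by (simp add: proj_point_eq_iff)
  qed
  obtain t where t: "t \<noteq> 0" "h z = t *s h zf"
    using homogeneous_map_change_lift[OF homogeneous_map_UNIV[OF h(1)], of zf z] z by auto
  have "h zf = compose_rules h f y"
    unfolding compose_rules_def by (rule M) (auto simp: zf_def A_def)
  then have hz: "h z \<noteq> 0" "proj_point (h z) = proj_point (compose_rules h f y)"
    using t cy by (auto simp: proj_point_scale)
  have "regular_at h (\<lambda>s. proj_point (z s)) (proj_point (h z))"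
    by (rule regular_at_self[OF h(1)]) (use z hz in auto)
  then have "regular_at (tuple_eval G) (\<lambda>s. proj_point (z s)) (proj_point (compose_rules h f y))"
    using regular_at_parallel[OF G' h(1) h(2)] hz(2) by simp
  moreover have "regular_at (tuple_eval F) (shift s (\<lambda>i. proj_point (y i))) (proj_point (z s))" if "s \<in> S'" for s
  proof -
    have "s \<in> A" using that by (simp add: A_def)
    then have "regular_at (tuple_eval F) (shift s (\<lambda>i. proj_point (y i))) (proj_point (tuple_eval F (shift s y)))"
      by (intro regular_at_self[OF F'] nz) (auto simp: y(1) shift_def)
    then show ?thesis using \<open>s \<in> A\<close> by (simp add: z_def)
  qed
  ultimately have "(rational_map S' G \<circ>\<^sub>m regional_map S' S (rational_map S F))
      (restrict (\<lambda>i. proj_point (y i)) (S + S')) = Some (proj_point (compose_rules h f y))"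
    unfolding composite_value[OF F G] by (intro exI[of _ "\<lambda>s. proj_point (z s)"]) simp
  moreover have "P y \<noteq> 0" using y(2)[of P] by (simp add: \<F>_def)
  ultimately show ?thesis using y(1) cy by blast
qed

lemma shift_scale_site: "shift s (scale_site i c x) = scale_site (i - s) c (shift s x)"
  by (auto simp: shift_def scale_site_def fun_eq_iff)

text \<open>
  At a point where the maps can be composed pointwise, representatives that are regular there
  compose to a representative of the composite that is regular there.
\<close>

lemma composite_extends:
  assumes F: "homogeneous_tuple S d F" and G: "homogeneous_tuple S' d' G" and "finite S'"
    and K: "homogeneous_tuple (S + S') dK K" "tuple_eval K = compose_rules (tuple_eval G) (tuple_eval F)"
  shows "(rational_map S' G \<circ>\<^sub>m regional_map S' S (rational_map S F)) \<subseteq>\<^sub>m rational_map (S + S') K"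
  unfolding map_le_def
proof
  let ?C = "rational_map S' G \<circ>\<^sub>m regional_map S' S (rational_map S F)"
  let ?f = "tuple_eval F" and ?g = "tuple_eval G"
  have f: "homogeneous_map S d ?f" and g: "homogeneous_map S' d' ?g"
    and k: "homogeneous_map (S + S') dK (compose_rules ?g ?f)"
    using F G K by (simp_all add: homogeneous_tuple_iff)
  fix v assume "v \<in> dom ?C"
  then obtain w where w: "?C v = Some w" by blast
  then have "v \<in> S' + S \<rightarrow>\<^sub>E UNIV"
    by (auto simp: map_comp_def regional_map_def split: option.splits if_splits)
  then have v: "restrict v (S + S') = v" by (simp add: PiE_restrict add.commute)
  obtain r where r: "\<And>s. s \<in> S' \<Longrightarrow> regular_at ?f (shift s v) (r s)" "regular_at ?g r w"
    using w composite_value[OF F G, of v w] v by auto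
  obtain x where x: "\<And>i. x i \<noteq> 0 \<and> proj_point (x i) = v i" using config_lift by metis
  obtain y0 where y0: "\<And>s. y0 s \<noteq> 0 \<and> proj_point (y0 s) = r s" using config_lift by metis
  have "\<exists>p e. homogeneous_map UNIV e p \<and> (\<forall>y. parallel (?f y) (p y)) \<and> p (shift s x) \<noteq> 0 \<and>
      r s = proj_point (p (shift s x))" if "s \<in> S'" for s
    by (rule regular_at_lift[OF r(1)[OF that], of "shift s x"]) (use x in \<open>auto simp: shift_def\<close>)
  then obtain p e where p: "\<And>s. s \<in> S' \<Longrightarrow> homogeneous_map UNIV (e s) (p s)"
    "\<And>s y. s \<in> S' \<Longrightarrow> parallel (?f y) (p s y)" "\<And>s. s \<in> S' \<Longrightarrow> p s (shift s x) \<noteq> 0"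
    "\<And>s. s \<in> S' \<Longrightarrow> r s = proj_point (p s (shift s x))" by metis
  define z where "z y s = (if s \<in> S' then p s (shift s y) else y0 s)" for y s
  have zx: "z x s \<noteq> 0 \<and> proj_point (z x s) = r s" for s using p y0 by (simp add: z_def)
  obtain q e' where q: "homogeneous_map UNIV e' q" "\<And>y. parallel (?g y) (q y)" "q (z x) \<noteq> 0"
      "w = proj_point (q (z x))"
    using regular_at_lift[OF r(2) zx] by blast
  have polyz: "polyfun (\<lambda>y. z y s $ j)" for s j
    using polyfun_shift[OF homogeneous_polyfun[OF p(1)]]
    by (cases "s \<in> S'") (auto simp: z_def polyfun_const)
  have polyq: "polyfun (\<lambda>y. q (z y) $ j)" for j
    by (rule polyfun_compose[OF homogeneous_polyfun[OF q(1)] polyz])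
  have hom: "homogeneous_map UNIV (\<lambda>i. \<Sum>s\<in>S'. e s (i - s) * e' s) (\<lambda>y. q (z y))"
    unfolding homogeneous_map_def
  proof (intro conjI allI polyq)
    show "\<exists>y. q (z y) \<noteq> 0" using q(3) by blast
    fix i c y
    have "z (scale_site i c y) = (\<lambda>s. if s \<in> S' then (c ^ e s (i - s)) *s z y s else z y s)"
      using p(1) by (auto simp: z_def shift_scale_site homogeneous_map_def fun_eq_iff)
    then have "q (z (scale_site i c y)) = (\<Prod>s\<in>S'. (c ^ e s (i - s)) ^ e' s) *s q (z y)"
      using homogeneous_map_rescale[OF q(1) \<open>finite S'\<close>] by simp
    then show "q (z (scale_site i c y)) = (if i \<in> UNIV then c ^ (\<Sum>s\<in>S'. e s (i - s) * e' s) else 1) *s q (z y)"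
      by (simp add: power_mult[symmetric] power_sum)
  qed
  obtain l xc where lc: "compose_rules ?g ?f xc $ l \<noteq> 0" using homogeneous_map_component[OF k] by blast
  obtain j xf where jf: "?f xf $ j \<noteq> 0" using homogeneous_map_component[OF f] by blast
  have "\<forall>s\<in>S'. \<exists>m u. p s u $ m \<noteq> 0" using homogeneous_map_component p(1) by blast
  then obtain m u where mu: "\<And>s. s \<in> S' \<Longrightarrow> p s (u s) $ m s \<noteq> 0" by metis
  have mu': "\<exists>y. p s (shift s y) $ m s \<noteq> 0" if "s \<in> S'" for s
    by (rule nonzero_shift[where f = "p s"]) (rule mu[OF that])
  define \<F> where "\<F> = {\<lambda>y. compose_rules ?g ?f y $ l} \<union> (\<lambda>s y. ?f (shift s y) $ j) ` S' \<union>
    (\<lambda>s y. p s (shift s y) $ m s) ` S'"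
  have par: "parallel (compose_rules ?g ?f y) (q (z y))" for y
  proof (rule parallel_if_generically[OF homogeneous_polyfun[OF k] polyq, of \<F>])
    show "finite \<F>" using \<open>finite S'\<close> by (simp add: \<F>_def)
    show "polyfun a" if "a \<in> \<F>" for a
      using that homogeneous_polyfun[OF k] polyfun_shift[OF homogeneous_polyfun[OF f]]
        polyfun_shift[OF homogeneous_polyfun[OF p(1)]]
      by (auto simp: \<F>_def)
    show "\<exists>y. a y \<noteq> 0" if "a \<in> \<F>" for a
      using that lc nonzero_shift[of ?f, OF jf] mu' unfolding \<F>_def by blast
    fix y assume gen: "\<And>a. a \<in> \<F> \<Longrightarrow> a y \<noteq> 0"
    have nz: "?f (shift s y) \<noteq> 0" "p s (shift s y) \<noteq> 0" if "s \<in> S'" for s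
    proof -
      have "?f (shift s y) $ j \<noteq> 0" "p s (shift s y) $ m s \<noteq> 0"
        using gen[of "\<lambda>y. ?f (shift s y) $ j"] gen[of "\<lambda>y. p s (shift s y) $ m s"] that
        unfolding \<F>_def by blast+
      then show "?f (shift s y) \<noteq> 0" "p s (shift s y) \<noteq> 0" by auto
    qed
    have cy: "compose_rules ?g ?f y \<noteq> 0"
      using gen[of "\<lambda>y. compose_rules ?g ?f y $ l"] by (auto simp: \<F>_def)
    define zf where "zf s = (if s \<in> S' then ?f (shift s y) else y0 s)" for s
    have "zf s \<noteq> 0 \<and> z y s \<noteq> 0 \<and> proj_point (zf s) = proj_point (z y s)" for s
      using nz p(2) y0 by (cases "s \<in> S'") (auto simp: zf_def z_def proj_point_eq_iff)
    then obtain t where t: "t \<noteq> 0" "?g (z y) = t *s ?g zf"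
      using homogeneous_map_change_lift[OF homogeneous_map_UNIV[OF g], of zf "z y"] by blast
    have "?g zf = compose_rules ?g ?f y"
      unfolding compose_rules_def by (rule homogeneous_map_cong[OF g]) (simp add: zf_def)
    then have e: "?g (z y) = t *s compose_rules ?g ?f y" using t by simp
    show "parallel (compose_rules ?g ?f y) (q (z y))"
    proof (rule parallel_trans[of "?g (z y)"])
      show "parallel (?g (z y)) (compose_rules ?g ?f y)" by (simp add: e parallel_def)
      show "?g (z y) \<noteq> 0" using e t(1) cy by simp
    qed (rule q(2))
  qed
  have "regular_at (compose_rules ?g ?f) v w"
    unfolding regular_at_def using hom par x q(3,4) by blast
  then have "rational_map (S + S') K v = Some w"
    using rational_map_Some_iff[OF K(1), of v w] v K(2) by simp
  then show "?C v = rational_map (S + S') K v" using w by simp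
qed

lemma is_composite_lattice_of:
  assumes F: "homogeneous_tuple S d F" "finite S" "S \<noteq> {}" and G: "homogeneous_tuple S' d' G" "finite S'" "S' \<noteq> {}"
    and K: "homogeneous_tuple (S + S') dK K" "tuple_eval K = compose_rules (tuple_eval G) (tuple_eval F)"
  shows "is_composite (lattice_of (tuple_eval G)) (lattice_of (tuple_eval F)) (lattice_of (tuple_eval K))"
proof -
  have "local_rule S (rational_map S F)" "local_rule S' (rational_map S' G)" "local_rule (S + S') (rational_map (S + S') K)"
    using F G K(1) by (auto simp: local_rule_def finite_set_plus)
  moreover have "\<not> ran (regional_map S' S (rational_map S F)) \<subseteq> Ind S' (rational_map S' G)"
  proof -
    have "homogeneous_map (S + S') dK (compose_rules (tuple_eval G) (tuple_eval F))"
      using K by (simp add: homogeneous_tuple_iff)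
    then obtain v w where "(rational_map S' G \<circ>\<^sub>m regional_map S' S (rational_map S F)) v = Some w"
      using composite_generic[OF F(1) G(1) \<open>finite S'\<close>, of S d "tuple_eval F" S' d' "tuple_eval G" "S + S'" dK "\<lambda>_. 1"] F(1) G(1)
      by (auto simp: homogeneous_tuple_iff parallel_def intro: polyfun_const)
    then obtain r where "regional_map S' S (rational_map S F) v = Some r" "rational_map S' G r = Some w"
      by (auto simp: map_comp_def split: option.splits)
    then show ?thesis by (auto simp: Ind_def ran_def)
  qed
  ultimately show ?thesis
    unfolding is_composite_def
    using composite_extends[OF F(1) G(1,2) K] lattice_map_of_rational_map[OF F(1)]
      lattice_map_of_rational_map[OF G(1)] lattice_map_of_rational_map[OF K(1)]
    by metis
qed

text \<open>
  All local rules of the two factors are proportional to \<open>f\<close> and \<open>h\<close>, and the value of any extension of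
  the pointwise composite at generic points is the one given by \<open>compose_rules h f\<close>.
\<close>

lemma is_composite_unique:
  assumes f: "homogeneous_map Sf df f" and h: "homogeneous_map Sh dh h"
    and c: "homogeneous_map Sc dc (compose_rules h f)"
    and comp: "is_composite (lattice_of h) (lattice_of f) U"
  shows "U = lattice_of (compose_rules h f)"
proof -
  obtain S \<phi> S' \<phi>' \<psi> where *: "local_rule S \<phi>" "lattice_of f = lattice_map_of S \<phi>"
      "local_rule S' \<phi>'" "lattice_of h = lattice_map_of S' \<phi>'" "local_rule (S + S') \<psi>"
      "(\<phi>' \<circ>\<^sub>m regional_map S' S \<phi>) \<subseteq>\<^sub>m \<psi>" "U = lattice_map_of (S + S') \<psi>"
    using comp unfolding is_composite_def by blast
  obtain d F where F: "homogeneous_tuple S d F" "\<phi> = rational_map S F" using *(1) by (auto simp: local_rule_def)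
  obtain d' G where G: "homogeneous_tuple S' d' G" "\<phi>' = rational_map S' G" and "finite S'"
    using *(3) by (auto simp: local_rule_def)
  obtain dK K where K: "homogeneous_tuple (S + S') dK K" "\<psi> = rational_map (S + S') K"
    using *(5) by (auto simp: local_rule_def)
  have F': "homogeneous_map S d (tuple_eval F)" and G': "homogeneous_map S' d' (tuple_eval G)"
    and K': "homogeneous_map (S + S') dK (tuple_eval K)"
    using F G K by (simp_all add: homogeneous_tuple_iff)
  have Ff: "parallel (tuple_eval F y) (f y)" for y
    by (rule lattice_of_eq_imp_parallel[OF F' f]) (simp add: *(2) F(2) lattice_map_of_rational_map[OF F(1)])
  have Gh: "parallel (tuple_eval G y) (h y)" for y
    by (rule lattice_of_eq_imp_parallel[OF G' h]) (simp add: *(4) G(2) lattice_map_of_rational_map[OF G(1)])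
  have "parallel (tuple_eval K x) (compose_rules h f x)" for x
  proof (rule ccontr)
    assume "\<not> parallel (tuple_eval K x) (compose_rules h f x)"
    then obtain j k where jk: "tuple_eval K x $ j * compose_rules h f x $ k - tuple_eval K x $ k * compose_rules h f x $ j \<noteq> 0"
      by (auto simp: parallel_def)
    let ?P = "\<lambda>x. tuple_eval K x $ j * compose_rules h f x $ k - tuple_eval K x $ k * compose_rules h f x $ j"
    have "polyfun ?P"
      using homogeneous_polyfun[OF K'] homogeneous_polyfun[OF c] by (intro polyfun_intros)
    then obtain y where y: "\<And>i. y i \<noteq> 0" "?P y \<noteq> 0" "compose_rules h f y \<noteq> 0"
      "(rational_map S' G \<circ>\<^sub>m regional_map S' S (rational_map S F)) (restrict (\<lambda>i. proj_point (y i)) (S + S'))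
        = Some (proj_point (compose_rules h f y))"
      using composite_generic[OF F(1) G(1) \<open>finite S'\<close> f Ff h Gh c, of ?P x] jk by blast
    then have "rational_map (S + S') K (restrict (\<lambda>i. proj_point (y i)) (S + S')) = Some (proj_point (compose_rules h f y))"
      using *(6) unfolding F(2) G(2) K(2) map_le_def by (metis domI)
    then have "regular_at (tuple_eval K) (\<lambda>i. proj_point (y i)) (proj_point (compose_rules h f y))"
      unfolding rational_map_Some_iff[OF K(1)] .
    then obtain g e where g: "homogeneous_map UNIV e g" "\<And>y. parallel (tuple_eval K y) (g y)" "g y \<noteq> 0"
        "proj_point (compose_rules h f y) = proj_point (g y)"
      by (rule regular_at_lift[of _ _ _ y]) (use y(1) in auto)
    then have "parallel (g y) (compose_rules h f y)" using y(3) by (metis proj_point_eq_iff)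
    then have "parallel (tuple_eval K y) (compose_rules h f y)"
      using g(2)[of y] g(3) parallel_trans parallel_sym by blast
    then show False using y(2) by (simp add: parallel_def)
  qed
  then show ?thesis
    using lattice_of_parallel[OF K' c] *(7) K(2) lattice_map_of_rational_map[OF K(1)] by simp
qed

section \<open>The local rule of the heat map\<close>

lemma in_span_pair: "c \<in> vec.span {a, b} \<longleftrightarrow> (\<exists>s t. c = s *s a + t *s b)"
  for a b c :: "complex ^ 'n::finite"
proof
  assume "c \<in> vec.span {a, b}"
  then obtain s where "c - s *s a \<in> vec.span {b}" unfolding vec.span_insert[of a] by blast
  then obtain t where "c - s *s a = t *s b" unfolding vec.span_singleton by blast
  then have "c = s *s a + t *s b" by (simp add: algebra_simps)
  then show "\<exists>s t. c = s *s a + t *s b" by blast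
next
  assume "\<exists>s t. c = s *s a + t *s b"
  moreover have "a \<in> vec.span {a, b}" "b \<in> vec.span {a, b}" by (simp_all add: vec.span_base)
  ultimately show "c \<in> vec.span {a, b}" using vec.span_add vec.span_scale by metis
qed

lemma proj_line_iff:
  assumes "a \<noteq> 0" "b \<noteq> 0" "c \<noteq> 0"
  shows "proj_point c \<in> proj_line (proj_point a) (proj_point b) \<longleftrightarrow> (\<exists>s t. c = s *s a + t *s b)"
proof -
  have "vec.span (vec.span {a} \<union> vec.span {b}) = vec.span {a, b}"
  proof (rule antisym)
    show "vec.span (vec.span {a} \<union> vec.span {b}) \<subseteq> vec.span {a, b}"
      by (intro vec.span_minimal Un_least vec.span_mono vec.subspace_span) auto
    show "vec.span {a, b} \<subseteq> vec.span (vec.span {a} \<union> vec.span {b})"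
      by (intro vec.span_mono) (auto simp: vec.span_base)
  qed
  moreover have "vec.span {c} \<subseteq> vec.span {a, b} \<longleftrightarrow> c \<in> vec.span {a, b}"
    using vec.span_base[of c "{c}"] vec.span_minimal[of "{c}" "vec.span {a, b}"] vec.subspace_span by blast
  ultimately show ?thesis
    using assms by (simp add: proj_line_def subspace_of_proj_point in_span_pair)
qed

lemma independent_if_distinct:
  assumes "a \<noteq> 0" "b \<noteq> 0" "proj_point a \<noteq> proj_point b" "s *s a + t *s b = 0"
  shows "s = 0 \<and> t = 0"
proof -
  have np: "\<not> parallel a b" using assms by (simp add: proj_point_eq_iff)
  have eq: "s * a $ j + t * b $ j = 0" for j
    using arg_cong[OF assms(4), of "\<lambda>v. v $ j"] by simp
  obtain j k where jk: "a $ j * b $ k \<noteq> a $ k * b $ j" using np by (auto simp: parallel_def)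
  have "s * (a $ j * b $ k - a $ k * b $ j) = (s * a $ j + t * b $ j) * b $ k - (s * a $ k + t * b $ k) * b $ j"
    "t * (a $ j * b $ k - a $ k * b $ j) = (s * a $ k + t * b $ k) * a $ j - (s * a $ j + t * b $ j) * a $ k"
    by (simp_all add: algebra_simps)
  then show ?thesis using jk unfolding eq by simp
qed

text \<open>
  Cramer's rule for a basis \<open>a\<close>, \<open>b\<close>, \<open>e\<close>, in which \<open>c\<close> has no component along \<open>e\<close>.
\<close>

lemma in_line_if_det3_zero:
  assumes "a \<noteq> 0" "b \<noteq> 0" "proj_point a \<noteq> proj_point b" "det3 c a b = 0"
  shows "\<exists>s t. c = s *s a + t *s b"
proof -
  have "\<exists>e. det3 a b e \<noteq> 0"
  proof (rule ccontr)
    assume "\<nexists>e. det3 a b e \<noteq> 0"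
    then have "det3 a b (axis 1 1) = 0" "det3 a b (axis 2 1) = 0" "det3 a b (axis 3 1) = 0" by blast+
    then have "parallel a b" by (auto simp: det3_def axis_def parallel_def forall_3 algebra_simps)
    then show False using assms by (simp add: proj_point_eq_iff)
  qed
  then obtain e where e: "det3 a b e \<noteq> 0" by blast
  have "det3 a b e *s c = det3 c b e *s a - det3 c a e *s b"
    unfolding cramer3[of a b e c] using assms(4) by simp
  then have "c = (det3 c b e / det3 a b e) *s a + (- det3 c a e / det3 a b e) *s b"
    using e by (simp add: vec3_eq_iff field_simps)
  then show ?thesis by blast
qed

text \<open>
  The relation between the four points gives the two auxiliary intersection points of the
  construction, and their difference lies on the line through \<open>x 1\<close> and \<open>x 2\<close>.
\<close>

lemma midpoint_is_heat_step:
  assumes x: "\<And>i. x i \<noteq> 0"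
    and mid: "projective_midpoint (restrict (\<lambda>i. proj_point (x i)) {0, 1, 2, 3}) w"
  shows "heat_step x 0 \<noteq> 0 \<and> w = proj_point (heat_step x 0)"
proof -
  let ?v = "\<lambda>i. proj_point (x i)"
  obtain a b where ne: "?v 0 \<noteq> ?v 2" "?v 1 \<noteq> ?v 3" "?v 0 \<noteq> ?v 1" "?v 2 \<noteq> ?v 3" "?v 1 \<noteq> ?v 2"
    and a: "proj_line (?v 0) (?v 2) \<inter> proj_line (?v 1) (?v 3) = {a}"
    and b: "proj_line (?v 0) (?v 1) \<inter> proj_line (?v 2) (?v 3) = {b}"
    and "a \<noteq> b" and w: "proj_line a b \<inter> proj_line (?v 1) (?v 2) = {w}"
    using mid unfolding projective_midpoint_def by auto
  define c0 c1 c2 c3 where "c0 = skip3 x 1" and "c1 = skip1 x 0" and "c2 = skip2 x 0" and "c3 = skip3 x 0"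
  have rel: "c0 *s x 0 = c1 *s x 1 - c2 *s x 2 + c3 *s x 3"
    using skip_relation[of x 0] by (simp add: c0_def c1_def c2_def c3_def)
  have nz: "\<not> (c0 = 0 \<and> c1 = 0 \<and> c2 = 0 \<and> c3 = 0)"
  proof
    (* otherwise the four points are collinear and the first two lines coincide *)
    assume "c0 = 0 \<and> c1 = 0 \<and> c2 = 0 \<and> c3 = 0"
    then have d: "det3 (x 1) (x 2) (x 3) = 0" "det3 (x 0) (x 2) (x 3) = 0" "det3 (x 0) (x 1) (x 3) = 0"
      by (simp_all add: c0_def c1_def c2_def skip1_def skip2_def skip3_def)
    have "\<exists>s t. x 0 = s *s x 1 + t *s x 3" using in_line_if_det3_zero[OF x x ne(2)] d(3) by blast
    moreover have "\<exists>s t. x 2 = s *s x 1 + t *s x 3"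
      using in_line_if_det3_zero[OF x x ne(2), of "x 2"] d(1) det3_swap(1)[of "x 2" "x 1" "x 3"] by auto
    moreover have "x 0 = 1 *s x 0 + 0 *s x 2" "x 2 = 0 *s x 0 + 1 *s x 2" by simp_all
    ultimately have "?v 0 \<in> proj_line (?v 0) (?v 2) \<inter> proj_line (?v 1) (?v 3)"
      "?v 2 \<in> proj_line (?v 0) (?v 2) \<inter> proj_line (?v 1) (?v 3)"
      using proj_line_iff[OF x x x] by (metis IntI)+
    then show False using a ne(1) by (metis singletonD)
  qed
  define A B where "A = c0 *s x 0 + c2 *s x 2" and "B = c0 *s x 0 + (- c1) *s x 1"
  have A': "A = c1 *s x 1 + c3 *s x 3" and B': "B = (- c2) *s x 2 + c3 *s x 3"
    using rel by (simp_all add: A_def B_def vec3_eq_iff algebra_simps)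
  have "A \<noteq> 0"
    using nz independent_if_distinct[OF x x ne(1), of c0 c2] independent_if_distinct[OF x x ne(2), of c1 c3]
    by (metis A' A_def)
  have "B \<noteq> 0"
    using nz independent_if_distinct[OF x x ne(3), of c0 "- c1"] independent_if_distinct[OF x x ne(4), of "- c2" c3]
    by (metis B' B_def neg_equal_0_iff_equal)
  have "proj_point A \<in> proj_line (?v 0) (?v 2) \<inter> proj_line (?v 1) (?v 3)"
    using proj_line_iff[OF x x \<open>A \<noteq> 0\<close>] A' A_def by blast
  then have aA: "a = proj_point A" using a by simp
  have "proj_point B \<in> proj_line (?v 0) (?v 1) \<inter> proj_line (?v 2) (?v 3)"
    using proj_line_iff[OF x x \<open>B \<noteq> 0\<close>] B' B_def by blast
  then have bB: "b = proj_point B" using b by simp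
  have W: "heat_step x 0 = 1 *s A + (- 1) *s B" "heat_step x 0 = c1 *s x 1 + c2 *s x 2"
    by (simp_all add: heat_step_def c1_def c2_def A_def B_def vec3_eq_iff)
  have "heat_step x 0 \<noteq> 0"
    using independent_if_distinct[OF \<open>A \<noteq> 0\<close> \<open>B \<noteq> 0\<close>, of 1 "- 1"] \<open>a \<noteq> b\<close> W(1) aA bB
    by (metis one_neq_zero)
  moreover from this have "proj_point (heat_step x 0) \<in> proj_line a b \<inter> proj_line (?v 1) (?v 2)"
    using proj_line_iff[OF x x] proj_line_iff[OF \<open>A \<noteq> 0\<close> \<open>B \<noteq> 0\<close>] W unfolding aA bB by blast
  ultimately show ?thesis using w by simp
qed

lemma relation_unique:
  assumes "det3 (p :: complex ^ 3) q r \<noteq> 0" "a *s p + b *s q + c *s r = 0"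
  shows "a = 0 \<and> b = 0 \<and> c = 0"
proof -
  have "det3 (a *s p + b *s q + c *s r) q r = a * det3 p q r"
    "det3 (a *s p + b *s q + c *s r) p r = - b * det3 p q r"
    "det3 (a *s p + b *s q + c *s r) p q = c * det3 p q r"
    using det3_swap(1)[of q p r] det3_swap(1)[of r p q] det3_swap(2)[of p r q]
    by (simp_all add: det3_add det3_scale det3_repeat)
  then show ?thesis using assms(1) unfolding assms(2) by (simp add: det3_zero)
qed

lemma line_intersection_unique:
  assumes nz: "p \<noteq> 0" "q \<noteq> 0" "p' \<noteq> 0" "q' \<noteq> 0" "c \<noteq> 0"
    and c: "c = s *s p + t *s q" "c = s' *s p' + t' *s q'"
    and only: "\<And>d s t s' t'. d = s *s p + t *s q \<Longrightarrow> d = s' *s p' + t' *s q' \<Longrightarrow> parallel c d"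
  shows "proj_line (proj_point p) (proj_point q) \<inter> proj_line (proj_point p') (proj_point q') = {proj_point c}"
proof -
  have "proj_point c \<in> proj_line (proj_point p) (proj_point q) \<inter> proj_line (proj_point p') (proj_point q')"
    using proj_line_iff nz c by blast
  moreover have "u = proj_point c"
    if u: "u \<in> proj_line (proj_point p) (proj_point q) \<inter> proj_line (proj_point p') (proj_point q')" for u
  proof -
    obtain d where d: "d \<noteq> 0" "proj_point d = u" using proj_point_cases by blast
    then have "parallel c d" using u proj_line_iff[of p q d] proj_line_iff[of p' q' d] nz only by blast
    then show ?thesis using d nz(5) by (metis proj_point_eq_iff)
  qed
  ultimately show ?thesis by blast
qed

text \<open>
  If the four brackets do not vanish, the relation between the points is unique up to a factor and has
  nonzero coefficients.  So each pair of lines meets in exactly the point read off from the relation.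
\<close>

lemma heat_step_is_midpoint:
  assumes x: "\<And>i. x i \<noteq> 0"
    and nz: "skip1 x 0 \<noteq> 0" "skip2 x 0 \<noteq> 0" "skip3 x 0 \<noteq> 0" "skip3 x 1 \<noteq> 0"
  shows "projective_midpoint (restrict (\<lambda>i. proj_point (x i)) {0, 1, 2, 3}) (proj_point (heat_step x 0))"
proof -
  let ?v = "\<lambda>i. proj_point (x i)"
  define c0 c1 c2 c3 where "c0 = skip3 x 1" and "c1 = skip1 x 0" and "c2 = skip2 x 0" and "c3 = skip3 x 0"
  have c: "c0 \<noteq> 0" "c1 \<noteq> 0" "c2 \<noteq> 0" "c3 \<noteq> 0" using nz by (simp_all add: c0_def c1_def c2_def c3_def)
  have rel: "c0 *s x 0 = c1 *s x 1 - c2 *s x 2 + c3 *s x 3"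
    using skip_relation[of x 0] by (simp add: c0_def c1_def c2_def c3_def)
  have d123: "det3 (x 1) (x 2) (x 3) \<noteq> 0" using c(1) by (simp add: c0_def skip3_def)
  have dets: "det3 (x 0) (x 2) (x 3) = c1" "det3 (x 0) (x 1) (x 3) = c2"
    by (simp_all add: c1_def c2_def skip1_def skip2_def)
  define A B where "A = c1 *s x 1 + c3 *s x 3" and "B = (- c2) *s x 2 + c3 *s x 3"
  have W: "heat_step x 0 = c1 *s x 1 + c2 *s x 2" "heat_step x 0 = 1 *s A + (- 1) *s B"
    by (simp_all add: heat_step_def c1_def c2_def A_def B_def vec3_eq_iff)
  have A': "A = c0 *s x 0 + c2 *s x 2" and B': "B = c0 *s x 0 + (- c1) *s x 1"
    using rel by (simp_all add: A_def B_def vec3_eq_iff algebra_simps)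
  have coeff: "c0 * p = - (s * c1) \<and> c0 * q = s * c2 \<and> c0 * r = - (s * c3)"
    if "s *s x 0 + p *s x 1 + q *s x 2 + r *s x 3 = 0" for s p q r
  proof -
    have "c0 *s (s *s x 0 + p *s x 1 + q *s x 2 + r *s x 3)
        = s *s (c0 *s x 0) + (c0 * p) *s x 1 + (c0 * q) *s x 2 + (c0 * r) *s x 3"
      by (simp add: vec3_eq_iff algebra_simps)
    also have "\<dots> = (s * c1 + c0 * p) *s x 1 + (c0 * q - s * c2) *s x 2 + (c0 * r + s * c3) *s x 3"
      unfolding rel by (simp add: vec3_eq_iff algebra_simps)
    finally have "(s * c1 + c0 * p) *s x 1 + (c0 * q - s * c2) *s x 2 + (c0 * r + s * c3) *s x 3 = 0"
      unfolding that by simp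
    then have "s * c1 + c0 * p = 0 \<and> c0 * q - s * c2 = 0 \<and> c0 * r + s * c3 = 0"
      by (rule relation_unique[OF d123])
    then show ?thesis by (auto simp: add_eq_0_iff)
  qed
  have nzW: "heat_step x 0 \<noteq> 0" "A \<noteq> 0" "B \<noteq> 0"
    using relation_unique[OF d123, of c1 c2 0] relation_unique[OF d123, of c1 0 c3]
      relation_unique[OF d123, of 0 "- c2" c3] c
    by (auto simp: W(1) A_def B_def)
  have ne: "?v i \<noteq> ?v j" if "\<exists>k. det3 (x i) (x j) (x k) \<noteq> 0" for i j
  proof
    assume "?v i = ?v j"
    then obtain t where "x j = t *s x i" using x by (auto simp: proj_point_eq_iff parallel_iff_multiple)
    then show False using that by (simp add: det3_scale det3_repeat)
  qed
  have "?v 0 \<noteq> ?v 2" "?v 0 \<noteq> ?v 1" "?v 1 \<noteq> ?v 2"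
    using dets c d123 by (auto intro!: ne)
  moreover have "?v 1 \<noteq> ?v 3"
    using d123 det3_swap(2)[of "x 1" "x 3" "x 2"] by (intro ne exI[of _ 2]) simp
  moreover have "?v 2 \<noteq> ?v 3"
    using d123 det3_swap(1)[of "x 2" "x 1" "x 3"] det3_swap(2)[of "x 2" "x 3" "x 1"]
    by (intro ne exI[of _ 1]) simp
  moreover have "proj_line (?v 0) (?v 2) \<inter> proj_line (?v 1) (?v 3) = {proj_point A}"
  proof (rule line_intersection_unique[OF x x x x nzW(2) A' A_def])
    fix d s t s' t' assume d: "d = s *s x 0 + t *s x 2" "d = s' *s x 1 + t' *s x 3"
    have "s *s x 0 + (- s') *s x 1 + t *s x 2 + (- t') *s x 3 = 0"
      using d by (simp add: vec3_eq_iff algebra_simps)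
    then have "c0 * t = s * c2" using coeff by blast
    then have "c0 *s d = s *s A" unfolding d(1) A' by (simp add: vec3_eq_iff algebra_simps)
    then have "d = (s / c0) *s A" using c(1) by (simp add: vec3_eq_iff field_simps)
    then show "parallel A d" by (simp add: parallel_def)
  qed
  moreover have "proj_line (?v 0) (?v 1) \<inter> proj_line (?v 2) (?v 3) = {proj_point B}"
  proof (rule line_intersection_unique[OF x x x x nzW(3) B' B_def])
    fix d s t s' t' assume d: "d = s *s x 0 + t *s x 1" "d = s' *s x 2 + t' *s x 3"
    have "s *s x 0 + t *s x 1 + (- s') *s x 2 + (- t') *s x 3 = 0"
      using d by (simp add: vec3_eq_iff algebra_simps)
    then have "c0 * t = - (s * c1)" using coeff by blast
    then have "c0 *s d = s *s B" unfolding d(1) B' by (simp add: vec3_eq_iff algebra_simps)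
    then have "d = (s / c0) *s B" using c(1) by (simp add: vec3_eq_iff field_simps)
    then show "parallel B d" by (simp add: parallel_def)
  qed
  moreover have "proj_line (proj_point A) (proj_point B) \<inter> proj_line (?v 1) (?v 2) = {proj_point (heat_step x 0)}"
  proof (rule line_intersection_unique[OF nzW(2,3) x x nzW(1) W(2,1)])
    fix d s t s' t' assume d: "d = s *s A + t *s B" "d = s' *s x 1 + t' *s x 2"
    have "(s * c1 - s') *s x 1 + (- t * c2 - t') *s x 2 + ((s + t) * c3) *s x 3 = 0"
      using d by (simp add: A_def B_def vec3_eq_iff algebra_simps)
    then have "(s + t) * c3 = 0" using relation_unique[OF d123] by blast
    then have "t = - s" using c(4) by (simp add: add_eq_0_iff)
    then have "d = s *s heat_step x 0" unfolding d(1) W(2) by (simp add: vec3_eq_iff algebra_simps)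
    then show "parallel (heat_step x 0) d" by (simp add: parallel_def)
  qed
  moreover have "proj_point A \<noteq> proj_point B"
  proof
    assume "proj_point A = proj_point B"
    then obtain t where "B = t *s A" using nzW by (auto simp: proj_point_eq_iff parallel_iff_multiple)
    then have "(t * c1) *s x 1 + c2 *s x 2 + ((t - 1) * c3) *s x 3 = 0"
      by (simp add: A_def B_def vec3_eq_iff algebra_simps)
    then show False using relation_unique[OF d123] c(3) by blast
  qed
  ultimately show ?thesis unfolding projective_midpoint_def by auto
qed

section \<open>The iterates of the heat map and their degrees\<close>

text \<open>
  The coefficients of the polynomial \<open>(1 + z + z\<^sup>2 + z\<^sup>3) ^ m\<close>.
\<close>

fun heat_degree :: "nat \<Rightarrow> int \<Rightarrow> nat" where
  "heat_degree 0 i = (if i = 0 then 1 else 0)"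
| "heat_degree (Suc m) i = (\<Sum>s\<in>{0..3}. heat_degree m (i - s))"

lemma heat_degree_support: "i \<notin> {0..3 * int m} \<Longrightarrow> heat_degree m i = 0"
  by (induction m arbitrary: i) auto

lemma sum_heat_degree: "(\<Sum>i\<in>{0..3 * int m}. heat_degree m i) = 4 ^ m"
proof (induction m)
  case (Suc m)
  have "(\<Sum>i\<in>{0..3 * int (Suc m)}. heat_degree m (i - s)) = 4 ^ m" if s: "s \<in> {0..3}" for s
  proof -
    have "(\<Sum>i\<in>{0..3 * int (Suc m)}. heat_degree m (i - s)) = (\<Sum>i\<in>{s..s + 3 * int m}. heat_degree m (i - s))"
      by (rule sum.mono_neutral_right) (use s in \<open>auto intro!: heat_degree_support\<close>)
    also have "\<dots> = (\<Sum>i\<in>{0..3 * int m}. heat_degree m i)"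
      by (rule sum.reindex_bij_witness[of _ "\<lambda>i. i + s" "\<lambda>i. i - s"]) auto
    finally show ?thesis using Suc by simp
  qed
  then show ?case by (simp only: heat_degree.simps) (subst sum.swap, simp)
qed simp

lemma heat_step_rescale:
  assumes "\<And>s. s \<in> {0..3} \<Longrightarrow> y (i + s) = t s *s x (i + s)"
  shows "heat_step y i = (\<Prod>s\<in>{0..3 :: int}. t s) *s heat_step x i"
proof -
  have "{0..3 :: int} = {0, 1, 2, 3}" by auto
  then have "(\<Prod>s\<in>{0..3 :: int}. t s) = t 0 * t 1 * t 2 * t 3" by (simp add: mult.assoc)
  moreover have "y i = t 0 *s x i" "y (i + 1) = t 1 *s x (i + 1)" "y (i + 2) = t 2 *s x (i + 2)"
    "y (i + 3) = t 3 *s x (i + 3)" using assms[of 0] assms[of 1] assms[of 2] assms[of 3] by simp_all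
  ultimately show ?thesis
    by (simp add: heat_step_def skip1_def skip2_def det3_scale) (simp add: vec3_eq_iff algebra_simps)
qed

lemma heat_iterate_scale_site:
  "(heat_step ^^ m) (scale_site i c x) n = c ^ heat_degree m (i - n) *s (heat_step ^^ m) x n"
proof (induction m arbitrary: n)
  case 0
  then show ?case by (auto simp: scale_site_def)
next
  case (Suc m)
  have "(heat_step ^^ Suc m) (scale_site i c x) n
      = (\<Prod>s\<in>{0..3}. c ^ heat_degree m (i - (n + s))) *s (heat_step ^^ Suc m) x n"
    unfolding funpow.simps comp_def by (rule heat_step_rescale) (rule Suc)
  then show ?case by (simp add: power_sum[symmetric] algebra_simps)
qed

definition heat_iterate_rule :: "nat \<Rightarrow> (int \<Rightarrow> complex ^ 3) \<Rightarrow> complex ^ 3" where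
  "heat_iterate_rule m x = (heat_step ^^ m) x 0"

lemma homogeneous_heat_iterate:
  "homogeneous_map {0..3 * int m} (heat_degree m) (heat_iterate_rule m)"
  unfolding homogeneous_map_def heat_iterate_rule_def
proof (intro conjI allI)
  show "\<exists>x. (heat_step ^^ m) x 0 \<noteq> 0"
    using positive_config_nonzero[OF heat_iterate_positive[OF parabola_positive]] by blast
  show "(heat_step ^^ m) (scale_site i c x) 0
      = (if i \<in> {0..3 * int m} then c ^ heat_degree m i else 1) *s (heat_step ^^ m) x 0" for i c x
    using heat_degree_support[of i m] by (auto simp: heat_iterate_scale_site)
qed (rule polyfun_heat_iterate)

lemma compose_heat_iterate:
  "compose_rules (heat_iterate_rule 1) (heat_iterate_rule m) = heat_iterate_rule (Suc m)"
proof
  fix x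
  have "heat_iterate_rule m (shift s x) = (heat_step ^^ m) x s" for s
    using heat_iterate_shift[of m x s 0]
    by (simp add: heat_iterate_rule_def shift_def add.commute)
  then show "compose_rules (heat_iterate_rule 1) (heat_iterate_rule m) x = heat_iterate_rule (Suc m) x"
    by (simp add: compose_rules_def heat_iterate_rule_def)
qed

text \<open>
  Every local rule that extends the geometric construction has the prescribed values at generic points,
  hence it is proportional to the heat step.
\<close>

lemma heat_rule_eq:
  assumes F: "tuple_eval F = heat_iterate_rule 1"
  shows "heat_rule = rational_map {0..3} F"
proof -
  have S: "{0, 1, 2, 3 :: int} = {0..3}" by auto
  have f: "homogeneous_map {0..3} (heat_degree 1) (heat_iterate_rule 1)"
    using homogeneous_heat_iterate[of 1] unfolding of_nat_1 mult_1_right .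
  have F': "homogeneous_tuple {0..3} (heat_degree 1) F" unfolding homogeneous_tuple_iff F by (rule f)
  have mid: "heat_step x 0 \<noteq> 0 \<and> w = proj_point (heat_step x 0)"
    if "\<And>i. x i \<noteq> 0" "projective_midpoint (restrict (\<lambda>i. proj_point (x i)) {0..3}) w" for x w
    using midpoint_is_heat_step that unfolding S by blast
  have mid_Some: "partial_map_of projective_midpoint (restrict (\<lambda>i. proj_point (x i)) {0..3}) = Some w \<longleftrightarrow>
      projective_midpoint (restrict (\<lambda>i. proj_point (x i)) {0..3}) w" if "\<And>i. x i \<noteq> 0" for x w
    by (rule partial_map_of_Some_iff) (use mid that in blast)
  show ?thesis
    unfolding heat_rule_def S
  proof (rule the_equality)
    have "partial_map_of projective_midpoint \<subseteq>\<^sub>m rational_map {0..3} F"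
      unfolding map_le_def
    proof
      fix v assume "v \<in> dom (partial_map_of projective_midpoint)"
      then obtain w where w: "partial_map_of projective_midpoint v = Some w" by blast
      obtain x where x: "\<And>i. x i \<noteq> 0 \<and> proj_point (x i) = v i" using config_lift by metis
      have "v \<in> {0..3} \<rightarrow>\<^sub>E UNIV"
        using w by (auto simp: partial_map_of_def projective_midpoint_def S split: if_splits)
      then have v: "restrict (\<lambda>i. proj_point (x i)) {0..3} = v" using x by (simp add: PiE_restrict)
      then have m: "heat_step x 0 \<noteq> 0" "w = proj_point (heat_step x 0)"
        using w mid_Some[of x w] mid[of x w] x by auto
      have "regular_at (heat_iterate_rule 1) (\<lambda>i. proj_point (x i)) (proj_point (heat_iterate_rule 1 x))"
        by (rule regular_at_self[OF f]) (use x m in \<open>auto simp: heat_iterate_rule_def\<close>)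
      then have "rational_map {0..3} F v = Some w"
        using rational_map_Some_iff[OF F', of "\<lambda>i. proj_point (x i)" w] v m
        by (simp add: F heat_iterate_rule_def)
      then show "partial_map_of projective_midpoint v = rational_map {0..3} F v" using w by simp
    qed
    then show "local_rule {0..3} (rational_map {0..3} F) \<and>
        partial_map_of projective_midpoint \<subseteq>\<^sub>m rational_map {0..3} F"
      using F' by (auto simp: local_rule_def)
  next
    fix \<phi> assume \<phi>: "local_rule {0..3} \<phi> \<and> partial_map_of projective_midpoint \<subseteq>\<^sub>m \<phi>"
    then obtain d G where G: "homogeneous_tuple {0..3} d G" "\<phi> = rational_map {0..3} G"
      by (auto simp: local_rule_def)
    have g: "homogeneous_map {0..3} d (tuple_eval G)" using G by (simp add: homogeneous_tuple_iff)
    have par: "parallel (tuple_eval G x) (heat_iterate_rule 1 x)" for x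
    proof (rule parallel_if_generically[OF homogeneous_polyfun[OF g] homogeneous_polyfun[OF f],
          of "{\<lambda>x. skip1 x 0, \<lambda>x. skip2 x 0, \<lambda>x. skip3 x 0, \<lambda>x. skip3 x 1}"])
      show "polyfun q" if "q \<in> {\<lambda>x. skip1 x 0, \<lambda>x. skip2 x 0, \<lambda>x. skip3 x 0, \<lambda>x. skip3 x 1}" for q
        using that by (auto simp: polyfun_skip)
      show "\<exists>x. q x \<noteq> 0" if "q \<in> {\<lambda>x. skip1 x 0, \<lambda>x. skip2 x 0, \<lambda>x. skip3 x 0, \<lambda>x. skip3 x 1}" for q
        using that parabola_positive unfolding positive_config_def skip1_def skip2_def skip3_def
        by (intro exI[of _ parabola]) auto
      fix y assume y: "\<And>i. y i \<noteq> 0" and nz: "\<And>q. q \<in> {\<lambda>x. skip1 x 0, \<lambda>x. skip2 x 0, \<lambda>x. skip3 x 0, \<lambda>x. skip3 x 1} \<Longrightarrow> q y \<noteq> 0"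
      have "skip1 y 0 \<noteq> 0" "skip2 y 0 \<noteq> 0" "skip3 y 0 \<noteq> 0" "skip3 y 1 \<noteq> 0"
        using nz by blast+
      then have m: "projective_midpoint (restrict (\<lambda>i. proj_point (y i)) {0..3}) (proj_point (heat_step y 0))"
        using heat_step_is_midpoint[of y, OF y] unfolding S by blast
      then have "partial_map_of projective_midpoint (restrict (\<lambda>i. proj_point (y i)) {0..3}) = Some (proj_point (heat_step y 0))"
        unfolding mid_Some[of y, OF y] .
      then have "\<phi> (restrict (\<lambda>i. proj_point (y i)) {0..3}) = Some (proj_point (heat_step y 0))"
        using \<phi> unfolding map_le_def by (metis domI)
      then have "regular_at (tuple_eval G) (\<lambda>i. proj_point (y i)) (proj_point (heat_step y 0))"
        unfolding G(2) rational_map_Some_iff[OF G(1)] .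
      then obtain p e where p: "homogeneous_map UNIV e p" "\<And>y. parallel (tuple_eval G y) (p y)" "p y \<noteq> 0"
          "proj_point (heat_step y 0) = proj_point (p y)"
        by (rule regular_at_lift[of _ _ _ y]) (use y in auto)
      moreover have "heat_step y 0 \<noteq> 0" using mid[of y, OF y m] by blast
      ultimately have "parallel (p y) (heat_step y 0)" by (metis proj_point_eq_iff)
      then have "parallel (tuple_eval G y) (heat_step y 0)"
        using p parallel_trans parallel_sym by blast
      then show "parallel (tuple_eval G y) (heat_iterate_rule 1 y)" by (simp add: heat_iterate_rule_def)
    qed simp
    have "rational_map {0..3} G v = rational_map {0..3} F v" for v
    proof (cases "v \<in> {0..3} \<rightarrow>\<^sub>E UNIV")
      case True
      then have v: "restrict v {0..3} = v" by (simp add: PiE_restrict)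
      have "rational_map {0..3} G v = Some w \<longleftrightarrow> rational_map {0..3} F v = Some w" for w
        using rational_map_Some_iff[OF G(1), of v w] rational_map_Some_iff[OF F', of v w]
          regular_at_parallel[OF g f par] by (simp add: v F)
      then show ?thesis by (metis option.exhaust)
    next
      case False
      then show ?thesis using rational_map_domain by (metis option.exhaust)
    qed
    then show "\<phi> = rational_map {0..3} F" using G(2) by (auto simp: fun_eq_iff)
  qed
qed

lemma heat_map_eq: "heat_map = lattice_of (heat_iterate_rule 1)"
proof -
  have f: "homogeneous_map {0..3} (heat_degree 1) (heat_iterate_rule 1)"
    using homogeneous_heat_iterate[of 1] unfolding of_nat_1 mult_1_right .
  obtain F where F: "tuple_eval F = heat_iterate_rule 1"
    using tuple_eval_surj homogeneous_polyfun[OF f] by blast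
  have S: "{0, 1, 2, 3 :: int} = {0..3}" by auto
  have "homogeneous_tuple {0..3} (heat_degree 1) F" unfolding homogeneous_tuple_iff F by (rule f)
  then show ?thesis
    unfolding heat_map_def heat_rule_eq[OF F] S using lattice_map_of_rational_map F by metis
qed

lemma lattice_of_site: "lattice_of (heat_iterate_rule 0) = Some"
proof
  fix v :: "int \<Rightarrow> 3 proj"
  have f: "homogeneous_map {0..3 * int 0} (heat_degree 0) (heat_iterate_rule 0)"
    by (rule homogeneous_heat_iterate)
  obtain x where x: "\<And>i. x i \<noteq> 0 \<and> proj_point (x i) = v i" using config_lift by metis
  have "regular_at (heat_iterate_rule 0) (shift i v) (v i)" for i
    using regular_at_self[OF f, of "shift i x" "shift i v"] x
    by (simp add: heat_iterate_rule_def shift_def)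
  then show "lattice_of (heat_iterate_rule 0) v = Some v"
    unfolding lattice_of_Some_iff[OF f] by blast
qed

lemma set_plus_intervals: "{0..3 * int m} + {0..3} = {0..3 * int (Suc m)}"
proof
  show "{0..3 * int (Suc m)} \<subseteq> {0..3 * int m} + {0..3}"
  proof
    fix i assume i: "i \<in> {0..3 * int (Suc m)}"
    have "min i (3 * int m) \<in> {0..3 * int m}" "i - min i (3 * int m) \<in> {0..3}" using i by auto
    then have "min i (3 * int m) + (i - min i (3 * int m)) \<in> {0..3 * int m} + {0..3}" by (rule set_plus_intro)
    then show "i \<in> {0..3 * int m} + {0..3}" by simp
  qed
qed (auto simp: set_plus_def)

lemma is_iterate_heat_map_iff: "is_iterate heat_map m U \<longleftrightarrow> U = lattice_of (heat_iterate_rule m)"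
proof
  assume "is_iterate heat_map m U"
  then show "U = lattice_of (heat_iterate_rule m)"
  proof induction
    case 1
    show ?case using lattice_of_site by simp
  next
    case (2 m U U')
    have "U' = lattice_of (compose_rules (heat_iterate_rule 1) (heat_iterate_rule m))"
    proof (rule is_composite_unique)
      show "is_composite (lattice_of (heat_iterate_rule 1)) (lattice_of (heat_iterate_rule m)) U'"
        using 2 by (simp add: heat_map_eq)
    qed (unfold compose_heat_iterate, (rule homogeneous_heat_iterate)+)
    then show ?case by (simp only: compose_heat_iterate)
  qed
next
  have "is_iterate heat_map m (lattice_of (heat_iterate_rule m))"
  proof (induction m)
    case 0
    show ?case unfolding lattice_of_site by (rule is_iterate.intros)
  next
    case (Suc m)
    have "\<exists>F. tuple_eval F = heat_iterate_rule m" for m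
      using tuple_eval_surj homogeneous_polyfun[OF homogeneous_heat_iterate] by blast
    then obtain F G K where FGK: "tuple_eval F = heat_iterate_rule m" "tuple_eval G = heat_iterate_rule 1"
      "tuple_eval K = heat_iterate_rule (Suc m)" by metis
    have "is_composite (lattice_of (tuple_eval G)) (lattice_of (tuple_eval F)) (lattice_of (tuple_eval K))"
    proof (rule is_composite_lattice_of)
      show "homogeneous_tuple {0..3 * int m} (heat_degree m) F" "homogeneous_tuple {0..3} (heat_degree 1) G"
        "homogeneous_tuple ({0..3 * int m} + {0..3}) (heat_degree (Suc m)) K"
        using homogeneous_heat_iterate[of m] homogeneous_heat_iterate[of 1]
          homogeneous_heat_iterate[of "Suc m"]
        unfolding homogeneous_tuple_iff FGK set_plus_intervals by simp_all
      show "tuple_eval K = compose_rules (tuple_eval G) (tuple_eval F)"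
        unfolding FGK compose_heat_iterate ..
    qed auto
    then show ?case using Suc by (auto simp: FGK heat_map_eq intro: is_iterate.intros)
  qed
  moreover assume "U = lattice_of (heat_iterate_rule m)"
  ultimately show "is_iterate heat_map m U" by simp
qed

lemma no_common_factor_if_coprime:
  assumes "coprime_tuple (\<lambda>j x. tuple_eval F x $ j)" "tuple_eval F a \<noteq> 0"
  shows "no_common_factor F"
  unfolding no_common_factor_def
proof (intro allI impI)
  fix h assume h: "\<forall>j. h dvd F j"
  have "\<forall>j. divides (mpoly_eval h) (\<lambda>x. tuple_eval F x $ j)"
    using h by (simp add: mpoly_dvd_iff tuple_eval_def)
  then obtain K where K: "\<And>j. polyfun (K j)" "\<And>j x. tuple_eval F x $ j = mpoly_eval h x * K j x"
    unfolding divides_def by metis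
  have "tuple_eval F x $ j * K k x = tuple_eval F x $ k * K j x" for j k x
    unfolding K(2) by (simp add: mult_ac)
  then obtain N where N: "polyfun N" "\<And>j x. K j x = N x * tuple_eval F x $ j"
    using assms(1) K(1) unfolding coprime_tuple_def by blast
  obtain j where j: "tuple_eval F a $ j \<noteq> 0" using assms(2) by (auto simp: vec_eq_iff)
  have "mpoly_eval h x * N x = 1" for x
  proof (rule polyfun_cancel[of "\<lambda>x. tuple_eval F x $ j", OF _ _ _ j])
    show "polyfun (\<lambda>x. tuple_eval F x $ j)" using assms(1) by (simp add: coprime_tuple_def)
    show "tuple_eval F x $ j * (mpoly_eval h x * N x) = tuple_eval F x $ j * 1" for x
      using K(2)[of x j] N(2)[of j x] by (simp add: mult_ac)
  qed (use N polyfun_mpoly_eval in \<open>auto intro: polyfun_intros\<close>)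
  then have "mpoly_eval 1 x = mpoly_eval h x * N x" for x
    using mpoly_eval_single[of 0 1 x] by (simp add: monom_eval_def)
  then show "h dvd 1" unfolding mpoly_dvd_iff divides_def using N(1) by blast
qed

lemma homogeneous_map_total_scaling:
  assumes "homogeneous_map S d f" "finite S"
  shows "f (\<lambda>i. c *s x i) = c ^ (\<Sum>i\<in>S. d i) *s f x"
proof -
  have "f (\<lambda>i. c *s x i) = f (\<lambda>i. if i \<in> S then c *s x i else x i)"
    by (rule homogeneous_map_cong[OF assms(1)]) simp
  also have "\<dots> = (\<Prod>i\<in>S. c ^ (if i \<in> S then d i else 0)) *s f x"
    by (rule homogeneous_map_rescale[OF homogeneous_map_UNIV[OF assms(1)] assms(2)])
  finally show ?thesis by (simp add: power_sum)
qed

text \<open>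
  Along the line through the origin and \<open>x\<close> the function is \<open>c ^ e * N x\<close>, which would vanish at \<open>c = 0\<close>.
\<close>

lemma unit_polyfun_degree:
  assumes "polyfun N" "N (\<lambda>_. 0) \<noteq> 0" "\<And>c. c \<noteq> 0 \<Longrightarrow> N (\<lambda>i. c *s x i) = c ^ e * N x"
  shows "e = 0"
proof (rule ccontr)
  assume "e \<noteq> 0"
  obtain p where p: "\<And>t. N (\<lambda>i. 0 + t *s x i) = poly p t"
    using polyfun_on_line[OF assms(1), of "\<lambda>_. 0" x] by blast
  have "poly p t = poly (monom (N x) e) t" if "t \<noteq> 0" for t
    using p[of t] assms(3)[OF that] by (simp add: poly_monom mult.commute)
  then have "UNIV - {0} \<subseteq> {t. poly (p - monom (N x) e) t = 0}" by auto
  moreover have "infinite (UNIV - {0 :: complex})" by (simp add: infinite_UNIV_char_0)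
  ultimately have "p - monom (N x) e = 0" using poly_roots_finite finite_subset by blast
  then have "poly p 0 = 0" using \<open>e \<noteq> 0\<close> by (simp add: poly_monom)
  then show False using p[of 0] assms(2) by simp
qed

text \<open>
  By coprimality every representative is \<open>N * f\<close>.  If it has no common factor either, then \<open>N\<close> is a
  unit, and comparing the behaviour under scaling shows that the total degrees agree.
\<close>

lemma coprime_degree_unique:
  assumes f: "homogeneous_map S d f" "finite S" "coprime_tuple (\<lambda>j x. f x $ j)"
    and G: "homogeneous_tuple S' d' G" "finite S'" "no_common_factor G"
    and par: "\<And>x. parallel (f x) (tuple_eval G x)"
  shows "(\<Sum>i\<in>S'. d' i) = (\<Sum>i\<in>S. d i)"
proof -
  have g: "homogeneous_map S' d' (tuple_eval G)" using G by (simp add: homogeneous_tuple_iff)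
  have "\<forall>j k x. f x $ j * tuple_eval G x $ k = f x $ k * tuple_eval G x $ j"
    using par by (simp add: parallel_def)
  then obtain N where N: "polyfun N" "\<And>j x. tuple_eval G x $ j = N x * f x $ j"
    using f(3) homogeneous_polyfun[OF g] unfolding coprime_tuple_def by meson
  obtain n where n: "mpoly_eval n = N" using polyfun_is_mpoly_eval[OF N(1)] by blast
  have "n dvd G j" for j
    unfolding mpoly_dvd_iff divides_def n
    by (rule exI[of _ "\<lambda>x. f x $ j"]) (use N(2)[of _ j] homogeneous_polyfun[OF f(1)] in \<open>simp add: tuple_eval_def\<close>)
  then have "n dvd 1" using G(3) by (simp add: no_common_factor_def)
  then obtain N' where N': "polyfun N'" "\<And>x. mpoly_eval 1 x = N x * N' x"
    unfolding mpoly_dvd_iff divides_def n by blast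
  have one: "N x * N' x = 1" for x
    using N'(2)[of x] mpoly_eval_single[of 0 1 x] by (simp add: monom_eval_def)
  obtain j x where j: "f x $ j \<noteq> 0" using homogeneous_map_component[OF f(1)] by blast
  define D D' where "D = (\<Sum>i\<in>S. d i)" and "D' = (\<Sum>i\<in>S'. d' i)"
  have sc: "c ^ D' * N x = N (\<lambda>i. c *s x i) * c ^ D" for c
  proof -
    have "c ^ D' * (N x * f x $ j) = N (\<lambda>i. c *s x i) * (c ^ D * f x $ j)"
      using N(2)[of "\<lambda>i. c *s x i" j] homogeneous_map_total_scaling[OF g G(2), of c x]
        homogeneous_map_total_scaling[OF f(1,2), of c x] N(2)[of x j]
      by (simp add: D_def D'_def)
    then show ?thesis using j by simp
  qed
  have unit: "N (\<lambda>_. 0) \<noteq> 0" "N' (\<lambda>_. 0) \<noteq> 0" using one[of "\<lambda>_. 0"] by auto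
  have "D' \<le> D"
  proof (rule ccontr)
    assume "\<not> D' \<le> D"
    moreover have "N (\<lambda>i. c *s x i) = c ^ (D' - D) * N x" if "c \<noteq> 0" for c
      using sc[of c] that \<open>\<not> D' \<le> D\<close> by (simp add: power_diff field_simps)
    ultimately show False
      using unit_polyfun_degree[OF N(1) unit(1), of x "D' - D"] by auto
  qed
  moreover have "D \<le> D'"
  proof (rule ccontr)
    assume "\<not> D \<le> D'"
    moreover have "N' (\<lambda>i. c *s x i) = c ^ (D - D') * N' x" if "c \<noteq> 0" for c
    proof -
      have "N' (\<lambda>i. c *s x i) * (c ^ D' * N x) = (N (\<lambda>i. c *s x i) * N' (\<lambda>i. c *s x i)) * c ^ D"
        unfolding sc[of c] by (simp add: mult_ac)
      then have "N' (\<lambda>i. c *s x i) * c ^ D' * (N x * N' x) = c ^ D * N' x"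
        using one[of "\<lambda>i. c *s x i"] by (simp add: mult.assoc[symmetric])
      then have "N' (\<lambda>i. c *s x i) * c ^ D' = c ^ D * N' x" unfolding one mult_1_right .
      then show ?thesis using that \<open>\<not> D \<le> D'\<close> by (simp add: power_diff field_simps)
    qed
    ultimately show False
      using unit_polyfun_degree[OF N'(1) unit(2), of x "D - D'"] by auto
  qed
  ultimately show ?thesis by (simp add: D_def D'_def)
qed

lemma lattice_degree_heat_iterate: "lattice_degree (lattice_of (heat_iterate_rule m)) = 4 ^ m"
proof -
  let ?S = "{0..3 * int m}" and ?f = "heat_iterate_rule m"
  have f: "homogeneous_map ?S (heat_degree m) ?f" by (rule homogeneous_heat_iterate)
  have cop: "coprime_tuple (\<lambda>j x. ?f x $ j)"
    using coprime_heat_iterate[of m] by (simp add: heat_iterate_rule_def)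
  obtain F where F: "tuple_eval F = ?f" using tuple_eval_surj homogeneous_polyfun[OF f] by blast
  show ?thesis
    unfolding lattice_degree_def
  proof (rule the_equality)
    obtain a where "?f a \<noteq> 0" using f unfolding homogeneous_map_def by blast
    then have "no_common_factor F" using no_common_factor_if_coprime[of F a] cop F by simp
    moreover have F': "homogeneous_tuple ?S (heat_degree m) F" by (simp add: homogeneous_tuple_iff F f)
    ultimately show "\<exists>S d F. finite S \<and> S \<noteq> {} \<and> homogeneous_tuple S d F \<and> no_common_factor F \<and>
        lattice_of ?f = lattice_map_of S (rational_map S F) \<and> 4 ^ m = (\<Sum>i\<in>S. d i)"
      using lattice_map_of_rational_map[OF F'] F sum_heat_degree[of m]
      by (intro exI[of _ ?S] exI[of _ "heat_degree m"] exI[of _ F]) auto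
  next
    fix n
    assume "\<exists>S d F. finite S \<and> S \<noteq> {} \<and> homogeneous_tuple S d F \<and> no_common_factor F \<and>
        lattice_of ?f = lattice_map_of S (rational_map S F) \<and> n = (\<Sum>i\<in>S. d i)"
    then obtain S d G where G: "finite S" "homogeneous_tuple S d G" "no_common_factor G"
      "lattice_of ?f = lattice_of (tuple_eval G)" "n = (\<Sum>i\<in>S. d i)"
      using lattice_map_of_rational_map by metis
    have g: "homogeneous_map S d (tuple_eval G)" using G by (simp add: homogeneous_tuple_iff)
    have "n = (\<Sum>i\<in>?S. heat_degree m i)"
      unfolding G(5)
      by (rule coprime_degree_unique[OF f _ cop G(2,1,3)]) (use lattice_of_eq_imp_parallel[OF f g G(4)] in auto)
    then show "n = 4 ^ m" by (simp add: sum_heat_degree)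
  qed
qed

theorem corollary7p20:
  shows "has_dynamical_degree heat_map 4"
proof -
  have "iterate heat_map m = lattice_of (heat_iterate_rule m)" for m
    unfolding iterate_def is_iterate_heat_map_iff by simp
  then have deg: "root m (real (lattice_degree (iterate heat_map m))) = 4" if "0 < m" for m
    using that by (simp add: lattice_degree_heat_iterate real_root_power_cancel)
  have "(\<lambda>m. root m (real (lattice_degree (iterate heat_map m)))) \<longlonglongrightarrow> 4"
    by (rule tendsto_eventually) (use deg in \<open>auto simp: eventually_at_top_dense\<close>)
  then show ?thesis
    unfolding has_dynamical_degree_def iterable_def is_iterate_heat_map_iff by blast
qed

end
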